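(* Let $n\geq 6$, let $f\colon M^2\to\mathbb{R}^n$ be a substantial $1$-isotropic surface, and let $g\colon M^2\to\mathbb{R}^n$ be a pedal surface to $f$ (with respect to some fixed point of $\mathbb{R}^n$; $g$ is assumed to be an immersion). Then $g$ is superconformal if and only if $f$ is $2$-isotropic. In this case, the following hold: (i) The surfaces $f$ and $g$ are conformal, i.e., the metrics induced on $M^2$ by $f$ and by $g$ are conformal. (ii) The surface $g$ is not locally conformally equivalent to a minimal surface, i.e., there is no nonempty open subset $U\subset M^2$ and no Moebius transformation $T$ of $\mathbb{R}^n\cup\{\infty\}$ such that $T\circ g|_U$ is a minimal surface in $\mathbb{R}^n$. (iii) The surface $g$ is not S-Willmore.
   Context: Surfaces. $M^2$ is a connected oriented two-dimensional manifold and $f\colon M^2\to\mathbb{R}^n$ is an immersion; $M^2$ carries the metric induced by $f$, and $J$ is the complex structure of $M^2$ determined by this metric and the orientation. $N_fM$ is the normal bundle, $\nabla^\perp$ the normal connection and $\alpha_f\colon TM\times TM\to N_fM$ the second fundamental form. $f$ is substantial if $f(M)$ is not contained in any proper affine subspace of $\mathbb{R}^n$. $f$ is minimal if its mean curvature vector vanishes. Higher fundamental forms and normal spaces. Set $\alpha_f^2=\alpha_f$ and, inductively for $s\geq 3$, $\alpha_f^s(X_1,\ldots,X_s)=(\nabla^\perp_{X_s}\cdots\nabla^\perp_{X_3}\alpha_f(X_2,X_1))^\perp$, where $(\;)^\perp$ here is the projection onto the orthogonal complement of $N_1^f\oplus\cdots\oplus N_{s-2}^f$ in $N_fM$; this is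 a symmetric tensor. Here, for $k\ge 1$, the $k$-th normal space is $N^f_k(p)=\mathrm{span}\{\alpha_f^{k+1}(X_1,\ldots,X_{k+1}) : X_1,\dots,X_{k+1}\in T_pM\}$. The surface $f$ is always assumed regular, i.e., every $N_k^f$ has constant dimension and hence is a normal subbundle. For a minimal $f$ that is substantial, $N_fM=N_1^f\oplus\cdots\oplus N_m^f$ with $m=[(n-1)/2]$, all summands having rank two except the last one, which has rank one if $n$ is odd. Ellipses of curvature and isotropy. If $N_s^f$ is a plane bundle, the $s$-th order ellipse of curvature at $p$ is $\mathcal{E}_s^f(p)=\{\alpha_f^{s+1}(X_\psi,\ldots,X_\psi): X_\psi=\cos\psi\, X+\sin\psi\, JX,\ \psi\in[0,2\pi)\}\subset N_s^f(p)$, where $X\in T_pM$ is a unit vector. A minimal surface $f$ is $m$-isotropic if $\mathcal{E}_r^f(p)$ is a circle for every $p\in M^2$ and every $1\leq r\leq m$. Superconformal. An immersed surface $g\colon M^2\to\mathbb{R}^n$ is superconformal if at every $p$ its ellipse of curvature $\{\alpha_g(X,X): X\in T_pM,\ \|X\|_g=1\}\subset N_gM(p)$ is a nondegenerate circle (positive radius). Pedal surface. The pedal surface $g\colon M^2\to\mathbb{R}^n$ to $f$ with respect to a fixed point $q\in\mathbb{R}^n$ assigns to $p\in M^2$ the foot of the perpendicular from $q$ to the affine tangent plane $f(p)+f_*T_pM$; it is assumed to be an immersion. S-Willmore. Let $z=x+iy$ be local isothermal coordinates for the metric induced by $g$, $\partial=\frac12(\partial_x-i\partial_y)$ and $\bar\partial=\frac12(\partial_x+i\partial_y)$,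 with $\alpha_g$ and the normal connection $\hat\nabla^\perp$ of $g$ extended complex linearly. The surface $g$ is S-Willmore if $\hat\nabla^\perp_{\bar\partial}\alpha_g(\partial,\partial)$ is everywhere parallel to (a complex multiple of) $\alpha_g(\partial,\partial)$. *)

theory Defs
  imports "HOL-Analysis.Analysis"
begin

section \<open>Smooth maps\<close>

definition dderiv :: "'a::real_normed_vector \<Rightarrow> ('a \<Rightarrow> 'b::real_normed_vector) \<Rightarrow> 'a \<Rightarrow> 'b" where
  "dderiv v u z = frechet_derivative u (at z) v"

text \<open>The next two notions are only used for open sets \<open>S\<close>.\<close>

primrec Ck_on :: "nat \<Rightarrow> 'a::real_normed_vector set \<Rightarrow> ('a \<Rightarrow> 'b::real_normed_vector) \<Rightarrow> bool" where
  "Ck_on 0 S u \<longleftrightarrow> continuous_on S u"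
| "Ck_on (Suc k) S u \<longleftrightarrow> u differentiable_on S \<and> (\<forall>v. Ck_on k S (dderiv v u))"

definition smooth_on :: "'a::real_normed_vector set \<Rightarrow> ('a \<Rightarrow> 'b::real_normed_vector) \<Rightarrow> bool" where
  "smooth_on S u \<longleftrightarrow> (\<forall>k. Ck_on k S u)"


section \<open>Oriented surfaces\<close>

text \<open>
  The points of the surface form a type \<open>'m\<close>. An atlas is a set of local parametrizations
  \<open>(W, x)\<close>, where \<open>x\<close> (the inverse of a coordinate chart) maps the open set \<open>W\<close> of the
  coordinate plane homeomorphically onto an open subset of the surface. Values of \<open>x\<close>
  outside \<open>W\<close> are irrelevant.
\<close>

type_synonym 'm param = "(real^2) set \<times> (real^2 \<Rightarrow> 'm)"

definition local_param :: "'m::topological_space param \<Rightarrow> bool" where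
  "local_param = (\<lambda>(W, x). open W \<and> open (x ` W) \<and> (\<exists>y. homeomorphism W (x ` W) x y))"

definition oriented_transition :: "'m::topological_space param \<Rightarrow> 'm param \<Rightarrow> bool" where
  "oriented_transition = (\<lambda>(W, x) (V, y).
     let S = {z \<in> W. x z \<in> y ` V}; t = inv_into V y \<circ> x
     in smooth_on S t \<and> (\<forall>z\<in>S. det (matrix (frechet_derivative t (at z))) > 0))"

definition oriented_surface :: "'m::topological_space param set \<Rightarrow> bool" where
  "oriented_surface A \<longleftrightarrow>
     (\<forall>P\<in>A. local_param P) \<and>
     (\<Union>(W, x)\<in>A. x ` W) = UNIV \<and>
     (\<forall>P\<in>A. \<forall>Q\<in>A. oriented_transition P Q) \<and>
     (\<forall>P. local_param P \<and> (\<forall>Q\<in>A. oriented_transition P Q \<and> oriented_transition Q P) \<longrightarrow> P \<in> A)"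


section \<open>Geometry of a parametrized surface\<close>

text \<open>
  In this section \<open>u\<close> is a parametrized surface, later \<open>u = f \<circ> x\<close> for an immersion \<open>f\<close> and a
  local parametrization \<open>x\<close>. A tangent vector of the surface at \<open>x z\<close> is represented by its
  coordinates \<open>v\<close> in \<open>real^2\<close>; its image under the differential of \<open>f\<close> is \<open>dderiv v u z\<close>.
\<close>

text \<open>The orthogonal projection of \<open>q\<close> to an affine (in particular, a linear) subspace \<open>S\<close>.\<close>
definition orth_proj :: "'a::euclidean_space set \<Rightarrow> 'a \<Rightarrow> 'a" where
  "orth_proj S q = (THE y. y \<in> S \<and> (\<forall>s\<in>S. inner (q - y) (s - y) = 0))"

definition tangent_space :: "(real^2 \<Rightarrow> 'a::euclidean_space) \<Rightarrow> real^2 \<Rightarrow> 'a set" where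
  "tangent_space u z = range (frechet_derivative u (at z))"

definition normal_fibre :: "(real^2 \<Rightarrow> 'a::euclidean_space) \<Rightarrow> real^2 \<Rightarrow> 'a set" where
  "normal_fibre u z = orthogonal_comp (tangent_space u z)"

definition induced_metric :: "(real^2 \<Rightarrow> 'a::euclidean_space) \<Rightarrow> real^2 \<Rightarrow> real^2 \<Rightarrow> real^2 \<Rightarrow> real" where
  "induced_metric u z v w = inner (dderiv v u z) (dderiv w u z)"

text \<open>Rotation by the angle \<open>\<pi>/2\<close> with respect to the induced metric and the orientation.\<close>
definition cpx_structure :: "(real^2 \<Rightarrow> 'a::euclidean_space) \<Rightarrow> real^2 \<Rightarrow> real^2 \<Rightarrow> real^2" where
  "cpx_structure u z v = (THE w. induced_metric u z v w = 0 \<and> induced_metric u z w w = induced_metric u z v v \<and>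
     (v \<noteq> 0 \<longrightarrow> v $ 1 * w $ 2 - v $ 2 * w $ 1 > 0))"

definition normal_connection ::
    "(real^2 \<Rightarrow> 'a::euclidean_space) \<Rightarrow> real^2 \<Rightarrow> (real^2 \<Rightarrow> 'a) \<Rightarrow> real^2 \<Rightarrow> 'a" where
  "normal_connection u v \<xi> z = orth_proj (normal_fibre u z) (dderiv v \<xi> z)"

text \<open>
  Gauss formula: the tangent vectors are extended to vector fields with constant coordinates.
\<close>
definition sff :: "(real^2 \<Rightarrow> 'a::euclidean_space) \<Rightarrow> real^2 \<Rightarrow> real^2 \<Rightarrow> real^2 \<Rightarrow> 'a" where
  "sff u v w z = orth_proj (normal_fibre u z) (dderiv v (dderiv w u) z)"

text \<open>Half of the trace of the second fundamental form with respect to the induced metric.\<close>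
definition mean_curvature :: "(real^2 \<Rightarrow> 'a::euclidean_space) \<Rightarrow> real^2 \<Rightarrow> 'a" where
  "mean_curvature u z =
    (let e1 = axis 1 1; e2 = axis 2 1;
         E = induced_metric u z e1 e1; F = induced_metric u z e1 e2; G = induced_metric u z e2 e2
     in (1 / (2 * (E * G - F\<^sup>2))) *\<^sub>R
        (G *\<^sub>R sff u e1 e1 z - (2 * F) *\<^sub>R sff u e1 e2 z + E *\<^sub>R sff u e2 e2 z))"

text \<open>
  For constant coordinate fields, \<open>iter_sff u [X\<^sub>s, \<dots>, X\<^sub>3, X\<^sub>2, X\<^sub>1]\<close> is
  \<open>\<nabla>\<^sup>\<bottom>\<^bsub>X\<^sub>s\<^esub> \<dots> \<nabla>\<^sup>\<bottom>\<^bsub>X\<^sub>3\<^esub> \<alpha>(X\<^sub>2, X\<^sub>1)\<close>: the arguments are listed in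
  reverse order. In \<open>higher_sff\<close>, the projection removes the dependence on the extension of the
  tangent vectors to vector fields.
\<close>
fun iter_sff :: "(real^2 \<Rightarrow> 'a::euclidean_space) \<Rightarrow> (real^2) list \<Rightarrow> real^2 \<Rightarrow> 'a" where
  "iter_sff u (X # Y # Z # Xs) = normal_connection u X (iter_sff u (Y # Z # Xs))"
| "iter_sff u [X, Y] = sff u X Y"
| "iter_sff u _ = (\<lambda>z. 0)"

function higher_sff :: "(real^2 \<Rightarrow> 'a::euclidean_space) \<Rightarrow> (real^2) list \<Rightarrow> real^2 \<Rightarrow> 'a"
  and kth_normal_space :: "(real^2 \<Rightarrow> 'a) \<Rightarrow> nat \<Rightarrow> real^2 \<Rightarrow> 'a set" where
  "higher_sff u Xs z =
     orth_proj (normal_fibre u z \<inter>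
         orthogonal_comp (\<Union>k\<in>{1..length Xs - 2}. kth_normal_space u k z))
       (iter_sff u Xs z)"
| "kth_normal_space u k z = span ((\<lambda>Xs. higher_sff u Xs z) ` {Xs. length Xs = k + 1})"
  by pat_completeness auto
termination
  by (relation "Wellfounded.measure (case_sum (\<lambda>(u, Xs, z). 2 * length Xs) (\<lambda>(u, k, z). 2 * k + 3))") auto

declare higher_sff.simps [simp del] kth_normal_space.simps [simp del]

definition curvature_ellipse ::
    "(real^2 \<Rightarrow> 'a::euclidean_space) \<Rightarrow> nat \<Rightarrow> real^2 \<Rightarrow> real^2 \<Rightarrow> 'a set" where
  "curvature_ellipse u s z X =
     {higher_sff u (replicate (s + 1) (cos \<psi> *\<^sub>R X + sin \<psi> *\<^sub>R cpx_structure u z X)) z |\<psi>.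
        \<psi> \<in> {0..<2 * pi}}"

text \<open>A circle of positive radius.\<close>
definition is_circle :: "'a::euclidean_space set \<Rightarrow> bool" where
  "is_circle C \<longleftrightarrow> (\<exists>c r P. r > 0 \<and> subspace P \<and> dim P = 2 \<and> C = {c + w |w. w \<in> P \<and> norm w = r})"


section \<open>Surfaces in Euclidean space\<close>

definition immersion_on ::
    "'m::topological_space param set \<Rightarrow> 'm set \<Rightarrow> ('m \<Rightarrow> 'a::euclidean_space) \<Rightarrow> bool" where
  "immersion_on A U f \<longleftrightarrow> (\<forall>(W, x)\<in>A.
     smooth_on (W \<inter> x -` U) (f \<circ> x) \<and>
     (\<forall>z\<in>W \<inter> x -` U. inj (frechet_derivative (f \<circ> x) (at z))))"

definition minimal_on ::
    "'m::topological_space param set \<Rightarrow> 'm set \<Rightarrow> ('m \<Rightarrow> 'a::euclidean_space) \<Rightarrow> bool" where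
  "minimal_on A U f \<longleftrightarrow> immersion_on A U f \<and>
     (\<forall>(W, x)\<in>A. \<forall>z\<in>W \<inter> x -` U. mean_curvature (f \<circ> x) z = 0)"

definition substantial :: "('m \<Rightarrow> 'a::euclidean_space) \<Rightarrow> bool" where
  "substantial f \<longleftrightarrow> \<not> (\<exists>S. affine S \<and> S \<noteq> UNIV \<and> range f \<subseteq> S)"

definition regular_surface :: "'m::topological_space param set \<Rightarrow> ('m \<Rightarrow> 'a::euclidean_space) \<Rightarrow> bool" where
  "regular_surface A f \<longleftrightarrow>
     (\<forall>k\<ge>1. \<exists>d. \<forall>(W, x)\<in>A. \<forall>z\<in>W. dim (kth_normal_space (f \<circ> x) k z) = d)"

text \<open>The ellipse of curvature of order \<open>r\<close> is only considered if the \<open>r\<close>-th normal space is a plane.\<close>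
definition isotropic ::
    "'m::topological_space param set \<Rightarrow> nat \<Rightarrow> ('m \<Rightarrow> 'a::euclidean_space) \<Rightarrow> bool" where
  "isotropic A m f \<longleftrightarrow> minimal_on A UNIV f \<and>
     (\<forall>r\<in>{1..m}. \<forall>(W, x)\<in>A. \<forall>z\<in>W.
        dim (kth_normal_space (f \<circ> x) r z) = 2 \<and>
        (\<forall>X. induced_metric (f \<circ> x) z X X = 1 \<longrightarrow> is_circle (curvature_ellipse (f \<circ> x) r z X)))"

definition superconformal ::
    "'m::topological_space param set \<Rightarrow> ('m \<Rightarrow> 'a::euclidean_space) \<Rightarrow> bool" where
  "superconformal A g \<longleftrightarrow> (\<forall>(W, x)\<in>A. \<forall>z\<in>W.
     is_circle {sff (g \<circ> x) X X z |X. induced_metric (g \<circ> x) z X X = 1})"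

definition pedal_surface ::
    "'m::topological_space param set \<Rightarrow> ('m \<Rightarrow> 'a::euclidean_space) \<Rightarrow> 'a \<Rightarrow> ('m \<Rightarrow> 'a) \<Rightarrow> bool" where
  "pedal_surface A f q g \<longleftrightarrow> (\<forall>(W, x)\<in>A. \<forall>z\<in>W.
     g (x z) = orth_proj ((+) (f (x z)) ` tangent_space (f \<circ> x) z) q)"

definition conformal_metrics ::
    "'m::topological_space param set \<Rightarrow> ('m \<Rightarrow> 'a::euclidean_space) \<Rightarrow> ('m \<Rightarrow> 'a) \<Rightarrow> bool" where
  "conformal_metrics A f g \<longleftrightarrow> (\<exists>\<rho> :: 'm \<Rightarrow> real. (\<forall>p. \<rho> p > 0) \<and>
     (\<forall>(W, x)\<in>A. \<forall>z\<in>W. \<forall>v w. induced_metric (g \<circ> x) z v w = \<rho> (x z) * induced_metric (f \<circ> x) z v w))"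


section \<open>Moebius transformations\<close>

text \<open>
  The point at infinity is \<open>None\<close>. The Moebius group is generated by the reflections in
  hyperplanes and the inversions in spheres; the generators are involutions.
\<close>

definition plane_reflection :: "'a::euclidean_space \<Rightarrow> real \<Rightarrow> 'a option \<Rightarrow> 'a option" where
  "plane_reflection a b = map_option (\<lambda>y. y - (2 * (inner a y - b) / inner a a) *\<^sub>R a)"

definition sphere_inversion :: "'a::euclidean_space \<Rightarrow> real \<Rightarrow> 'a option \<Rightarrow> 'a option" where
  "sphere_inversion c r Y = (case Y of
       None \<Rightarrow> Some c
     | Some y \<Rightarrow> if y = c then None else Some (c + (r\<^sup>2 / (norm (y - c))\<^sup>2) *\<^sub>R (y - c)))"

inductive_set moebius_group :: "('a::euclidean_space option \<Rightarrow> 'a option) set" where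
  ident: "id \<in> moebius_group"
| reflection: "T \<in> moebius_group \<Longrightarrow> a \<noteq> 0 \<Longrightarrow> plane_reflection a b \<circ> T \<in> moebius_group"
| inversion: "T \<in> moebius_group \<Longrightarrow> r > 0 \<Longrightarrow> sphere_inversion c r \<circ> T \<in> moebius_group"

definition locally_conformally_minimal ::
    "'m::topological_space param set \<Rightarrow> ('m \<Rightarrow> 'a::euclidean_space) \<Rightarrow> bool" where
  "locally_conformally_minimal A g \<longleftrightarrow> (\<exists>U T. open U \<and> U \<noteq> {} \<and> T \<in> moebius_group \<and>
     (\<forall>p\<in>U. T (Some (g p)) \<noteq> None) \<and> minimal_on A U (\<lambda>p. the (T (Some (g p)))))"


section \<open>S-Willmore surfaces\<close>

text \<open>Complexified tangent vectors are elements of \<open>complex^2\<close>, complexified normal vectors of \<open>complex^'n\<close>.\<close>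

definition cvec :: "real^'n \<Rightarrow> complex^'n" where
  "cvec v = (\<chi> i. complex_of_real (v $ i))"

definition csff ::
    "(real^2 \<Rightarrow> real^'n) \<Rightarrow> complex^2 \<Rightarrow> complex^2 \<Rightarrow> real^2 \<Rightarrow> complex^'n" where
  "csff u a b z = (\<Sum>j\<in>UNIV. \<Sum>k\<in>UNIV. (a $ j * b $ k) *s cvec (sff u (axis j 1) (axis k 1) z))"

definition cnormal_connection ::
    "(real^2 \<Rightarrow> real^'n) \<Rightarrow> complex^2 \<Rightarrow> (real^2 \<Rightarrow> complex^'n) \<Rightarrow> real^2 \<Rightarrow> complex^'n" where
  "cnormal_connection u a \<xi> z = (\<Sum>j\<in>UNIV. a $ j *s
     (cvec (normal_connection u (axis j 1) (\<lambda>y. \<chi> i. Re (\<xi> y $ i)) z) +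
      \<i> *s cvec (normal_connection u (axis j 1) (\<lambda>y. \<chi> i. Im (\<xi> y $ i)) z)))"

definition del :: "complex^2" where
  "del = vector [1 / 2, - \<i> / 2]"

definition delbar :: "complex^2" where
  "delbar = vector [1 / 2, \<i> / 2]"

definition isothermal :: "(real^2) set \<Rightarrow> (real^2 \<Rightarrow> 'a::euclidean_space) \<Rightarrow> bool" where
  "isothermal W u \<longleftrightarrow> (\<forall>z\<in>W.
     induced_metric u z (axis 1 1) (axis 1 1) = induced_metric u z (axis 2 1) (axis 2 1) \<and>
     induced_metric u z (axis 1 1) (axis 2 1) = 0)"

text \<open>
  Since the atlas is maximal, the following quantifies over all isothermal coordinates
  compatible with the orientation.
\<close>
definition S_Willmore :: "'m::topological_space param set \<Rightarrow> ('m \<Rightarrow> real^'n) \<Rightarrow> bool" where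
  "S_Willmore A g \<longleftrightarrow> (\<forall>(W, x)\<in>A. isothermal W (g \<circ> x) \<longrightarrow>
     (\<forall>z\<in>W. \<exists>c. cnormal_connection (g \<circ> x) delbar (csff (g \<circ> x) del del) z
              = c *s csff (g \<circ> x) del del z))"

end

theory Submission
  imports Defs
begin

text \<open>
  In isothermal coordinates \<open>\<phi> = \<partial>f\<close> is a holomorphic null curve and \<open>A = \<alpha>\<^sub>f(\<partial>, \<partial>)\<close> is the
  normal part of \<open>\<phi>'\<close>; writing \<open>B = \<alpha>\<^sub>f\<^sup>3(\<partial>, \<partial>, \<partial>)\<close>, \<open>f\<close> is 1-isotropic if
  \<open>\<langle>A, A\<rangle> = 0 \<noteq> A\<close> and 2-isotropic if moreover \<open>\<langle>B, B\<rangle> = 0 \<noteq> B\<close>, with the complex bilinear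
  product. If \<open>a\<close> is the \<open>\<phi>\<close>-component of the position vector \<open>f - q\<close>, then
  \<open>\<partial>g = - a A - \<gamma> \<phi>*\<close>, where \<open>\<phi>*\<close> is the conjugate of \<open>\<phi>\<close>. This vector is null, so \<open>g\<close> is
  conformal to \<open>f\<close>, and \<open>\<langle>\<partial>\<partial>g, \<partial>\<partial>g\<rangle> = a\<^sup>2 \<langle>B, B\<rangle>\<close>. The zeros of \<open>a\<close> are nowhere dense, hence \<open>g\<close>
  superconformal forces \<open>\<langle>B, B\<rangle> = 0\<close>. If \<open>B\<close> vanished identically, the osculating spaces of
  dimension four would be parallel and \<open>f\<close> would not be substantial; by regularity \<open>B\<close> then has no
  zeros.

  If \<open>g\<close> were S-Willmore, comparing the components along \<open>B\<close>, \<open>A\<close> and \<open>\<phi>*\<close> of the defining equation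
  would give \<open>\<partial>g = 0\<close>. If \<open>g\<close> were conformally minimal, \<open>g\<close> or an inversion of \<open>g\<close> would be harmonic.
  The first is impossible because the mixed second derivative of \<open>g\<close> has no zeros; the second puts
  \<open>f - d\<close>, for some point \<open>d\<close>, into the osculating space on an open set, and this is excluded by
  differentiating the relation, since \<open>B \<noteq> 0\<close>.
\<close>

section \<open>Smooth maps\<close>

text \<open>The definitions quantify over all charts, but the frame \<open>ph\<close>,
  \<open>A\<close>, \<open>B\<close> needs isothermal ones. Minimality supplies them: the Hodge star
  of du is closed, so each height function of \<open>f\<close> has a local conjugate, and such a
  pair serves as a chart. Results return to arbitrary charts through
  \<open>reparametrization\<close>. Power series never enter: a vanishing function on an open set is
  exploited by differentiating it there, and the exclusion of \<open>B\<close> vanishing identically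
  rests on a Gronwall estimate and connectedness. The frame consists of \<open>ph\<close>,
  \<open>A\<close>, \<open>B\<close> and their conjugates. Under the bilinear product the planes
  spanned by each vector and its conjugate are mutually orthogonal, and \<open>ph\<close>,
  \<open>A\<close> are null. Hence products with \<open>ccnj B\<close>, \<open>ccnj A\<close> and
  \<open>ph\<close> read off coefficients. Since \<open>A\<close> and \<open>ccnj ph\<close> span a
  totally null plane containing \<partial>g, the first derivative of \<open>g\<close> is null and
  the second one can fail to be null only through \<open>B\<close>. The scalar functions
  \<open>mu\<close>, \<open>cA\<close>, \<open>tau\<close> are logarithmic derivatives of the
  squared lengths \<open>lam\<close>, \<open>kap\<close>, \<open>Lam\<close>, which keeps all
  formulas rational.\<close>

lemma has_derivative_cong_open:
  assumes "open S" "z \<in> S" "\<And>x. x \<in> S \<Longrightarrow> u x = w x"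
  shows "(u has_derivative D) (at z) \<longleftrightarrow> (w has_derivative D) (at z)"
  using assms has_derivative_transform_within_open[of u D z UNIV S w]
    has_derivative_transform_within_open[of w D z UNIV S u] by auto

lemma frechet_derivative_cong_open:
  assumes "open S" "z \<in> S" "\<And>x. x \<in> S \<Longrightarrow> u x = w x"
  shows "frechet_derivative u (at z) = frechet_derivative w (at z)"
  unfolding frechet_derivative_def using has_derivative_cong_open[OF assms] by simp

lemma dderiv_cong_open:
  assumes "open S" "z \<in> S" "\<And>x. x \<in> S \<Longrightarrow> u x = w x"
  shows "dderiv v u z = dderiv v w z"
  unfolding dderiv_def using frechet_derivative_cong_open[OF assms] by simp

lemma dderiv_eq: "(u has_derivative D) (at z) \<Longrightarrow> dderiv v u z = D v"
  unfolding dderiv_def by (metis frechet_derivative_at)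

lemma has_derivative_dderiv: "u differentiable (at z) \<Longrightarrow> (u has_derivative (\<lambda>v. dderiv v u z)) (at z)"
  unfolding dderiv_def by (simp add: frechet_derivative_works)

lemma linear_dderiv: "u differentiable (at z) \<Longrightarrow> linear (\<lambda>v. dderiv v u z)"
  by (rule has_derivative_linear[OF has_derivative_dderiv])

lemma differentiable_on_openD:
  "u differentiable_on S \<Longrightarrow> open S \<Longrightarrow> z \<in> S \<Longrightarrow> u differentiable (at z)"
  using at_within_open[of z S] by (auto simp: differentiable_on_def)

lemma differentiable_on_cong_open:
  assumes "open S" "\<And>x. x \<in> S \<Longrightarrow> u x = w x"
  shows "u differentiable_on S \<longleftrightarrow> w differentiable_on S"
  unfolding differentiable_on_def differentiable_def
  using has_derivative_cong_open[OF assms(1) _ assms(2)] at_within_open[OF _ assms(1)] by simp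

lemma Ck_on_cong:
  assumes "open S" "\<And>x. x \<in> S \<Longrightarrow> u x = w x"
  shows "Ck_on k S u \<longleftrightarrow> Ck_on k S w"
  using assms(2)
proof (induction k arbitrary: u w)
  case 0
  then show ?case by (auto cong: continuous_on_cong)
next
  case (Suc k)
  have "Ck_on k S (dderiv v u) \<longleftrightarrow> Ck_on k S (dderiv v w)" for v
    by (rule Suc.IH) (use Suc.prems assms(1) dderiv_cong_open in blast)
  then show ?case
    using differentiable_on_cong_open[OF assms(1) Suc.prems] by simp
qed

lemma smooth_on_cong:
  assumes "open S" "\<And>x. x \<in> S \<Longrightarrow> u x = w x"
  shows "smooth_on S u \<longleftrightarrow> smooth_on S w"
  unfolding smooth_on_def using Ck_on_cong[OF assms] by simp

lemma Ck_on_subset: "Ck_on k S u \<Longrightarrow> T \<subseteq> S \<Longrightarrow> Ck_on k T u"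
  by (induction k arbitrary: u) (auto intro: continuous_on_subset differentiable_on_subset)

lemma smooth_on_subset: "smooth_on S u \<Longrightarrow> T \<subseteq> S \<Longrightarrow> smooth_on T u"
  unfolding smooth_on_def using Ck_on_subset by blast

lemma Ck_on_SucD: "Ck_on (Suc k) S u \<Longrightarrow> Ck_on k S u"
proof (induction k arbitrary: u)
  case 0
  then show ?case by (simp add: differentiable_imp_continuous_on)
next
  case (Suc k)
  have "u differentiable_on S" "\<And>v. Ck_on (Suc k) S (dderiv v u)"
    using Suc.prems by (simp_all only: Ck_on.simps(2)[of "Suc k"])
  then show ?case using Suc.IH by (simp only: Ck_on.simps(2)[of k]) blast
qed

lemma smooth_on_iff:
  "smooth_on S u \<longleftrightarrow> u differentiable_on S \<and> (\<forall>v. smooth_on S (dderiv v u))"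
proof
  assume "smooth_on S u"
  then have "Ck_on (Suc k) S u" for k unfolding smooth_on_def by blast
  then show "u differentiable_on S \<and> (\<forall>v. smooth_on S (dderiv v u))"
    unfolding smooth_on_def by simp
next
  assume "u differentiable_on S \<and> (\<forall>v. smooth_on S (dderiv v u))"
  then have "Ck_on (Suc k) S u" for k unfolding smooth_on_def by simp
  then show "smooth_on S u"
    unfolding smooth_on_def using Ck_on_SucD by blast
qed

lemma smooth_on_dderiv: "smooth_on S u \<Longrightarrow> smooth_on S (dderiv v u)"
  using smooth_on_iff by blast

lemma smooth_on_differentiable: "smooth_on S u \<Longrightarrow> open S \<Longrightarrow> z \<in> S \<Longrightarrow> u differentiable (at z)"
  using smooth_on_iff differentiable_on_openD by blast

lemma smooth_on_continuous: "smooth_on S u \<Longrightarrow> continuous_on S u"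
  unfolding smooth_on_def using Ck_on.simps(1) by blast

lemma smooth_on_has_derivative:
  "smooth_on S u \<Longrightarrow> open S \<Longrightarrow> z \<in> S \<Longrightarrow> (u has_derivative (\<lambda>v. dderiv v u z)) (at z)"
  by (simp add: smooth_on_differentiable has_derivative_dderiv)

lemma Ck_on_const: "Ck_on k S (\<lambda>x. c)"
proof (induction k arbitrary: c)
  case (Suc k)
  have "dderiv v (\<lambda>x. c) = (\<lambda>x. 0)" for v :: 'a
    by (rule ext) (rule dderiv_eq[OF has_derivative_const])
  then show ?case using Suc by simp
qed simp

lemma Ck_on_linear:
  assumes "open S" "bounded_linear L" "Ck_on k S u"
  shows "Ck_on k S (\<lambda>x. L (u x))"
  using assms(3)
proof (induction k arbitrary: u)
  case 0
  then show ?case by (auto intro: bounded_linear.continuous_on[OF assms(2)])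
next
  case (Suc k)
  have der: "((\<lambda>x. L (u x)) has_derivative (\<lambda>v. L (dderiv v u z))) (at z)" if "z \<in> S" for z
    using Suc.prems differentiable_on_openD[OF _ assms(1) that] has_derivative_dderiv
    by (intro bounded_linear.has_derivative[OF assms(2)]) auto
  have "Ck_on k S (dderiv v (\<lambda>x. L (u x)))" for v
    using Suc by (subst Ck_on_cong[OF assms(1), of _ "\<lambda>x. L (dderiv v u x)"]) (auto simp: dderiv_eq[OF der])
  moreover have "(\<lambda>x. L (u x)) differentiable_on S"
    using der by (auto simp: differentiable_on_def differentiable_def intro: has_derivative_at_withinI)
  ultimately show ?case by simp
qed

lemma Ck_on_add:
  assumes "open S" "Ck_on k S u" "Ck_on k S w"
  shows "Ck_on k S (\<lambda>x. u x + w x)"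
  using assms(2,3)
proof (induction k arbitrary: u w)
  case 0
  then show ?case by (auto intro: continuous_on_add)
next
  case (Suc k)
  have der: "((\<lambda>x. u x + w x) has_derivative (\<lambda>v. dderiv v u z + dderiv v w z)) (at z)" if "z \<in> S" for z
    using Suc.prems differentiable_on_openD[OF _ assms(1) that]
    by (intro has_derivative_add has_derivative_dderiv) auto
  have "Ck_on k S (dderiv v (\<lambda>x. u x + w x))" for v
    using Suc by (subst Ck_on_cong[OF assms(1), of _ "\<lambda>x. dderiv v u x + dderiv v w x"]) (auto simp: dderiv_eq[OF der])
  moreover have "(\<lambda>x. u x + w x) differentiable_on S"
    using der by (auto simp: differentiable_on_def differentiable_def intro: has_derivative_at_withinI)
  ultimately show ?case by simp
qed

lemma Ck_on_bilinear:
  assumes "open S" "bounded_bilinear B" "Ck_on k S u" "Ck_on k S w"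
  shows "Ck_on k S (\<lambda>x. B (u x) (w x))"
  using assms(3,4)
proof (induction k arbitrary: u w)
  case 0
  then show ?case by (auto intro: bounded_bilinear.continuous_on[OF assms(2)])
next
  case (Suc k)
  have der: "((\<lambda>x. B (u x) (w x)) has_derivative (\<lambda>v. B (u z) (dderiv v w z) + B (dderiv v u z) (w z))) (at z)"
    if "z \<in> S" for z
    using Suc.prems differentiable_on_openD[of u S z] differentiable_on_openD[of w S z] assms(1) that
    by (intro bounded_bilinear.FDERIV[OF assms(2)] has_derivative_dderiv) auto
  have "Ck_on k S (\<lambda>z. B (u z) (dderiv v w z) + B (dderiv v u z) (w z))" for v
    using Suc.prems Ck_on_SucD[OF Suc.prems(1)] Ck_on_SucD[OF Suc.prems(2)]
    by (intro Ck_on_add[OF assms(1)] Suc.IH) auto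
  then have "Ck_on k S (dderiv v (\<lambda>x. B (u x) (w x)))" for v
    by (subst Ck_on_cong[OF assms(1), of _ "\<lambda>z. B (u z) (dderiv v w z) + B (dderiv v u z) (w z)"])
      (auto simp: dderiv_eq[OF der])
  moreover have "(\<lambda>x. B (u x) (w x)) differentiable_on S"
    using der by (auto simp: differentiable_on_def differentiable_def intro: has_derivative_at_withinI)
  ultimately show ?case by simp
qed

lemma Ck_on_sum:
  assumes "open S" "\<And>i. i \<in> I \<Longrightarrow> Ck_on k S (u i)"
  shows "Ck_on k S (\<lambda>x. \<Sum>i\<in>I. u i x)"
  using assms(2)
proof (induction I rule: infinite_finite_induct)
  case (insert i I)
  then show ?case by (auto intro: Ck_on_add[OF assms(1)])
qed (auto intro: Ck_on_const)

lemma dderiv_compose: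
  fixes t :: "'a::real_normed_vector \<Rightarrow> 'b::euclidean_space"
  assumes "t differentiable (at z)" "u differentiable (at (t z))"
  shows "dderiv v (\<lambda>x. u (t x)) z = dderiv (dderiv v t z) u (t z)"
  using diff_chain_at[OF has_derivative_dderiv[OF assms(1)] has_derivative_dderiv[OF assms(2)]]
  by (simp add: o_def dderiv_eq)

text \<open>\<open>Ck_on\<close> differentiates along constant directions only. In the chain rule
  the direction varies with the point; this expansion turns it into a sum of products that the
  closure properties can handle.\<close>

lemma dderiv_euclidean:
  fixes u :: "'b::euclidean_space \<Rightarrow> 'c::real_normed_vector"
  assumes "u differentiable (at y)"
  shows "dderiv w u y = (\<Sum>b\<in>Basis. inner w b *\<^sub>R dderiv b u y)"
proof -
  have "dderiv w u y = dderiv (\<Sum>b\<in>Basis. inner w b *\<^sub>R b) u y"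
    by (simp add: euclidean_representation)
  also have "\<dots> = (\<Sum>b\<in>Basis. inner w b *\<^sub>R dderiv b u y)"
    using linear_dderiv[OF assms] by (subst linear_sum[OF linear_dderiv[OF assms], of "\<lambda>b. inner w b *\<^sub>R b" Basis, simplified o_def])
      (simp add: linear_scale[OF linear_dderiv[OF assms]])
  finally show ?thesis .
qed

text \<open>The induction generalises \<open>u\<close> alone: the derivative of the composition is a
  sum of products of derivatives of \<open>t\<close> with derivatives of \<open>u\<close> composed
  with the same \<open>t\<close>.\<close>

lemma Ck_on_compose:
  fixes t :: "'a::real_normed_vector \<Rightarrow> 'b::euclidean_space"
  assumes "open S" "open T" "t ` S \<subseteq> T" "Ck_on k S t" "Ck_on k T u"
  shows "Ck_on k S (\<lambda>x. u (t x))"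
  using assms(4,5)
proof (induction k arbitrary: u)
  case 0
  then show ?case using assms(3) continuous_on_compose2 by (metis Ck_on.simps(1))
next
  case (Suc k)
  have dt: "t differentiable (at z)" if "z \<in> S" for z
    using Suc.prems differentiable_on_openD[OF _ assms(1) that] by auto
  have du: "u differentiable (at (t z))" if "z \<in> S" for z
    using Suc.prems differentiable_on_openD[OF _ assms(2)] that assms(3) by auto
  have tk: "Ck_on k S t" using Suc.prems(1) by (rule Ck_on_SucD)
  have "Ck_on k S (\<lambda>z. \<Sum>b\<in>Basis. inner (dderiv v t z) b *\<^sub>R dderiv b u (t z))" for v
    using Suc.prems
    by (intro Ck_on_sum[OF assms(1)] Ck_on_bilinear[OF assms(1) bounded_bilinear_scaleR]
       Ck_on_linear[OF assms(1) bounded_linear_inner_left] Suc.IH[OF tk]) auto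
  then have "Ck_on k S (dderiv v (\<lambda>x. u (t x)))" for v
    by (subst Ck_on_cong[OF assms(1), of _ "\<lambda>z. \<Sum>b\<in>Basis. inner (dderiv v t z) b *\<^sub>R dderiv b u (t z)"])
      (simp_all add: dderiv_compose[OF dt du] dderiv_euclidean[OF du, symmetric])
  moreover have "(\<lambda>x. u (t x)) differentiable_on S"
    using differentiable_chain_at[OF dt du]
    by (auto simp: differentiable_on_def o_def intro: differentiable_at_withinI)
  ultimately show ?case by simp
qed

lemma smooth_on_const: "smooth_on S (\<lambda>x. c)"
  by (simp add: smooth_on_def Ck_on_const)

lemma smooth_on_linear: "open S \<Longrightarrow> bounded_linear L \<Longrightarrow> smooth_on S u \<Longrightarrow> smooth_on S (\<lambda>x. L (u x))"
  by (simp add: smooth_on_def Ck_on_linear)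

lemma smooth_on_add: "open S \<Longrightarrow> smooth_on S u \<Longrightarrow> smooth_on S w \<Longrightarrow> smooth_on S (\<lambda>x. u x + w x)"
  by (simp add: smooth_on_def Ck_on_add)

lemma smooth_on_diff: "open S \<Longrightarrow> smooth_on S u \<Longrightarrow> smooth_on S w \<Longrightarrow> smooth_on S (\<lambda>x. u x - w x)"
  using smooth_on_add[of S u "\<lambda>x. - w x"] smooth_on_linear[of S uminus w]
  by (simp add: bounded_linear_minus bounded_linear_ident)

lemma smooth_on_bilinear:
  "open S \<Longrightarrow> bounded_bilinear B \<Longrightarrow> smooth_on S u \<Longrightarrow> smooth_on S w \<Longrightarrow> smooth_on S (\<lambda>x. B (u x) (w x))"
  by (simp add: smooth_on_def Ck_on_bilinear)

lemmas smooth_on_scaleR = smooth_on_bilinear[OF _ bounded_bilinear_scaleR]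
lemmas smooth_on_inner = smooth_on_bilinear[OF _ bounded_bilinear_inner]
lemmas smooth_on_mult = smooth_on_bilinear[OF _ bounded_bilinear_mult]

lemma smooth_on_compose:
  fixes t :: "'a::real_normed_vector \<Rightarrow> 'b::euclidean_space"
  assumes "open S" "open T" "t ` S \<subseteq> T" "smooth_on S t" "smooth_on T u"
  shows "smooth_on S (\<lambda>x. u (t x))"
  using assms Ck_on_compose unfolding smooth_on_def by blast

text \<open>The derivative is a polynomial in \<open>inverse\<close> itself, so the order of
  differentiability bootstraps.\<close>

lemma smooth_on_inverse_real: "smooth_on (- {0}) (inverse :: real \<Rightarrow> real)"
proof -
  have op: "open (- {0::real})" by auto
  have der: "(inverse has_derivative (\<lambda>v. v * - (inverse x * inverse x))) (at x)" if "x \<in> - {0::real}" for x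
  proof -
    have "(inverse has_derivative (*) (- (inverse x ^ Suc (Suc 0)))) (at x)"
      using DERIV_inverse[of x UNIV] that by (simp add: has_field_derivative_def)
    moreover have "(*) (- (inverse x ^ Suc (Suc 0))) = (\<lambda>v. v * - (inverse x * inverse x))"
      by (simp add: fun_eq_iff)
    ultimately show ?thesis by simp
  qed
  have "Ck_on k (- {0}) (inverse :: real \<Rightarrow> real)" for k
  proof (induction k)
    case 0
    then show ?case by (auto intro!: continuous_on_inverse continuous_on_id)
  next
    case (Suc k)
    have "Ck_on k (- {0}) (\<lambda>x::real. v * - (inverse x * inverse x))" for v
      using Suc
      by (intro Ck_on_bilinear[OF op bounded_bilinear_mult] Ck_on_const
          Ck_on_linear[OF op bounded_linear_minus[OF bounded_linear_ident]])
    then have "Ck_on k (- {0}) (dderiv v (inverse :: real \<Rightarrow> real))" for v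
      by (subst Ck_on_cong[OF op, of _ "\<lambda>x. v * - (inverse x * inverse x)"])
        (auto simp: dderiv_eq[OF der])
    moreover have "(inverse :: real \<Rightarrow> real) differentiable_on (- {0})"
      using der by (auto simp: differentiable_on_def differentiable_def intro: has_derivative_at_withinI)
    ultimately show ?case by simp
  qed
  then show ?thesis by (simp add: smooth_on_def)
qed

lemma smooth_on_inverse:
  fixes u :: "'a::real_normed_vector \<Rightarrow> real"
  assumes "open S" "smooth_on S u" "\<And>x. x \<in> S \<Longrightarrow> u x \<noteq> 0"
  shows "smooth_on S (\<lambda>x. inverse (u x))"
  by (rule smooth_on_compose[OF assms(1) _ _ assms(2) smooth_on_inverse_real]) (use assms in auto)

lemma smooth_on_divide:
  fixes u w :: "'a::real_normed_vector \<Rightarrow> real"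
  assumes "open S" "smooth_on S u" "smooth_on S w" "\<And>x. x \<in> S \<Longrightarrow> w x \<noteq> 0"
  shows "smooth_on S (\<lambda>x. u x / w x)"
  using smooth_on_mult[OF assms(1,2) smooth_on_inverse[OF assms(1,3,4)]]
  by (simp add: divide_inverse)

text \<open>Again a bootstrap: the derivative is the inverse of the function, up to a factor, and
  \<open>inverse\<close> is already smooth away from zero.\<close>

lemma smooth_on_sqrt_real: "smooth_on {0<..} (sqrt :: real \<Rightarrow> real)"
proof -
  have op: "open {0::real<..}" by auto
  have der: "(sqrt has_derivative (\<lambda>v. v * (inverse (sqrt x) / 2))) (at x)" if "x \<in> {0<..}" for x
  proof -
    have "(*) (inverse (sqrt x) / 2) = (\<lambda>v. v * (inverse (sqrt x) / 2))"
      by (simp add: fun_eq_iff)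
    then show ?thesis
      using DERIV_real_sqrt[of x] that by (simp add: has_field_derivative_def)
  qed
  have "Ck_on k {0<..} (sqrt :: real \<Rightarrow> real)" for k
  proof (induction k)
    case 0
    then show ?case by (auto intro!: continuous_on_real_sqrt continuous_on_id)
  next
    case (Suc k)
    have "Ck_on k {0<..} (\<lambda>x::real. v * (inverse (sqrt x) / 2))" for v
      using Suc smooth_on_inverse_real
      by (intro Ck_on_bilinear[OF op bounded_bilinear_mult] Ck_on_const
          Ck_on_linear[OF op bounded_linear_divide] Ck_on_compose[OF op, of "- {0}" sqrt k inverse])
        (auto simp: smooth_on_def)
    then have "Ck_on k {0<..} (dderiv v (sqrt :: real \<Rightarrow> real))" for v
      by (subst Ck_on_cong[OF op, of _ "\<lambda>x. v * (inverse (sqrt x) / 2)"])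
        (auto simp: dderiv_eq[OF der])
    moreover have "(sqrt :: real \<Rightarrow> real) differentiable_on {0<..}"
      using der by (auto simp: differentiable_on_def differentiable_def intro: has_derivative_at_withinI)
    ultimately show ?case by simp
  qed
  then show ?thesis by (simp add: smooth_on_def)
qed

lemma smooth_on_sqrt:
  fixes u :: "'a::real_normed_vector \<Rightarrow> real"
  assumes "open S" "smooth_on S u" "\<And>x. x \<in> S \<Longrightarrow> u x > 0"
  shows "smooth_on S (\<lambda>x. sqrt (u x))"
  by (rule smooth_on_compose[OF assms(1) _ _ assms(2) smooth_on_sqrt_real]) (use assms in auto)

section \<open>Symmetry of second derivatives\<close>

lemma second_difference_mean_value:
  fixes F :: "'a::real_normed_vector \<Rightarrow> real"
  assumes "open S" "smooth_on S F" "h > 0"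
    and seg: "\<And>s t. 0 \<le> s \<Longrightarrow> s \<le> h \<Longrightarrow> 0 \<le> t \<Longrightarrow> t \<le> h \<Longrightarrow> z + s *\<^sub>R v + t *\<^sub>R w \<in> S"
  shows "\<exists>s t. 0 < s \<and> s < h \<and> 0 < t \<and> t < h \<and>
    F (z + h *\<^sub>R v + h *\<^sub>R w) - F (z + h *\<^sub>R v) - F (z + h *\<^sub>R w) + F z
      = h * h * dderiv w (dderiv v F) (z + s *\<^sub>R v + t *\<^sub>R w)"
proof -
  have dF: "(F has_derivative (\<lambda>v. dderiv v F x)) (at x)" if "x \<in> S" for x
    using smooth_on_has_derivative assms that by blast
  have ddF: "(dderiv v F has_derivative (\<lambda>w. dderiv w (dderiv v F) x)) (at x)" if "x \<in> S" for x
    using smooth_on_has_derivative assms that smooth_on_dderiv by blast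
  have lin: "dderiv (r *\<^sub>R y) F x = r * dderiv y F x" if "x \<in> S" for r x y
    using linear_scale[OF linear_dderiv[OF smooth_on_differentiable[OF assms(2,1) that]], of r y] by simp
  have lin2: "dderiv (r *\<^sub>R y) (dderiv v F) x = r * dderiv y (dderiv v F) x" if "x \<in> S" for r x y
    using linear_scale[OF linear_dderiv[OF smooth_on_differentiable[OF smooth_on_dderiv[OF assms(2)] assms(1) that]], of r y] by simp
  \<comment> \<open>The increment in direction \<open>w\<close> as a function of the position along
    \<open>v\<close>: the mean value theorem is applied to it first, then in direction
    \<open>w\<close>. The term with factor 0 keeps both summands in one common shape.\<close>
  define g where "g s = F (z + s *\<^sub>R v + h *\<^sub>R w) - F (z + s *\<^sub>R v + 0 *\<^sub>R w)" for s
  have dg: "(g has_real_derivative dderiv v F (z + s *\<^sub>R v + h *\<^sub>R w) - dderiv v F (z + s *\<^sub>R v + 0 *\<^sub>R w)) (at s)"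
    if "0 \<le> s" "s \<le> h" for s
  proof -
    have in1: "z + s *\<^sub>R v + t *\<^sub>R w \<in> S" if "0 \<le> t" "t \<le> h" for t
      using seg[of s t] that \<open>0 \<le> s\<close> \<open>s \<le> h\<close> by blast
    have c: "((\<lambda>s. z + s *\<^sub>R v + t *\<^sub>R w) has_derivative (\<lambda>r. r *\<^sub>R v)) (at s)" for t
      by (auto intro!: derivative_eq_intros)
    have "((\<lambda>s. F (z + s *\<^sub>R v + t *\<^sub>R w)) has_derivative (\<lambda>r. dderiv (r *\<^sub>R v) F (z + s *\<^sub>R v + t *\<^sub>R w))) (at s)"
      if "0 \<le> t" "t \<le> h" for t
      using diff_chain_at[OF c dF[OF in1[OF that]]] by (simp add: o_def)
    then have "((\<lambda>s. F (z + s *\<^sub>R v + t *\<^sub>R w)) has_derivative (\<lambda>r. r * dderiv v F (z + s *\<^sub>R v + t *\<^sub>R w))) (at s)"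
      if "0 \<le> t" "t \<le> h" for t
      unfolding lin[OF in1[OF that], symmetric] using that .
    then
    have "((\<lambda>s. F (z + s *\<^sub>R v + t *\<^sub>R w)) has_real_derivative (dderiv v F (z + s *\<^sub>R v + t *\<^sub>R w))) (at s)"
      if "0 \<le> t" "t \<le> h" for t
      using that by (simp add: has_field_derivative_def mult_commute_abs)
    from this[of h] this[of 0] show ?thesis
      unfolding g_def using assms(3) by (intro DERIV_diff) auto
  qed
  obtain s where s: "0 < s" "s < h"
      "g h - g 0 = (h - 0) * (dderiv v F (z + s *\<^sub>R v + h *\<^sub>R w) - dderiv v F (z + s *\<^sub>R v + 0 *\<^sub>R w))"
    using MVT2[of 0 h g, OF \<open>h > 0\<close> dg] by blast
  have in2: "z + s *\<^sub>R v + t *\<^sub>R w \<in> S" if "0 \<le> t" "t \<le> h" for t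
    using seg[of s t] that s by auto
  have dk: "((\<lambda>t. dderiv v F (z + s *\<^sub>R v + t *\<^sub>R w)) has_real_derivative
      dderiv w (dderiv v F) (z + s *\<^sub>R v + t *\<^sub>R w)) (at t)" if "0 \<le> t" "t \<le> h" for t
  proof -
    have c: "((\<lambda>t. z + s *\<^sub>R v + t *\<^sub>R w) has_derivative (\<lambda>r. r *\<^sub>R w)) (at t)"
      by (auto intro!: derivative_eq_intros)
    show ?thesis
      using diff_chain_at[OF c ddF[OF in2[OF that]]] lin2[OF in2[OF that]]
      by (simp add: o_def has_field_derivative_def mult_commute_abs)
  qed
  obtain t where t: "0 < t" "t < h" "dderiv v F (z + s *\<^sub>R v + h *\<^sub>R w) - dderiv v F (z + s *\<^sub>R v + 0 *\<^sub>R w)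
       = (h - 0) * dderiv w (dderiv v F) (z + s *\<^sub>R v + t *\<^sub>R w)"
    using MVT2[of 0 h, OF \<open>h > 0\<close> dk] by blast
  have "g h - g 0 = h * h * dderiv w (dderiv v F) (z + s *\<^sub>R v + t *\<^sub>R w)"
    using s(3) t(3) by simp
  moreover have "g h - g 0 = F (z + h *\<^sub>R v + h *\<^sub>R w) - F (z + h *\<^sub>R v) - F (z + h *\<^sub>R w) + F z"
    by (simp add: g_def)
  ultimately show ?thesis using s t by metis
qed

text \<open>The second difference is symmetric in \<open>v\<close> and \<open>w\<close>, so both
  iterated derivatives take a common value at two points of an arbitrarily small parallelogram;
  continuity does the rest.\<close>

lemma dderiv_commute_real:
  fixes F :: "'a::real_normed_vector \<Rightarrow> real"
  assumes "open S" "smooth_on S F" "z \<in> S"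
  shows "dderiv w (dderiv v F) z = dderiv v (dderiv w F) z"
proof (rule ccontr)
  let ?P = "dderiv w (dderiv v F)" and ?Q = "dderiv v (dderiv w F)"
  assume ne: "?P z \<noteq> ?Q z"
  define e where "e = dist (?P z) (?Q z) / 2"
  have "e > 0" using ne by (simp add: e_def)
  have "continuous_on S ?P" "continuous_on S ?Q"
    using assms smooth_on_continuous smooth_on_dderiv by blast+
  then obtain d1 d2 where d: "d1 > 0" "\<forall>x\<in>S. dist x z < d1 \<longrightarrow> dist (?P x) (?P z) < e"
      "d2 > 0" "\<forall>x\<in>S. dist x z < d2 \<longrightarrow> dist (?Q x) (?Q z) < e"
    using assms(3) \<open>e > 0\<close> unfolding continuous_on_iff by metis
  obtain d0 where d0: "d0 > 0" "ball z d0 \<subseteq> S"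
    using assms openE by blast
  define d where "d = min d0 (min d1 d2)"
  \<comment> \<open>The whole parallelogram of side parameter \<open>h\<close> then stays within
    distance d / 2 of \<open>z\<close>; the summand 1 keeps the denominator positive for v = w =
    0.\<close>
  define h where "h = d / (2 * (norm v + norm w + 1))"
  have "d > 0" using d d0 by (simp add: d_def)
  then have h: "h > 0" unfolding h_def by (intro divide_pos_pos) (auto simp: add_nonneg_pos)
  have small: "dist (z + s *\<^sub>R v + t *\<^sub>R w) z < d" if "0 \<le> s" "s \<le> h" "0 \<le> t" "t \<le> h" for s t
  proof -
    have "dist (z + s *\<^sub>R v + t *\<^sub>R w) z \<le> s * norm v + t * norm w"
      using that norm_triangle_ineq[of "s *\<^sub>R v" "t *\<^sub>R w"] by (simp add: dist_norm algebra_simps)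
    also have "\<dots> \<le> h * norm v + h * norm w"
      using that by (intro add_mono mult_right_mono) auto
    also have "\<dots> \<le> h * (norm v + norm w + 1)"
      using h by (simp add: algebra_simps)
    also have "\<dots> = d / 2"
      using add_nonneg_pos[of "norm v + norm w" 1] by (simp add: h_def field_simps)
    finally show ?thesis using \<open>d > 0\<close> by simp
  qed
  have seg: "z + s *\<^sub>R v + t *\<^sub>R w \<in> S" if "0 \<le> s" "s \<le> h" "0 \<le> t" "t \<le> h" for s t
    using small[OF that] d0 by (auto simp: d_def dist_commute subset_eq)
  obtain s t where st: "0 < s" "s < h" "0 < t" "t < h"
    "F (z + h *\<^sub>R v + h *\<^sub>R w) - F (z + h *\<^sub>R v) - F (z + h *\<^sub>R w) + F z = h * h * ?P (z + s *\<^sub>R v + t *\<^sub>R w)"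
    using second_difference_mean_value[OF assms(1,2) h seg] by blast
  have seg': "z + s *\<^sub>R w + t *\<^sub>R v \<in> S" if "0 \<le> s" "s \<le> h" "0 \<le> t" "t \<le> h" for s t
    using seg[of t s] that by (simp add: add.assoc add.commute[of "s *\<^sub>R w"])
  obtain s' t' where st': "0 < s'" "s' < h" "0 < t'" "t' < h"
    "F (z + h *\<^sub>R w + h *\<^sub>R v) - F (z + h *\<^sub>R w) - F (z + h *\<^sub>R v) + F z = h * h * ?Q (z + s' *\<^sub>R w + t' *\<^sub>R v)"
    using second_difference_mean_value[OF assms(1,2) h seg'] by blast
  have "h * h * ?P (z + s *\<^sub>R v + t *\<^sub>R w) = h * h * ?Q (z + s' *\<^sub>R w + t' *\<^sub>R v)"
    unfolding st(5)[symmetric] st'(5)[symmetric] by (simp add: algebra_simps)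
  then have eq: "?P (z + s *\<^sub>R v + t *\<^sub>R w) = ?Q (z + t' *\<^sub>R v + s' *\<^sub>R w)"
    using h by (simp add: add.assoc add.commute[of "s' *\<^sub>R w"])
  have "dist (?P (z + s *\<^sub>R v + t *\<^sub>R w)) (?P z) < e"
    using d(2) seg[of s t] small[of s t] st by (auto simp: d_def)
  moreover have "dist (?Q (z + t' *\<^sub>R v + s' *\<^sub>R w)) (?Q z) < e"
    using d(4) seg[of t' s'] small[of t' s'] st' by (auto simp: d_def)
  ultimately have "dist (?P z) (?Q z) < 2 * e"
    using eq dist_triangle_half_r[of "?P (z + s *\<^sub>R v + t *\<^sub>R w)" "?P z" "2*e" "?Q z"] by (simp add: dist_commute)
  then show False by (simp add: e_def)
qed

lemma dderiv_inner_const: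
  assumes "u differentiable (at z)"
  shows "dderiv v (\<lambda>x. inner (u x) b) z = inner (dderiv v u z) b"
  by (rule dderiv_eq) (intro has_derivative_inner_left has_derivative_dderiv assms)

lemma dderiv_commute:
  fixes u :: "'a::real_normed_vector \<Rightarrow> 'b::euclidean_space"
  assumes "open S" "smooth_on S u" "z \<in> S"
  shows "dderiv w (dderiv v u) z = dderiv v (dderiv w u) z"
proof (rule euclidean_eqI)
  fix b :: 'b assume "b \<in> Basis"
  have sm: "smooth_on S (\<lambda>x. inner (u x) b)"
    by (rule smooth_on_linear[OF assms(1) bounded_linear_inner_left assms(2)])
  have 1: "dderiv v (\<lambda>x. inner (u x) b) x = inner (dderiv v u x) b" if "x \<in> S" for v x
    by (rule dderiv_inner_const[OF smooth_on_differentiable[OF assms(2,1) that]])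
  have 2: "dderiv w (dderiv v (\<lambda>x. inner (u x) b)) z = inner (dderiv w (dderiv v u) z) b" for v w
    by (subst dderiv_cong_open[OF assms(1,3) 1]) (assumption,
      rule dderiv_inner_const[OF smooth_on_differentiable[OF smooth_on_dderiv[OF assms(2)] assms(1,3)]])
  show "inner (dderiv w (dderiv v u) z) b = inner (dderiv v (dderiv w u) z) b"
    using dderiv_commute_real[OF assms(1) sm assms(3), of w v] 2 by simp
qed

text \<open>The primitive is the integral of the form along the segment from \<open>z0\<close>.
  Differentiating under the integral and using closedness leaves an integrand that is a total
  derivative in the segment parameter.\<close>

lemma poincare_lemma:
  fixes P :: "'a::euclidean_space \<Rightarrow> 'a"
  assumes S: "open S" "convex S" "z0 \<in> S" and P: "smooth_on S P"
    and closed: "\<And>z v w. z \<in> S \<Longrightarrow> inner (dderiv v P z) w = inner (dderiv w P z) v"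
  obtains h :: "'a \<Rightarrow> real" where "smooth_on S h"
    "\<And>z. z \<in> S \<Longrightarrow> (h has_derivative (\<lambda>v. inner (P z) v)) (at z)"
proof -
  define c where "c z t = z0 + t *\<^sub>R (z - z0)" for z and t :: real
  have c: "c z t \<in> S" if "z \<in> S" "t \<in> cbox 0 1" for z t
    using convexD_alt[OF S(2) S(3) that(1), of t] that(2) by (simp add: c_def algebra_simps)
  have dP: "(P has_derivative (\<lambda>v. dderiv v P z)) (at z)" if "z \<in> S" for z
    by (rule smooth_on_has_derivative[OF P S(1) that])
  \<comment> \<open>This is the derivative of t P(c z t) with respect to t, so its integral over the
    unit interval is P z.\<close>
  define G where "G z t = P (c z t) + t *\<^sub>R dderiv (z - z0) P (c z t)" for z t
  define h where "h z = integral (cbox 0 1) (\<lambda>t. inner (P (c z t)) (z - z0))" for z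
  have contc: "continuous_on (S \<times> cbox 0 1) (\<lambda>x. c (fst x) (snd x))"
    unfolding c_def by (intro continuous_intros)
  have comp: "continuous_on (S \<times> cbox 0 1) (\<lambda>x. F (c (fst x) (snd x)))"
    if "continuous_on S F" for F :: "'a \<Rightarrow> 'a"
    by (rule continuous_on_compose2[OF that contc]) (use c in auto)
  have cP: "continuous_on (S \<times> cbox 0 1) (\<lambda>x. P (c (fst x) (snd x)))"
    by (rule comp[OF smooth_on_continuous[OF P]])
  have cdP: "continuous_on (S \<times> cbox 0 1) (\<lambda>x. dderiv b P (c (fst x) (snd x)))" for b
    by (rule comp[OF smooth_on_continuous[OF smooth_on_dderiv[OF P]]])
  have G_alt: "G z t = P (c z t) + t *\<^sub>R (\<Sum>b\<in>Basis. inner (z - z0) b *\<^sub>R dderiv b P (c z t))"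
    if "z \<in> S" "t \<in> cbox 0 1" for z t
    unfolding G_def by (simp only: dderiv_euclidean[OF smooth_on_differentiable[OF P S(1) c[OF that]], of "z - z0"])
  have contG: "continuous_on (S \<times> cbox 0 1) (\<lambda>x. G (fst x) (snd x))"
  proof (subst continuous_on_cong[OF refl])
    show "G (fst x) (snd x) = P (c (fst x) (snd x)) + snd x *\<^sub>R
      (\<Sum>b\<in>Basis. inner (fst x - z0) b *\<^sub>R dderiv b P (c (fst x) (snd x)))" if "x \<in> S \<times> cbox 0 1" for x
      using that by (intro G_alt) auto
    show "continuous_on (S \<times> cbox 0 1) (\<lambda>x. P (c (fst x) (snd x)) + snd x *\<^sub>R
      (\<Sum>b\<in>Basis. inner (fst x - z0) b *\<^sub>R dderiv b P (c (fst x) (snd x))))"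
      by (intro continuous_on_add continuous_on_scaleR continuous_on_sum continuous_on_inner continuous_on_diff
          continuous_on_const continuous_on_fst continuous_on_snd continuous_on_id cP cdP)
  qed
  have intG: "(G z has_integral P z) (cbox 0 1)" if z: "z \<in> S" for z
  proof -
    have "((\<lambda>t. t *\<^sub>R P (c z t)) has_vector_derivative G z t) (at t)" if t: "t \<in> cbox 0 1" for t
    proof -
      have d: "((\<lambda>t. c z t) has_derivative (\<lambda>r. r *\<^sub>R (z - z0))) (at t)"
        unfolding c_def by (auto intro!: derivative_eq_intros)
      have "((\<lambda>t. P (c z t)) has_derivative (\<lambda>r. dderiv (r *\<^sub>R (z - z0)) P (c z t))) (at t)"
        using diff_chain_at[OF d dP[OF c[OF z t]]] by (simp add: o_def)
      then have "((\<lambda>t. P (c z t)) has_vector_derivative dderiv (z - z0) P (c z t)) (at t)"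
        unfolding has_vector_derivative_def
        using linear_scale[OF linear_dderiv[OF smooth_on_differentiable[OF P S(1) c[OF z t]]]] by simp
      from has_vector_derivative_scaleR[OF DERIV_ident this]
      show ?thesis by (simp add: G_def add.commute)
    qed
    then have "(G z has_integral 1 *\<^sub>R P (c z 1) - 0 *\<^sub>R P (c z 0)) {0..1}"
      by (intro fundamental_theorem_of_calculus[where f = "\<lambda>t. t *\<^sub>R P (c z t)"])
        (auto intro: has_vector_derivative_at_within)
    then show ?thesis by (simp add: c_def)
  qed
  have dh: "(h has_derivative (\<lambda>v. inner (P z) v)) (at z)" if z: "z \<in> S" for z
  proof -
    have 1: "((\<lambda>z. inner (P (c z t)) (z - z0)) has_derivative blinfun_apply (blinfun_inner_right (G x t))) (at x within S)"
      if x: "x \<in> S" and t: "t \<in> cbox 0 1" for x t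
    proof -
      have d: "((\<lambda>z. c z t) has_derivative (\<lambda>v. t *\<^sub>R v)) (at x)"
        unfolding c_def by (auto intro!: derivative_eq_intros)
      have "((\<lambda>z. P (c z t)) has_derivative (\<lambda>v. dderiv (t *\<^sub>R v) P (c x t))) (at x)"
        using diff_chain_at[OF d dP[OF c[OF x t]]] by (simp add: o_def)
      then have "((\<lambda>z. inner (P (c z t)) (z - z0)) has_derivative
          (\<lambda>v. inner (P (c x t)) v + inner (dderiv (t *\<^sub>R v) P (c x t)) (x - z0))) (at x)"
        by (auto intro!: derivative_eq_intros)
      \<comment> \<open>Closedness exchanges \<open>v\<close> with \<open>x - z0\<close> in the
        derivative of \<open>P\<close>, which turns the gradient of the integrand into
        \<open>G\<close>.\<close>
      also have "(\<lambda>v. inner (P (c x t)) v + inner (dderiv (t *\<^sub>R v) P (c x t)) (x - z0))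
          = blinfun_apply (blinfun_inner_right (G x t))"
        using linear_scale[OF linear_dderiv[OF smooth_on_differentiable[OF P S(1) c[OF x t]]]]
          closed[OF c[OF x t], of _ "x - z0"]
        by (simp add: fun_eq_iff G_def inner_add_left)
      finally show ?thesis by (rule has_derivative_at_withinI)
    qed
    have 2: "(\<lambda>t. inner (P (c x t)) (x - z0)) integrable_on cbox 0 1" if "x \<in> S" for x
    proof (intro integrable_continuous continuous_intros)
      show "continuous_on (cbox 0 1) (\<lambda>t. P (c x t))"
        by (rule continuous_on_compose2[OF smooth_on_continuous[OF P]])
          (use c that in \<open>auto simp: c_def intro!: continuous_intros\<close>)
    qed
    have 3: "continuous_on (S \<times> cbox 0 1) (\<lambda>(x, t). blinfun_inner_right (G x t))"
      unfolding split_beta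
      by (intro bounded_linear.continuous_on[OF bounded_linear_blinfun_inner_right] contG)
    have "(h has_derivative integral (cbox 0 1) (\<lambda>t. blinfun_inner_right (G z t))) (at z within S)"
      unfolding h_def using leibniz_rule[OF 1 2 3 z S(2)] by simp
    moreover have "integral (cbox 0 1) (\<lambda>t. blinfun_inner_right (G z t)) = blinfun_inner_right (P z)"
      using has_integral_linear[OF intG[OF z] bounded_linear_blinfun_inner_right]
      by (simp add: o_def integral_unique)
    ultimately show ?thesis
      using at_within_open[OF z S(1)] by (simp add: blinfun_inner_right.rep_eq)
  qed
  have "smooth_on S (dderiv v h)" for v
    by (subst smooth_on_cong[OF S(1), of _ "\<lambda>z. inner (P z) v"])
      (simp_all add: dderiv_eq[OF dh] smooth_on_linear[OF S(1) bounded_linear_inner_left P])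
  moreover have "h differentiable_on S"
    using dh by (auto simp: differentiable_on_def differentiable_def intro: has_derivative_at_withinI)
  ultimately have "smooth_on S h" using smooth_on_iff by blast
  then show ?thesis using dh that by blast
qed

section \<open>Linear algebra and inverse functions in the plane\<close>

lemma vec2_eq: "(v::real^2) = v $ 1 *\<^sub>R axis 1 1 + v $ 2 *\<^sub>R axis 2 1"
  by (simp add: vec_eq_iff forall_2 axis_def)

lemma dderiv_coords:
  fixes u :: "real^2 \<Rightarrow> 'a::real_normed_vector"
  assumes "u differentiable (at z)"
  shows "dderiv v u z = v $ 1 *\<^sub>R dderiv (axis 1 1) u z + v $ 2 *\<^sub>R dderiv (axis 2 1) u z"
proof -
  note lin = linear_dderiv[OF assms]
  have "dderiv v u z = dderiv (v $ 1 *\<^sub>R axis 1 1 + v $ 2 *\<^sub>R axis 2 1) u z"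
    using vec2_eq[of v] by simp
  then show ?thesis by (simp only: linear_add[OF lin] linear_scale[OF lin])
qed

definition jac2 :: "(real^2 \<Rightarrow> real^2) \<Rightarrow> real^2 \<Rightarrow> real" where
  "jac2 t z = dderiv (axis 1 1) t z $ 1 * dderiv (axis 2 1) t z $ 2 - dderiv (axis 2 1) t z $ 1 * dderiv (axis 1 1) t z $ 2"

lemma jac2_det: "jac2 t z = det (matrix (frechet_derivative t (at z)))"
  by (simp add: jac2_def det_2 matrix_def dderiv_def)

lemma smooth_on_component: "open S \<Longrightarrow> smooth_on S u \<Longrightarrow> smooth_on S (\<lambda>z. (u z :: real^'n) $ i)"
  by (rule smooth_on_linear[OF _ bounded_linear_vec_nth])

lemma smooth_on_jac2: "open S \<Longrightarrow> smooth_on S t \<Longrightarrow> smooth_on S (jac2 t)"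
  unfolding jac2_def [abs_def]
  by (intro smooth_on_diff smooth_on_mult smooth_on_component smooth_on_dderiv)

text \<open>Cramer's rule for the inverse of the derivative of \<open>t\<close> at \<open>z\<close>,
  applied to \<open>v\<close>. As a rational expression in the partial derivatives it depends
  smoothly on \<open>z\<close>.\<close>

definition cramer2 :: "(real^2 \<Rightarrow> real^2) \<Rightarrow> real^2 \<Rightarrow> real^2 \<Rightarrow> real^2" where
  "cramer2 t v z =
     ((v $ 1 * dderiv (axis 2 1) t z $ 2 - v $ 2 * dderiv (axis 2 1) t z $ 1) / jac2 t z) *\<^sub>R axis 1 1 +
     ((v $ 2 * dderiv (axis 1 1) t z $ 1 - v $ 1 * dderiv (axis 1 1) t z $ 2) / jac2 t z) *\<^sub>R axis 2 1"

lemma cramer2_nth: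
  "cramer2 t v z $ 1 = (v $ 1 * dderiv (axis 2 1) t z $ 2 - v $ 2 * dderiv (axis 2 1) t z $ 1) / jac2 t z"
  "cramer2 t v z $ 2 = (v $ 2 * dderiv (axis 1 1) t z $ 1 - v $ 1 * dderiv (axis 1 1) t z $ 2) / jac2 t z"
  by (simp_all add: cramer2_def axis_def)

lemma cramer2_dderiv:
  assumes "t differentiable (at z)" "jac2 t z \<noteq> 0"
  shows "cramer2 t (dderiv w t z) z = w"
proof -
  have *: "((x * a + y * b) * d - (x * c + y * d) * b) / (a * d - b * c) = x"
    "((x * c + y * d) * a - (x * a + y * b) * c) / (a * d - b * c) = y"
    if "a * d - b * c \<noteq> 0" for a b c d x y :: real
    using that by (simp_all add: divide_simps) (simp_all add: algebra_simps)
  show ?thesis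
    using * [OF assms(2)[unfolded jac2_def]]
    by (simp add: vec_eq_iff forall_2 cramer2_nth dderiv_coords[OF assms(1), of w] jac2_def del: mult_cancel_right2)
qed

lemma dderiv_cramer2:
  assumes "t differentiable (at z)" "jac2 t z \<noteq> 0"
  shows "dderiv (cramer2 t v z) t z = v"
proof -
  have *: "(x * d - y * b) / (a * d - b * c) * a + (y * a - x * c) / (a * d - b * c) * b = x"
    "(x * d - y * b) / (a * d - b * c) * c + (y * a - x * c) / (a * d - b * c) * d = y"
    if "a * d - b * c \<noteq> 0" for a b c d x y :: real
    using that by (simp_all add: divide_simps) (simp_all add: algebra_simps)
  show ?thesis
    using * [OF assms(2)[unfolded jac2_def]]
    by (subst dderiv_coords[OF assms(1)]) (simp add: vec_eq_iff forall_2 cramer2_nth jac2_def)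
qed

lemma smooth_on_cramer2:
  assumes "open S" "smooth_on S t" "\<And>z. z \<in> S \<Longrightarrow> jac2 t z \<noteq> 0"
  shows "smooth_on S (cramer2 t v)"
  unfolding cramer2_def [abs_def]
  by (intro smooth_on_add smooth_on_diff smooth_on_scaleR smooth_on_divide smooth_on_mult smooth_on_const
      smooth_on_component smooth_on_dderiv smooth_on_jac2 assms)

text \<open>The inverse function theorem yields a differentiable inverse \<open>s\<close>. Its
  derivative is \<open>cramer2 t v\<close> composed with \<open>s\<close>, so each order of
  smoothness of \<open>s\<close> gives the next.\<close>

lemma smooth_local_inverse:
  fixes t :: "real^2 \<Rightarrow> real^2"
  assumes W: "open W" "z0 \<in> W" and t: "smooth_on W t" and J: "\<And>z. z \<in> W \<Longrightarrow> jac2 t z \<noteq> 0"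
  obtains U V s where "open U" "U \<subseteq> W" "z0 \<in> U" "open V" "homeomorphism U V t s"
    "smooth_on V s" "\<And>y v. y \<in> V \<Longrightarrow> dderiv v s y = cramer2 t v (s y)"
proof -
  have dt: "(t has_derivative (\<lambda>v. dderiv v t z)) (at z)" if "z \<in> W" for z
    by (rule smooth_on_has_derivative[OF t W(1) that])
  \<comment> \<open>Assembling the derivative from its two columns makes its continuity as a bounded
    linear map visible.\<close>
  define f' where "f' z = (\<Sum>j\<in>UNIV. blinfun_scaleR_left (dderiv (axis j 1) t z) o\<^sub>L Blinfun (\<lambda>v::real^2. v $ j))" for z
  have f'_apply: "blinfun_apply (f' z) = (\<lambda>v. dderiv v t z)" if "z \<in> W" for z
  proof
    fix v
    have "blinfun_apply (f' z) v = (\<Sum>j\<in>UNIV. v $ j *\<^sub>R dderiv (axis j 1) t z)"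
      unfolding f'_def
      by (simp add: blinfun.sum_left bounded_linear_Blinfun_apply[OF bounded_linear_vec_nth])
    also have "\<dots> = dderiv v t z"
      using dderiv_coords[OF smooth_on_differentiable[OF t W(1) that], of v] by (simp add: UNIV_2)
    finally show "blinfun_apply (f' z) v = dderiv v t z" .
  qed
  have contf': "continuous_on W f'"
    unfolding f'_def
    by (intro continuous_intros bounded_linear.continuous_on[OF bounded_linear_blinfun_scaleR_left]
        smooth_on_continuous smooth_on_dderiv t)
  have dt': "(t has_derivative blinfun_apply (f' z)) (at z)" if "z \<in> W" for z
    using dt[OF that] f'_apply[OF that] by simp
  define invf where "invf = Blinfun (\<lambda>v. cramer2 t v z0)"
  have lin: "bounded_linear (\<lambda>v. cramer2 t v z0)"
    unfolding cramer2_def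
    by (intro linear_linear[THEN iffD2] linearI) (auto simp: algebra_simps add_divide_distrib diff_divide_distrib)
  have inv: "invf o\<^sub>L f' z0 = id_blinfun"
    by (rule blinfun_eqI)
      (simp add: invf_def bounded_linear_Blinfun_apply[OF lin] f'_apply[OF W(2)]
        cramer2_dderiv[OF smooth_on_differentiable[OF t W] J[OF W(2)]])
  obtain U V s g' where *: "open U" "U \<subseteq> W" "z0 \<in> U" "open V" "t z0 \<in> V" "homeomorphism U V t s"
    "\<And>y. y \<in> V \<Longrightarrow> (s has_derivative (g' y)) (at y)"
    "\<And>y. y \<in> V \<Longrightarrow> g' y = inv (blinfun_apply (f' (s y)))"
    "\<And>y. y \<in> V \<Longrightarrow> bij (blinfun_apply (f' (s y)))"
    by (rule inverse_function_theorem[OF W(1) dt' contf' W(2) inv], assumption) (rule that; simp)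
  have sU: "s y \<in> U" if "y \<in> V" for y
    using *(6) that unfolding homeomorphism_def by blast
  have ds: "dderiv v s y = cramer2 t v (s y)" if y: "y \<in> V" for y v
  proof -
    have sW: "s y \<in> W" using sU[OF y] *(2) by blast
    have "dderiv v s y = inv (blinfun_apply (f' (s y))) v"
      using dderiv_eq[OF *(7)[OF y]] *(8)[OF y] by simp
    also have "\<dots> = cramer2 t v (s y)"
    proof (rule inv_f_eq)
      show "inj (blinfun_apply (f' (s y)))" using *(9)[OF y] by (simp add: bij_def)
      show "blinfun_apply (f' (s y)) (cramer2 t v (s y)) = v"
        using dderiv_cramer2[OF smooth_on_differentiable[OF t W(1) sW] J[OF sW]] f'_apply[OF sW] by simp
    qed
    finally show ?thesis .
  qed
  have sd: "s differentiable_on V"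
    using *(7) by (auto simp: differentiable_on_def differentiable_def intro: has_derivative_at_withinI)
  have "Ck_on k V s" for k
  proof (induction k)
    case 0
    then show ?case using *(6) by (simp add: homeomorphism_def)
  next
    case (Suc k)
    have "Ck_on k V (\<lambda>y. cramer2 t v (s y))" for v
      using smooth_on_cramer2[OF \<open>open U\<close> smooth_on_subset[OF t *(2)], of v] J *(2) sU
      by (intro Ck_on_compose[OF *(4) *(1) _ Suc]) (auto simp: smooth_on_def)
    then have "Ck_on k V (dderiv v s)" for v
      by (subst Ck_on_cong[OF *(4), of _ "\<lambda>y. cramer2 t v (s y)"]) (auto simp: ds)
    then show ?case using sd by simp
  qed
  then have "smooth_on V s" by (simp add: smooth_on_def)
  then show ?thesis using * ds by (intro that[of U V s]) blast+
qed

section \<open>Fundamental forms and reparametrization\<close>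

lemma orth_proj_eqI:
  assumes "subspace S" "y \<in> S" "\<And>s. s \<in> S \<Longrightarrow> inner (q - y) s = 0"
  shows "orth_proj S q = y"
  unfolding orth_proj_def
proof (rule the_equality)
  show "y \<in> S \<and> (\<forall>s\<in>S. inner (q - y) (s - y) = 0)"
    using assms by (auto simp: inner_diff_right)
next
  fix x assume x: "x \<in> S \<and> (\<forall>s\<in>S. inner (q - x) (s - x) = 0)"
  have "inner (q - x) (y - x) = 0" using x assms(2) by blast
  moreover have "inner (q - y) (y - x) = 0"
    using assms x subspace_diff by blast
  ultimately have "inner (y - x) (y - x) = 0"
    by (simp add: inner_diff_left)
  then show "x = y" by simp
qed

lemma orth_proj_ex:
  assumes "subspace S"
  obtains y where "orth_proj S q = y" "y \<in> S" "\<And>s. s \<in> S \<Longrightarrow> inner (q - y) s = 0"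
proof -
  obtain y z where yz: "y \<in> span S" "\<And>w. w \<in> span S \<Longrightarrow> orthogonal z w" "q = y + z"
    using orthogonal_subspace_decomp_exists[of S q] by blast
  have "inner (q - y) s = 0" if "s \<in> S" for s
    using yz(2)[OF span_base[OF that]] yz(3) by (simp add: orthogonal_def)
  moreover have "y \<in> S" using yz(1) assms by (simp add: span_eq_iff[THEN iffD2])
  ultimately show ?thesis using that orth_proj_eqI[OF assms] by blast
qed

lemma linear_orth_proj: "subspace S \<Longrightarrow> linear (orth_proj S)"
proof (rule linearI)
  assume S: "subspace S"
  fix x y :: 'a and c :: real
  obtain a where a: "orth_proj S x = a" "a \<in> S" "\<And>s. s \<in> S \<Longrightarrow> inner (x - a) s = 0"
    using orth_proj_ex[OF S] by blast
  obtain b where b: "orth_proj S y = b" "b \<in> S" "\<And>s. s \<in> S \<Longrightarrow> inner (y - b) s = 0"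
    using orth_proj_ex[OF S] by blast
  show "orth_proj S (x + y) = orth_proj S x + orth_proj S y"
    using a b S by (intro orth_proj_eqI) (auto simp: subspace_add inner_diff_left inner_add_left)
  show "orth_proj S (c *\<^sub>R x) = c *\<^sub>R orth_proj S x"
    using a S by (intro orth_proj_eqI) (auto simp: subspace_scale inner_diff_left)
qed

lemma mem_orthogonal_comp: "x \<in> orthogonal_comp T \<longleftrightarrow> (\<forall>y\<in>T. inner y x = 0)"
  by (simp add: orthogonal_comp_def orthogonal_def)

lemma orthogonal_comp_span: "orthogonal_comp (span T) = orthogonal_comp T"
proof
  show "orthogonal_comp T \<subseteq> orthogonal_comp (span T)"
  proof
    fix x assume x: "x \<in> orthogonal_comp T"
    have "inner y x = 0" if "y \<in> span T" for y
      using that by (induction rule: span_induct_alt) (use x in \<open>auto simp: mem_orthogonal_comp inner_add_left\<close>)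
    then show "x \<in> orthogonal_comp (span T)" by (simp add: mem_orthogonal_comp)
  qed
qed (simp add: orthogonal_comp_anti_mono span_superset)

text \<open>The normal spaces here are complements of explicit sets, so a projection is recognised
  from a residual in the span of such a set, without a basis of the complement.\<close>

lemma orth_proj_comp_eqI:
  assumes "y \<in> orthogonal_comp T" "q - y \<in> span T"
  shows "orth_proj (orthogonal_comp T) q = y"
proof (rule orth_proj_eqI[OF subspace_orthogonal_comp assms(1)])
  fix s assume "s \<in> orthogonal_comp T"
  then have "s \<in> orthogonal_comp (span T)" by (simp add: orthogonal_comp_span)
  then show "inner (q - y) s = 0" using assms(2) by (simp add: mem_orthogonal_comp)
qed

lemma orth_proj_comp_ex:
  obtains "orth_proj (orthogonal_comp T) q \<in> orthogonal_comp T" "q - orth_proj (orthogonal_comp T) q \<in> span T"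
proof -
  obtain y where y: "orth_proj (orthogonal_comp T) q = y" "y \<in> orthogonal_comp T"
    "\<And>s. s \<in> orthogonal_comp T \<Longrightarrow> inner (q - y) s = 0"
    using orth_proj_ex[OF subspace_orthogonal_comp] by blast
  have "q - y \<in> orthogonal_comp (orthogonal_comp (span T))"
    using y(3) by (simp add: mem_orthogonal_comp orthogonal_comp_span inner_commute)
  then have "q - y \<in> span T" by (simp add: orthogonal_comp_self)
  then show ?thesis using y that by simp
qed

lemma orth_proj_comp_cong:
  assumes "v - w \<in> span T"
  shows "orth_proj (orthogonal_comp T) v = orth_proj (orthogonal_comp T) w"
proof -
  obtain 1: "orth_proj (orthogonal_comp T) w \<in> orthogonal_comp T" "w - orth_proj (orthogonal_comp T) w \<in> span T"
    using orth_proj_comp_ex by blast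
  show ?thesis
    using span_add[OF assms 1(2)] by (intro orth_proj_comp_eqI 1) simp
qed

lemma orth_proj_comp_eq_0: "orth_proj (orthogonal_comp T) v = 0 \<longleftrightarrow> v \<in> span T"
proof
  assume "orth_proj (orthogonal_comp T) v = 0"
  then show "v \<in> span T" using orth_proj_comp_ex[of T v] by (metis diff_zero)
next
  assume "v \<in> span T"
  then show "orth_proj (orthogonal_comp T) v = 0"
    by (intro orth_proj_comp_eqI) (auto simp: mem_orthogonal_comp)
qed

lemma tangent_space_alt: "tangent_space u z = range (\<lambda>v. dderiv v u z)"
  by (simp add: tangent_space_def dderiv_def)

lemma span_tangent_space:
  assumes "u differentiable (at z)"
  shows "span (tangent_space u z) = tangent_space u z"
  unfolding tangent_space_alt span_eq_iff
  using linear_subspace_image[OF linear_dderiv[OF assms] subspace_UNIV] .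

lemma tangent_space_span:
  assumes "u differentiable (at z)"
  shows "tangent_space u z = span {dderiv (axis 1 1) u z, dderiv (axis 2 1) u z}"
proof
  show "tangent_space u z \<subseteq> span {dderiv (axis 1 1) u z, dderiv (axis 2 1) u z}"
    unfolding tangent_space_alt
    by (rule image_subsetI, subst dderiv_coords[OF assms]) (intro span_add span_scale span_base; simp)
  have "span {dderiv (axis 1 1) u z, dderiv (axis 2 1) u z} \<subseteq> span (tangent_space u z)"
    unfolding tangent_space_alt by (intro span_mono) auto
  then show "span {dderiv (axis 1 1) u z, dderiv (axis 2 1) u z} \<subseteq> tangent_space u z"
    by (simp add: span_tangent_space[OF assms])
qed

lemma gram_det_pos:
  fixes u :: "real^2 \<Rightarrow> 'a::euclidean_space"
  assumes "u differentiable (at z)" "inj (frechet_derivative u (at z))"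
  defines "u1 \<equiv> dderiv (axis 1 1) u z" and "u2 \<equiv> dderiv (axis 2 1) u z"
  shows "inner u1 u1 > 0" "inner u1 u1 * inner u2 u2 - (inner u1 u2)\<^sup>2 > 0"
proof -
  have nz: "dderiv v u z \<noteq> 0" if "v \<noteq> 0" for v
    using assms(2) that linear_0[OF linear_dderiv[OF assms(1)]] unfolding dderiv_def inj_def by metis
  have "axis 1 1 \<noteq> (0::real^2)" by (simp add: axis_eq_0_iff)
  then have "u1 \<noteq> 0" using nz unfolding u1_def by blast
  then show E: "inner u1 u1 > 0" by simp
  \<comment> \<open>Chosen so that its image is E times the component of \<open>u2\<close>
    orthogonal to \<open>u1\<close>; the squared length of that image is E times the Gram
    determinant.\<close>
  define w where "w = (- inner u1 u2) *\<^sub>R axis 1 1 + inner u1 u1 *\<^sub>R (axis 2 1 :: real^2)"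
  have w: "w $ 1 = - inner u1 u2" "w $ 2 = inner u1 u1" by (simp_all add: w_def axis_def)
  then have "w \<noteq> 0" using E by auto
  then have "dderiv w u z \<noteq> 0" by (rule nz)
  moreover have "dderiv w u z = (- inner u1 u2) *\<^sub>R u1 + inner u1 u1 *\<^sub>R u2"
    unfolding dderiv_coords[OF assms(1), of w] w u1_def u2_def ..
  ultimately have "inner ((- inner u1 u2) *\<^sub>R u1 + inner u1 u1 *\<^sub>R u2) ((- inner u1 u2) *\<^sub>R u1 + inner u1 u1 *\<^sub>R u2) > 0"
    by simp
  also have "inner ((- inner u1 u2) *\<^sub>R u1 + inner u1 u1 *\<^sub>R u2) ((- inner u1 u2) *\<^sub>R u1 + inner u1 u1 *\<^sub>R u2)
     = inner u1 u1 * (inner u1 u1 * inner u2 u2 - (inner u1 u2)\<^sup>2)"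
    by (simp add: inner_add_left inner_add_right inner_diff_left inner_diff_right inner_commute[of u2 u1] power2_eq_square algebra_simps)
  finally show "inner u1 u1 * inner u2 u2 - (inner u1 u2)\<^sup>2 > 0"
    using E by (simp add: zero_less_mult_iff)
qed

text \<open>The coefficient of \<open>u1\<close> in the projection of \<open>v\<close> onto the
  plane of \<open>u1\<close> and \<open>u2\<close>, obtained by solving the normal
  equations.\<close>

definition tangent_coeff :: "'a::euclidean_space \<Rightarrow> 'a \<Rightarrow> 'a \<Rightarrow> real" where
  "tangent_coeff u1 u2 v = (inner u2 u2 * inner v u1 - inner u1 u2 * inner v u2) / (inner u1 u1 * inner u2 u2 - inner u1 u2 * inner u1 u2)"

lemma orth_proj_tangent:
  fixes u1 u2 v :: "'a::euclidean_space"
  assumes "inner u1 u1 * inner u2 u2 - (inner u1 u2)\<^sup>2 \<noteq> 0"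
  shows "orth_proj (orthogonal_comp {u1, u2}) v = v - tangent_coeff u1 u2 v *\<^sub>R u1 - tangent_coeff u2 u1 v *\<^sub>R u2"
proof (rule orth_proj_comp_eqI)
  let ?D = "inner u1 u1 * inner u2 u2 - inner u1 u2 * inner u1 u2"
  have D: "?D \<noteq> 0" using assms by (simp add: power2_eq_square)
  have t2: "tangent_coeff u2 u1 v = (inner u1 u1 * inner v u2 - inner u1 u2 * inner v u1) / ?D"
    by (simp add: tangent_coeff_def inner_commute[of u2 u1] mult.commute)
  have "tangent_coeff u1 u2 v * ?D = inner u2 u2 * inner v u1 - inner u1 u2 * inner v u2"
    "tangent_coeff u2 u1 v * ?D = inner u1 u1 * inner v u2 - inner u1 u2 * inner v u1"
    using D by (simp add: tangent_coeff_def, simp add: t2)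
  then have "?D * (inner v u1 - tangent_coeff u1 u2 v * inner u1 u1 - tangent_coeff u2 u1 v * inner u1 u2) = 0"
    "?D * (inner v u2 - tangent_coeff u1 u2 v * inner u1 u2 - tangent_coeff u2 u1 v * inner u2 u2) = 0"
    by algebra+
  then show "v - tangent_coeff u1 u2 v *\<^sub>R u1 - tangent_coeff u2 u1 v *\<^sub>R u2 \<in> orthogonal_comp {u1, u2}"
    using D by (simp add: mem_orthogonal_comp inner_diff_right inner_commute[of u2 u1] inner_commute[of _ v])
  have "v - (v - tangent_coeff u1 u2 v *\<^sub>R u1 - tangent_coeff u2 u1 v *\<^sub>R u2) = tangent_coeff u1 u2 v *\<^sub>R u1 + tangent_coeff u2 u1 v *\<^sub>R u2"
    by simp
  moreover have "\<dots> \<in> span {u1, u2}"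
    by (intro span_add span_scale span_base; simp)
  ultimately show "v - (v - tangent_coeff u1 u2 v *\<^sub>R u1 - tangent_coeff u2 u1 v *\<^sub>R u2) \<in> span {u1, u2}"
    by (simp only:)
qed

lemma normal_fibre_span:
  assumes "u differentiable (at z)"
  shows "normal_fibre u z = orthogonal_comp {dderiv (axis 1 1) u z, dderiv (axis 2 1) u z}"
  unfolding normal_fibre_def tangent_space_span[OF assms] by (rule orthogonal_comp_span)

lemma orthogonal_comp_Un: "orthogonal_comp (S \<union> T) = orthogonal_comp S \<inter> orthogonal_comp T"
  by (auto simp: mem_orthogonal_comp)

text \<open>The derivatives of \<open>u\<close> up to second order span the sum of the tangent plane and \<open>N\<^sub>1\<close>.\<close>

definition osculating :: "(real^2 \<Rightarrow> 'a::euclidean_space) \<Rightarrow> real^2 \<Rightarrow> 'a set" where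
  "osculating u z = tangent_space u z \<union> {dderiv v (dderiv w u) z |v w. True}"

lemma higher_sff_2: "higher_sff u [X, Y] z = sff u X Y z"
proof -
  have "sff u X Y z \<in> normal_fibre u z"
    unfolding sff_def normal_fibre_def using orth_proj_comp_ex by blast
  then have "orth_proj (normal_fibre u z) (sff u X Y z) = sff u X Y z"
    unfolding normal_fibre_def by (intro orth_proj_eqI subspace_orthogonal_comp) auto
  then show ?thesis
    by (simp add: higher_sff.simps orthogonal_comp_def[of "{}"])
qed

lemma list_length_2: "{Xs. length Xs = 2} = {[x, y] |x y. True}"
  and list_length_3: "{Xs. length Xs = 3} = {[x, y, z] |x y z. True}"
  by (auto simp: numeral_2_eq_2 numeral_3_eq_3 length_Suc_conv)

lemma kth_normal_space_1: "kth_normal_space u 1 z = span {sff u X Y z |X Y. True}"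
proof -
  have "(\<lambda>Xs. higher_sff u Xs z) ` {Xs. length Xs = 2} = {sff u X Y z |X Y. True}"
    unfolding list_length_2 higher_sff_2[symmetric] by auto
  then show ?thesis unfolding kth_normal_space.simps[of u 1] one_add_one by simp
qed

lemma kth_normal_space_2: "kth_normal_space u 2 z = span {higher_sff u [X, Y, Z] z |X Y Z. True}"
proof -
  have "(\<lambda>Xs. higher_sff u Xs z) ` {Xs. length Xs = 3} = {higher_sff u [X, Y, Z] z |X Y Z. True}"
    unfolding list_length_3 by auto
  then show ?thesis by (simp add: kth_normal_space.simps[of u 2])
qed

text \<open>A second derivative and the corresponding value of \<open>sff\<close> differ by a
  tangent vector, so normal vectors cannot tell them apart.\<close>

lemma normal_fibre_Int_comp_N1:
  "normal_fibre u z \<inter> orthogonal_comp (kth_normal_space u 1 z) = orthogonal_comp (osculating u z)"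
proof -
  have "x \<in> orthogonal_comp {sff u X Y z |X Y. True} \<longleftrightarrow> x \<in> orthogonal_comp {dderiv v (dderiv w u) z |v w. True}"
    if x: "x \<in> normal_fibre u z" for x
  proof -
    have "inner (sff u v w z) x = inner (dderiv v (dderiv w u) z) x" for v w
    proof -
      have "dderiv v (dderiv w u) z - sff u v w z \<in> span (tangent_space u z)"
        unfolding sff_def normal_fibre_def using orth_proj_comp_ex by blast
      moreover have "x \<in> orthogonal_comp (span (tangent_space u z))"
        using x by (simp add: normal_fibre_def orthogonal_comp_span)
      ultimately have "inner (dderiv v (dderiv w u) z - sff u v w z) x = 0"
        by (simp add: mem_orthogonal_comp)
      then show ?thesis by (simp add: inner_diff_left)
    qed
    then show ?thesis unfolding mem_orthogonal_comp by fastforce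
  qed
  then show ?thesis
    unfolding kth_normal_space_1 orthogonal_comp_span osculating_def orthogonal_comp_Un
    by (auto simp: normal_fibre_def)
qed

text \<open>Subtracting tangential parts before differentiating changes the third derivative only by
  first and second derivatives of \<open>u\<close>, and these lie in the osculating space that the
  projection removes. The tangential coefficients must be smooth near the point for this product
  rule.\<close>

lemma higher_sff_3:
  fixes u :: "real^2 \<Rightarrow> 'a::euclidean_space"
  assumes S: "open S" "z \<in> S" and u: "smooth_on S u"
    and inj: "\<And>y. y \<in> S \<Longrightarrow> inj (frechet_derivative u (at y))"
  shows "higher_sff u [X, Y, Z] z = orth_proj (orthogonal_comp (osculating u z)) (dderiv X (dderiv Y (dderiv Z u)) z)"
proof -
  define u1 where "u1 = dderiv (axis 1 1) u"
  define u2 where "u2 = dderiv (axis 2 1) u"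
  define w where "w = dderiv Y (dderiv Z u)"
  have sm: "smooth_on S u1" "smooth_on S u2" "smooth_on S w"
    unfolding u1_def u2_def w_def by (intro smooth_on_dderiv u)+
  have df: "u differentiable (at y)" if "y \<in> S" for y
    by (rule smooth_on_differentiable[OF u S(1) that])
  have gram: "inner (u1 y) (u1 y) * inner (u2 y) (u2 y) - (inner (u1 y) (u2 y))\<^sup>2 \<noteq> 0" if "y \<in> S" for y
    using gram_det_pos[OF df[OF that] inj[OF that]] by (simp add: u1_def u2_def)
  define a where "a y = tangent_coeff (u1 y) (u2 y) (w y)" for y
  define b where "b y = tangent_coeff (u2 y) (u1 y) (w y)" for y
  have sa: "smooth_on S a" "smooth_on S b"
    unfolding a_def b_def tangent_coeff_def using gram
    by (auto intro!: smooth_on_divide smooth_on_diff smooth_on_mult smooth_on_inner S(1) sm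
       simp: power2_eq_square inner_commute mult.commute)
  have sff: "sff u Y Z y = w y - a y *\<^sub>R u1 y - b y *\<^sub>R u2 y" if "y \<in> S" for y
    unfolding sff_def normal_fibre_span[OF df[OF that]] w_def[symmetric] u1_def[symmetric] u2_def[symmetric]
    by (simp add: orth_proj_tangent[OF gram[OF that]] a_def b_def)
  note hd = smooth_on_has_derivative[OF _ S]
  have "((\<lambda>y. w y - a y *\<^sub>R u1 y - b y *\<^sub>R u2 y) has_derivative
     (\<lambda>X. dderiv X w z - (a z *\<^sub>R dderiv X u1 z + dderiv X a z *\<^sub>R u1 z) - (b z *\<^sub>R dderiv X u2 z + dderiv X b z *\<^sub>R u2 z))) (at z)"
    by (intro has_derivative_diff has_derivative_scaleR hd sm sa)
  then have d: "dderiv X (sff u Y Z) z =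
     dderiv X w z - (a z *\<^sub>R dderiv X u1 z + dderiv X a z *\<^sub>R u1 z) - (b z *\<^sub>R dderiv X u2 z + dderiv X b z *\<^sub>R u2 z)"
    using dderiv_cong_open[of S z _ _ X, OF S sff] dderiv_eq by simp
  have o1: "dderiv v u z \<in> span (osculating u z)" for v
    by (rule span_base) (auto simp: osculating_def tangent_space_alt)
  have o2: "dderiv v (dderiv w u) z \<in> span (osculating u z)" for v w
    by (rule span_base) (auto simp: osculating_def)
  have "dderiv X (sff u Y Z) z - dderiv X w z \<in> span (osculating u z)"
  proof -
    have "dderiv X (sff u Y Z) z - dderiv X w z =
       - ((a z *\<^sub>R dderiv X u1 z + dderiv X a z *\<^sub>R u1 z) + (b z *\<^sub>R dderiv X u2 z + dderiv X b z *\<^sub>R u2 z))"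
      by (simp add: d)
    then show ?thesis
      using o1 o2 by (simp only: u1_def u2_def) (intro span_neg span_add span_scale o1 o2)
  qed
  moreover have "dderiv X (sff u Y Z) z - normal_connection u X (sff u Y Z) z \<in> span (osculating u z)"
  proof -
    have "dderiv X (sff u Y Z) z - normal_connection u X (sff u Y Z) z \<in> span (tangent_space u z)"
      unfolding normal_connection_def normal_fibre_def using orth_proj_comp_ex by blast
    then show ?thesis using span_mono[of "tangent_space u z" "osculating u z"] by (auto simp: osculating_def)
  qed
  ultimately have "iter_sff u [X, Y, Z] z - dderiv X w z \<in> span (osculating u z)"
    using span_diff[of "dderiv X (sff u Y Z) z - dderiv X w z" "osculating u z"
       "dderiv X (sff u Y Z) z - normal_connection u X (sff u Y Z) z"] by simp
  then have "orth_proj (orthogonal_comp (osculating u z)) (iter_sff u [X, Y, Z] z)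
      = orth_proj (orthogonal_comp (osculating u z)) (dderiv X w z)"
    by (rule orth_proj_comp_cong)
  moreover have "higher_sff u [X, Y, Z] z = orth_proj (orthogonal_comp (osculating u z)) (iter_sff u [X, Y, Z] z)"
    unfolding higher_sff.simps using normal_fibre_Int_comp_N1[of u z] by simp
  ultimately show ?thesis by (simp add: w_def)
qed

section \<open>Change of chart\<close>

lemma dderiv_dderiv_coords:
  fixes F :: "real^2 \<Rightarrow> 'a::real_normed_vector"
  assumes "open W" "smooth_on W F" "y \<in> W"
  shows "dderiv x (dderiv c F) y = c $ 1 *\<^sub>R dderiv x (dderiv (axis 1 1) F) y + c $ 2 *\<^sub>R dderiv x (dderiv (axis 2 1) F) y"
proof -
  have "dderiv x (dderiv c F) y = dderiv x (\<lambda>y. c $ 1 *\<^sub>R dderiv (axis 1 1) F y + c $ 2 *\<^sub>R dderiv (axis 2 1) F y) y"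
    by (rule dderiv_cong_open[OF assms(1,3)]) (rule dderiv_coords[OF smooth_on_differentiable[OF assms(2,1)]])
  also have "\<dots> = c $ 1 *\<^sub>R dderiv x (dderiv (axis 1 1) F) y + c $ 2 *\<^sub>R dderiv x (dderiv (axis 2 1) F) y"
    by (rule dderiv_eq)
      (intro has_derivative_add has_derivative_scaleR_right smooth_on_has_derivative[OF _ assms(1,3)] smooth_on_dderiv assms(2))
  finally show ?thesis .
qed

text \<open>Isotropy and superconformality concern all charts, while the computations are made in
  isothermal ones. The locale models an orientation preserving transition \<open>t\<close> between
  two charts of one immersed surface.\<close>

locale reparametrization =
  fixes W S :: "(real^2) set" and u :: "real^2 \<Rightarrow> 'a::euclidean_space" and t :: "real^2 \<Rightarrow> real^2"
    and u' :: "real^2 \<Rightarrow> 'a"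
  assumes open_W: "open W" and smooth_u: "smooth_on W u"
    and inj_u: "\<And>y. y \<in> W \<Longrightarrow> inj (frechet_derivative u (at y))"
    and open_S: "open S" and smooth_t: "smooth_on S t" and t_mem: "\<And>z. z \<in> S \<Longrightarrow> t z \<in> W"
    and jac_pos: "\<And>z. z \<in> S \<Longrightarrow> jac2 t z > 0"
    and u': "\<And>z. z \<in> S \<Longrightarrow> u' z = u (t z)"
begin

lemma diff_t: "z \<in> S \<Longrightarrow> t differentiable (at z)"
  by (rule smooth_on_differentiable[OF smooth_t open_S])

lemma smooth_u': "smooth_on S u'"
proof -
  have "smooth_on S (\<lambda>z. u (t z))"
    using t_mem by (intro smooth_on_compose[OF open_S open_W _ smooth_t smooth_u]) auto
  then show ?thesis using smooth_on_cong[OF open_S u'] by simp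
qed

lemma dt_surj: "z \<in> S \<Longrightarrow> \<exists>w. dderiv w t z = v"
  using dderiv_cramer2[OF diff_t, of z v] jac_pos[of z] by auto

lemma dt_inj: "z \<in> S \<Longrightarrow> dderiv v t z = dderiv w t z \<longleftrightarrow> v = w"
  using cramer2_dderiv[OF diff_t, of z] jac_pos[of z] by (metis less_irrefl)

lemma dderiv_comp:
  assumes "z \<in> S" "smooth_on W F"
  shows "dderiv v (\<lambda>y. F (t y)) z = dderiv (dderiv v t z) F (t z)"
  by (rule dderiv_compose[OF diff_t smooth_on_differentiable[OF assms(2) open_W t_mem]]) (rule assms(1))+

lemma dderiv_u': "z \<in> S \<Longrightarrow> dderiv v u' z = dderiv (dderiv v t z) u (t z)"
  using dderiv_cong_open[of S z u' "\<lambda>y. u (t y)" v, OF open_S _ u'] dderiv_comp[OF _ smooth_u] by simp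

text \<open>Both the base point and the direction move. Expanding the direction in coordinates
  separates the two contributions; in the second summand the direction is frozen at
  \<open>a z\<close>.\<close>

lemma has_derivative_field:
  fixes F :: "real^2 \<Rightarrow> 'b::real_normed_vector"
  assumes z: "z \<in> S" and F: "smooth_on W F" and a: "a differentiable (at z)"
  shows "((\<lambda>y. dderiv (a y) F (t y)) has_derivative (\<lambda>v. dderiv (dderiv v a z) F (t z)
       + dderiv (dderiv v t z) (dderiv (a z) F) (t z))) (at z)"
proof -
  let ?F1 = "dderiv (axis 1 1) F" and ?F2 = "dderiv (axis 2 1) F"
  have sF: "smooth_on W ?F1" "smooth_on W ?F2" by (intro smooth_on_dderiv F)+
  have dF: "((\<lambda>y. G (t y)) has_derivative (\<lambda>v. dderiv (dderiv v t z) G (t z))) (at z)"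
    if "smooth_on W G" for G :: "real^2 \<Rightarrow> 'b"
    using diff_chain_at[OF has_derivative_dderiv[OF diff_t[OF z]] smooth_on_has_derivative[OF that open_W t_mem[OF z]]]
    by (simp add: o_def)
  have da: "((\<lambda>y. a y $ i) has_derivative (\<lambda>v. dderiv v a z $ i)) (at z)" for i
    by (rule bounded_linear.has_derivative[OF bounded_linear_vec_nth has_derivative_dderiv[OF a]])
  have "((\<lambda>y. a y $ 1 *\<^sub>R ?F1 (t y) + a y $ 2 *\<^sub>R ?F2 (t y)) has_derivative
     (\<lambda>v. (a z $ 1 *\<^sub>R dderiv (dderiv v t z) ?F1 (t z) + dderiv v a z $ 1 *\<^sub>R ?F1 (t z)) +
          (a z $ 2 *\<^sub>R dderiv (dderiv v t z) ?F2 (t z) + dderiv v a z $ 2 *\<^sub>R ?F2 (t z)))) (at z)"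
    by (intro has_derivative_add has_derivative_scaleR da dF sF)
  moreover have "(a z $ 1 *\<^sub>R dderiv (dderiv v t z) ?F1 (t z) + dderiv v a z $ 1 *\<^sub>R ?F1 (t z)) +
          (a z $ 2 *\<^sub>R dderiv (dderiv v t z) ?F2 (t z) + dderiv v a z $ 2 *\<^sub>R ?F2 (t z))
      = dderiv (dderiv v a z) F (t z) + dderiv (dderiv v t z) (dderiv (a z) F) (t z)" for v
    unfolding dderiv_dderiv_coords[OF open_W F t_mem[OF z], of _ "a z"]
      dderiv_coords[OF smooth_on_differentiable[OF F open_W t_mem[OF z]], of "dderiv v a z"]
    by simp
  ultimately have "((\<lambda>y. a y $ 1 *\<^sub>R ?F1 (t y) + a y $ 2 *\<^sub>R ?F2 (t y)) has_derivative
     (\<lambda>v. dderiv (dderiv v a z) F (t z) + dderiv (dderiv v t z) (dderiv (a z) F) (t z))) (at z)"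
    by simp
  moreover have "a y $ 1 *\<^sub>R ?F1 (t y) + a y $ 2 *\<^sub>R ?F2 (t y) = dderiv (a y) F (t y)" if "y \<in> S" for y
    using dderiv_coords[OF smooth_on_differentiable[OF F open_W t_mem[OF that]], of "a y"] by simp
  ultimately show ?thesis
    by (rule has_derivative_transform_within_open[OF _ open_S z])
qed

lemma dderiv2_u':
  assumes z: "z \<in> S"
  shows "dderiv v (dderiv w u') z = dderiv (dderiv v (dderiv w t) z) u (t z)
     + dderiv (dderiv v t z) (dderiv (dderiv w t z) u) (t z)"
proof -
  have "dderiv v (dderiv w u') z = dderiv v (\<lambda>y. dderiv (dderiv w t y) u (t y)) z"
    by (rule dderiv_cong_open[OF open_S z]) (rule dderiv_u')
  also have "\<dots> = dderiv (dderiv v (dderiv w t) z) u (t z)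
     + dderiv (dderiv v t z) (dderiv (dderiv w t z) u) (t z)"
    by (rule dderiv_eq[OF has_derivative_field[OF z smooth_u
          smooth_on_differentiable[OF smooth_on_dderiv[OF smooth_t] open_S z]]])
  finally show ?thesis .
qed

lemma osculating_1: "dderiv v u y \<in> span (osculating u y)"
  by (rule span_base) (auto simp: osculating_def tangent_space_alt)

lemma osculating_2: "dderiv v (dderiv w u) y \<in> span (osculating u y)"
  by (rule span_base) (auto simp: osculating_def)

text \<open>All terms containing second or third derivatives of the transition involve at most
  second derivatives of \<open>u\<close>. This is the tensor property of the third fundamental
  form.\<close>

lemma dderiv3_u':
  assumes z: "z \<in> S"
  shows "dderiv x (dderiv y (dderiv w u')) z -
     dderiv (dderiv x t z) (dderiv (dderiv y t z) (dderiv (dderiv w t z) u)) (t z) \<in> span (osculating u (t z))"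
proof -
  let ?u1 = "dderiv (axis 1 1) u" and ?u2 = "dderiv (axis 2 1) u"
  define X where "X = dderiv x t z"
  define p where "p = dderiv y (dderiv w t)"
  define Y where "Y = dderiv y t"
  define Z where "Z = dderiv w t"
  have su: "smooth_on W ?u1" "smooth_on W ?u2" by (intro smooth_on_dderiv smooth_u)+
  have st: "smooth_on S p" "smooth_on S Y" "smooth_on S Z"
    unfolding p_def Y_def Z_def by (intro smooth_on_dderiv smooth_t)+
  note dst = st[THEN smooth_on_differentiable, OF open_S z]
  have eq: "dderiv y (dderiv w u') r = dderiv (p r) u (t r) + (Z r $ 1 *\<^sub>R dderiv (Y r) ?u1 (t r) + Z r $ 2 *\<^sub>R dderiv (Y r) ?u2 (t r))"
    if "r \<in> S" for r
    unfolding dderiv2_u'[OF that] dderiv_dderiv_coords[OF open_W smooth_u t_mem[OF that], of _ "dderiv w t r"]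
    by (simp add: p_def Y_def Z_def)
  have dZ: "((\<lambda>r. Z r $ i) has_derivative (\<lambda>v. dderiv v Z z $ i)) (at z)" for i
    by (rule bounded_linear.has_derivative[OF bounded_linear_vec_nth has_derivative_dderiv[OF dst(3)]])
  have "((\<lambda>r. dderiv (p r) u (t r) + (Z r $ 1 *\<^sub>R dderiv (Y r) ?u1 (t r) + Z r $ 2 *\<^sub>R dderiv (Y r) ?u2 (t r)))
    has_derivative (\<lambda>x. (dderiv (dderiv x p z) u (t z) + dderiv (dderiv x t z) (dderiv (p z) u) (t z)) +
      ((Z z $ 1 *\<^sub>R (dderiv (dderiv x Y z) ?u1 (t z) + dderiv (dderiv x t z) (dderiv (Y z) ?u1) (t z))
          + dderiv x Z z $ 1 *\<^sub>R dderiv (Y z) ?u1 (t z)) +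
       (Z z $ 2 *\<^sub>R (dderiv (dderiv x Y z) ?u2 (t z) + dderiv (dderiv x t z) (dderiv (Y z) ?u2) (t z))
          + dderiv x Z z $ 2 *\<^sub>R dderiv (Y z) ?u2 (t z))))) (at z)"
    by (intro has_derivative_add has_derivative_scaleR has_derivative_field dZ dst z su smooth_u)
  from dderiv_eq[OF this, of x] dderiv_cong_open[of S z _ _ x, OF open_S z eq]
  have d: "dderiv x (dderiv y (dderiv w u')) z =
      (dderiv (dderiv x p z) u (t z) + dderiv X (dderiv (p z) u) (t z)) +
      ((Z z $ 1 *\<^sub>R (dderiv (dderiv x Y z) ?u1 (t z) + dderiv X (dderiv (Y z) ?u1) (t z))
          + dderiv x Z z $ 1 *\<^sub>R dderiv (Y z) ?u1 (t z)) +
       (Z z $ 2 *\<^sub>R (dderiv (dderiv x Y z) ?u2 (t z) + dderiv X (dderiv (Y z) ?u2) (t z))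
          + dderiv x Z z $ 2 *\<^sub>R dderiv (Y z) ?u2 (t z)))"
    by (simp add: X_def)
  have "dderiv X (dderiv (Y z) (dderiv (Z z) u)) (t z)
     = dderiv X (\<lambda>r. Z z $ 1 *\<^sub>R dderiv (Y z) ?u1 r + Z z $ 2 *\<^sub>R dderiv (Y z) ?u2 r) (t z)"
    by (rule dderiv_cong_open[OF open_W t_mem[OF z]]) (rule dderiv_dderiv_coords[OF open_W smooth_u])
  also have "\<dots> = Z z $ 1 *\<^sub>R dderiv X (dderiv (Y z) ?u1) (t z) + Z z $ 2 *\<^sub>R dderiv X (dderiv (Y z) ?u2) (t z)"
    by (rule dderiv_eq) (intro has_derivative_add has_derivative_scaleR_right
        smooth_on_has_derivative[OF _ open_W t_mem[OF z]] smooth_on_dderiv smooth_u)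
  finally have "dderiv x (dderiv y (dderiv w u')) z - dderiv X (dderiv (Y z) (dderiv (Z z) u)) (t z) =
      (dderiv (dderiv x p z) u (t z) + dderiv X (dderiv (p z) u) (t z)) +
      ((Z z $ 1 *\<^sub>R dderiv (dderiv x Y z) ?u1 (t z) + dderiv x Z z $ 1 *\<^sub>R dderiv (Y z) ?u1 (t z)) +
       (Z z $ 2 *\<^sub>R dderiv (dderiv x Y z) ?u2 (t z) + dderiv x Z z $ 2 *\<^sub>R dderiv (Y z) ?u2 (t z)))"
    unfolding d by (simp add: scaleR_add_right)
  also have "\<dots> \<in> span (osculating u (t z))"
    by (intro span_add span_scale osculating_1 osculating_2)
  finally show ?thesis by (simp add: X_def Y_def Z_def)
qed

lemma tangent_space_u': "z \<in> S \<Longrightarrow> tangent_space u' z = tangent_space u (t z)"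
  unfolding tangent_space_alt using dderiv_u' dt_surj[of z] by (auto simp: image_iff) metis

lemma inj_u': "z \<in> S \<Longrightarrow> inj (frechet_derivative u' (at z))"
  using inj_u[OF t_mem] dderiv_u' dt_inj unfolding inj_def dderiv_def by metis

text \<open>Second derivatives in the new chart acquire first order terms, so the agreement is
  stated for the spans.\<close>

lemma span_osculating_u':
  assumes z: "z \<in> S"
  shows "span (osculating u' z) = span (osculating u (t z))"
proof (rule antisym; rule span_minimal; (intro subspace_span subsetI)?)
  have o1: "dderiv v u' z \<in> span (osculating u' z)" "dderiv v (dderiv w u') z \<in> span (osculating u' z)" for v w
    by (rule span_base; auto simp: osculating_def tangent_space_alt)+
  { fix v assume "v \<in> osculating u' z"
    then consider w where "v = dderiv w u' z" | x y where "v = dderiv x (dderiv y u') z"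
      by (auto simp: osculating_def tangent_space_alt)
    then show "v \<in> span (osculating u (t z))"
    proof cases
      case 1
      then show ?thesis using dderiv_u'[OF z] osculating_1 by simp
    next
      case 2
      then show ?thesis unfolding 2 dderiv2_u'[OF z] by (intro span_add osculating_1 osculating_2)
    qed }
  have o1': "dderiv v u (t z) \<in> span (osculating u' z)" for v
    using dt_surj[OF z, of v] dderiv_u'[OF z] o1(1) by metis
  { fix v assume "v \<in> osculating u (t z)"
    then consider w where "v = dderiv w u (t z)" | x y where "v = dderiv x (dderiv y u) (t z)"
      by (auto simp: osculating_def tangent_space_alt)
    then show "v \<in> span (osculating u' z)"
    proof cases
      case 1
      then show ?thesis using o1' by simp
    next
      case 2
      obtain a b where ab: "dderiv a t z = x" "dderiv b t z = y" using dt_surj[OF z] by metis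
      have "dderiv x (dderiv y u) (t z) = dderiv a (dderiv b u') z - dderiv (dderiv a (dderiv b t) z) u (t z)"
        unfolding dderiv2_u'[OF z] ab by simp
      then show ?thesis unfolding 2 using span_diff[OF o1(2) o1'] by simp
    qed }
qed

lemma induced_metric_u': "z \<in> S \<Longrightarrow> induced_metric u' z v w = induced_metric u (t z) (dderiv v t z) (dderiv w t z)"
  by (simp add: induced_metric_def dderiv_u')

lemma sff_u': "z \<in> S \<Longrightarrow> sff u' v w z = sff u (dderiv v t z) (dderiv w t z) (t z)"
  unfolding sff_def normal_fibre_def tangent_space_u' dderiv2_u'
  by (rule orth_proj_comp_cong) (auto simp: tangent_space_alt intro: span_base)

lemma higher_sff_u':
  assumes z: "z \<in> S"
  shows "higher_sff u' [x, y, w] z = higher_sff u [dderiv x t z, dderiv y t z, dderiv w t z] (t z)"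
proof -
  have "orthogonal_comp (osculating u' z) = orthogonal_comp (osculating u (t z))"
    using span_osculating_u'[OF z] orthogonal_comp_span by metis
  moreover have "higher_sff u' [x, y, w] z = orth_proj (orthogonal_comp (osculating u' z)) (dderiv x (dderiv y (dderiv w u')) z)"
    by (rule higher_sff_3[OF open_S z smooth_u' inj_u'])
  moreover have "higher_sff u [x, y, w] (t z) = orth_proj (orthogonal_comp (osculating u (t z))) (dderiv x (dderiv y (dderiv w u)) (t z))" for x y w
    by (rule higher_sff_3[OF open_W t_mem[OF z] smooth_u inj_u])
  ultimately show ?thesis
    using orth_proj_comp_cong[OF dderiv3_u'[OF z]] by simp
qed

lemma kth_normal_space_2_u': "z \<in> S \<Longrightarrow> kth_normal_space u' 2 z = kth_normal_space u 2 (t z)"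
  unfolding kth_normal_space_2
  by (rule arg_cong[of _ _ span]) (auto simp: higher_sff_u', metis dt_surj)

lemma unit_sff_u':
  assumes z: "z \<in> S"
  shows "{sff u' X X z |X. induced_metric u' z X X = 1} = {sff u X X (t z) |X. induced_metric u (t z) X X = 1}"
proof -
  have "\<exists>Y. sff u X X (t z) = sff u (dderiv Y t z) (dderiv Y t z) (t z) \<and>
      induced_metric u (t z) (dderiv Y t z) (dderiv Y t z) = 1" if "induced_metric u (t z) X X = 1" for X
    using dt_surj[OF z, of X] that by metis
  then show ?thesis by (auto simp: sff_u'[OF z] induced_metric_u'[OF z])
qed

end

text \<open>The conditions give \<open>w\<close> the length of \<open>v\<close> and a determinant
  with \<open>v\<close> equal to the squared length of \<open>v\<close>, which is the equality case
  of Cauchy-Schwarz for \<open>w\<close> and the rotated \<open>v\<close>.\<close>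

lemma cpx_structure_unique:
  assumes "E > 0" "\<And>v w. induced_metric u z v w = E * (v $ 1 * w $ 1 + v $ 2 * w $ 2)"
  shows "(induced_metric u z v w = 0 \<and> induced_metric u z w w = induced_metric u z v v \<and>
     (v \<noteq> 0 \<longrightarrow> v $ 1 * w $ 2 - v $ 2 * w $ 1 > 0)) \<longleftrightarrow> w = vector [- v $ 2, v $ 1]"
proof
  assume *: "induced_metric u z v w = 0 \<and> induced_metric u z w w = induced_metric u z v v \<and>
     (v \<noteq> 0 \<longrightarrow> v $ 1 * w $ 2 - v $ 2 * w $ 1 > 0)"
  have a: "v $ 1 * w $ 1 + v $ 2 * w $ 2 = 0" using * assms by simp
  have b: "w $ 1 * w $ 1 + w $ 2 * w $ 2 = v $ 1 * v $ 1 + v $ 2 * v $ 2" using * assms by simp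
  let ?d = "v $ 1 * w $ 2 - v $ 2 * w $ 1" and ?n = "v $ 1 * v $ 1 + v $ 2 * v $ 2"
  \<comment> \<open>Lagrange's identity; it fixes the determinant up to sign, and the orientation
    condition selects the sign.\<close>
  have "?d * ?d + (v $ 1 * w $ 1 + v $ 2 * w $ 2)^2 = ?n * (w $ 1 * w $ 1 + w $ 2 * w $ 2)"
    by (simp add: power2_eq_square algebra_simps)
  then have "?d\<^sup>2 = ?n\<^sup>2" by (simp add: a b power2_eq_square)
  moreover have "?d \<ge> 0"
  proof (cases "v = 0")
    case False
    then show ?thesis using * by simp
  qed simp
  moreover have "?n \<ge> 0" by simp
  ultimately have d: "?d = ?n" using power2_eq_imp_eq by blast
  have "(w $ 1 + v $ 2)^2 + (w $ 2 - v $ 1)^2 = (w $ 1 * w $ 1 + w $ 2 * w $ 2) + ?n - 2 * ?d"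
    by (simp add: power2_eq_square algebra_simps)
  then have "(w $ 1 + v $ 2)^2 + (w $ 2 - v $ 1)^2 = 0" using b d by simp
  then show "w = vector [- v $ 2, v $ 1]"
    by (simp add: sum_power2_eq_zero_iff vec_eq_iff forall_2 eq_neg_iff_add_eq_0)
next
  assume w: "w = vector [- v $ 2, v $ 1]"
  have "v \<noteq> 0 \<Longrightarrow> 0 < v $ 1 * v $ 1 + v $ 2 * v $ 2"
    using sum_power2_gt_zero_iff[of "v $ 1" "v $ 2"] by (auto simp: vec_eq_iff forall_2 power2_eq_square)
  then show "induced_metric u z v w = 0 \<and> induced_metric u z w w = induced_metric u z v v \<and>
     (v \<noteq> 0 \<longrightarrow> v $ 1 * w $ 2 - v $ 2 * w $ 1 > 0)"
    by (simp add: assms w)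
qed

context reparametrization
begin

text \<open>The sign of the Jacobian is essential here: the determinant in the orientation condition
  gets multiplied by \<open>jac2 t z\<close>.\<close>

lemma cpx_structure_u':
  assumes z: "z \<in> S" and E: "E > 0"
    and iso: "\<And>v w. induced_metric u (t z) v w = E * (v $ 1 * w $ 1 + v $ 2 * w $ 2)"
  shows "dderiv (cpx_structure u' z v) t z = cpx_structure u (t z) (dderiv v t z)"
proof -
  let ?J = "\<lambda>v::real^2. vector [- v $ 2, v $ 1] :: real^2"
  have 1: "cpx_structure u (t z) w = ?J w" for w
    unfolding cpx_structure_def cpx_structure_unique[OF E iso] by simp
  have dz: "dderiv v t z \<noteq> 0 \<longleftrightarrow> v \<noteq> 0" for v
    using dt_inj[OF z, of v 0] linear_0[OF linear_dderiv[OF diff_t[OF z]]] by simp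
  have det: "dderiv v t z $ 1 * dderiv w t z $ 2 - dderiv v t z $ 2 * dderiv w t z $ 1
      = jac2 t z * (v $ 1 * w $ 2 - v $ 2 * w $ 1)" for v w
    unfolding dderiv_coords[OF diff_t[OF z], of v] dderiv_coords[OF diff_t[OF z], of w]
    by (simp add: jac2_def algebra_simps)
  have iff: "(induced_metric u' z v w = 0 \<and> induced_metric u' z w w = induced_metric u' z v v \<and>
     (v \<noteq> 0 \<longrightarrow> v $ 1 * w $ 2 - v $ 2 * w $ 1 > 0)) \<longleftrightarrow> dderiv w t z = ?J (dderiv v t z)" for w
    unfolding cpx_structure_unique[OF E iso, symmetric] induced_metric_u'[OF z] dz det
    using jac_pos[OF z] by (simp add: zero_less_mult_iff)
  obtain w where w: "dderiv w t z = ?J (dderiv v t z)" using dt_surj[OF z] by blast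
  have "cpx_structure u' z v = w"
    unfolding cpx_structure_def iff
    by (rule the_equality, rule w, rule dt_inj[OF z, THEN iffD1], simp only: w)
  then show ?thesis using w 1 by simp
qed

lemma curvature_ellipse_u':
  assumes z: "z \<in> S" and E: "E > 0"
    and iso: "\<And>v w. induced_metric u (t z) v w = E * (v $ 1 * w $ 1 + v $ 2 * w $ 2)"
    and r: "r \<in> {1, 2}"
  shows "curvature_ellipse u' r z X = curvature_ellipse u r (t z) (dderiv X t z)"
proof -
  have lin: "dderiv (cos \<psi> *\<^sub>R X + sin \<psi> *\<^sub>R cpx_structure u' z X) t z =
      cos \<psi> *\<^sub>R dderiv X t z + sin \<psi> *\<^sub>R cpx_structure u (t z) (dderiv X t z)" for \<psi>
    by (simp add: linear_add[OF linear_dderiv[OF diff_t[OF z]]] linear_scale[OF linear_dderiv[OF diff_t[OF z]]]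
        cpx_structure_u'[OF z E iso])
  have "higher_sff u' (replicate (r + 1) Y) z = higher_sff u (replicate (r + 1) (dderiv Y t z)) (t z)" for Y
    using r higher_sff_u'[OF z] sff_u'[OF z] by (auto simp: higher_sff_2 numeral_2_eq_2)
  then show ?thesis unfolding curvature_ellipse_def lin[symmetric] by simp
qed

end

section \<open>Isothermal coordinates on minimal surfaces\<close>

lemma dderiv_inner:
  fixes a b :: "'b::real_normed_vector \<Rightarrow> 'a::euclidean_space"
  assumes "a differentiable (at z)" "b differentiable (at z)"
  shows "dderiv v (\<lambda>z. inner (a z) (b z)) z = inner (a z) (dderiv v b z) + inner (dderiv v a z) (b z)"
  by (rule dderiv_eq) (intro has_derivative_inner has_derivative_dderiv assms)

lemma dderiv_scaleR:
  assumes "a differentiable (at z)" "b differentiable (at z)"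
  shows "dderiv v (\<lambda>z. a z *\<^sub>R b z) z = a z *\<^sub>R dderiv v b z + dderiv v a z *\<^sub>R b z"
  by (rule dderiv_eq) (intro has_derivative_scaleR has_derivative_dderiv assms)

lemma dderiv_diff:
  assumes "a differentiable (at z)" "b differentiable (at z)"
  shows "dderiv v (\<lambda>z. a z - b z) z = dderiv v a z - dderiv v b z"
  by (rule dderiv_eq) (intro has_derivative_diff has_derivative_dderiv assms)

lemma dderiv_mult:
  fixes a b :: "'b::real_normed_vector \<Rightarrow> real"
  assumes "a differentiable (at z)" "b differentiable (at z)"
  shows "dderiv v (\<lambda>z. a z * b z) z = a z * dderiv v b z + dderiv v a z * b z"
  by (rule dderiv_eq) (intro has_derivative_mult has_derivative_dderiv assms)

locale minimal_patch =
  fixes W :: "(real^2) set" and u :: "real^2 \<Rightarrow> 'a::euclidean_space"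
  assumes open_W: "open W" and smooth_u: "smooth_on W u"
    and inj_u: "\<And>z. z \<in> W \<Longrightarrow> inj (frechet_derivative u (at z))"
    and mean_0: "\<And>z. z \<in> W \<Longrightarrow> mean_curvature u z = 0"
begin

abbreviation "e1 \<equiv> axis 1 1 :: real^2"
abbreviation "e2 \<equiv> axis 2 1 :: real^2"

definition "u1 = dderiv e1 u"
definition "u2 = dderiv e2 u"
definition "fE z = inner (u1 z) (u1 z)"
definition "fF z = inner (u1 z) (u2 z)"
definition "fG z = inner (u2 z) (u2 z)"
definition "fD z = fE z * fG z - fF z * fF z"
definition "fw z = sqrt (fD z)"

text \<open>The rotated differential: \<open>- Q dx + P dy\<close> is the image of \<open>du\<close> under the Hodge star.\<close>

definition "P z = (fG z / fw z) *\<^sub>R u1 z - (fF z / fw z) *\<^sub>R u2 z"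
definition "Q z = (fE z / fw z) *\<^sub>R u2 z - (fF z / fw z) *\<^sub>R u1 z"

lemma diff_u: "z \<in> W \<Longrightarrow> u differentiable (at z)"
  by (rule smooth_on_differentiable[OF smooth_u open_W])

lemma gram: "z \<in> W \<Longrightarrow> fE z > 0" "z \<in> W \<Longrightarrow> fD z > 0"
  using gram_det_pos[OF diff_u inj_u, of z] by (simp_all add: fE_def fD_def fF_def fG_def u1_def u2_def power2_eq_square)

lemma fw: "z \<in> W \<Longrightarrow> fw z > 0" "z \<in> W \<Longrightarrow> fw z * fw z = fD z"
  using gram(2)[of z] by (simp_all add: fw_def)

lemma smooth:
  "smooth_on W u1" "smooth_on W u2" "smooth_on W fE" "smooth_on W fF" "smooth_on W fG" "smooth_on W fD" "smooth_on W fw"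
proof -
  show s: "smooth_on W u1" "smooth_on W u2" unfolding u1_def u2_def by (intro smooth_on_dderiv smooth_u)+
  show e: "smooth_on W fE" "smooth_on W fF" "smooth_on W fG"
    unfolding fE_def [abs_def] fF_def [abs_def] fG_def [abs_def] by (intro smooth_on_inner s open_W)+
  show d: "smooth_on W fD" unfolding fD_def [abs_def] by (intro smooth_on_diff smooth_on_mult e open_W)
  show "smooth_on W fw" unfolding fw_def [abs_def] by (intro smooth_on_sqrt d open_W gram)
qed

lemma smooth_PQ: "smooth_on W P" "smooth_on W Q"
  unfolding P_def [abs_def] Q_def [abs_def]
  by (intro smooth_on_diff smooth_on_scaleR smooth_on_divide smooth open_W less_imp_neq[THEN not_sym] fw(1); assumption)+

lemma PQ_inner:
  assumes "z \<in> W"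
  shows "inner (P z) (u1 z) = fw z" "inner (P z) (u2 z) = 0" "inner (Q z) (u1 z) = 0" "inner (Q z) (u2 z) = fw z"
proof -
  note w = fw[OF assms]
  have "fw z * inner (P z) (u1 z) = fG z * fE z - fF z * fF z"
    using w(1) by (simp add: P_def inner_diff_left fE_def fF_def inner_commute[of "u2 z" "u1 z"] algebra_simps)
  then have "fw z * inner (P z) (u1 z) = fw z * fw z" using w by (simp add: fD_def mult.commute)
  then show "inner (P z) (u1 z) = fw z" using w(1) by simp
  have "fw z * inner (Q z) (u2 z) = fG z * fE z - fF z * fF z"
    using w(1) by (simp add: Q_def inner_diff_left fG_def fF_def inner_commute[of "u2 z" "u1 z"] algebra_simps)
  then have "fw z * inner (Q z) (u2 z) = fw z * fw z" using w by (simp add: fD_def mult.commute)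
  then show "inner (Q z) (u2 z) = fw z" using w(1) by simp
qed (simp_all add: P_def Q_def inner_diff_left fE_def fF_def fG_def inner_commute[of "u2 z" "u1 z"])

text \<open>The left side is the area density times the Laplacian of \<open>u\<close>. Its normal
  part vanishes by minimality; its tangential part vanishes for metric reasons, as seen by testing
  against \<open>u1\<close> and \<open>u2\<close>.\<close>

lemma rotated_closed:
  assumes z: "z \<in> W"
  shows "dderiv e1 P z + dderiv e2 Q z = 0"
proof -
  note df = smooth[THEN smooth_on_differentiable, OF open_W z] smooth_PQ[THEN smooth_on_differentiable, OF open_W z]
  note w = fw[OF z]
  define R where "R = dderiv e1 P z + dderiv e2 Q z"
  let ?al = "\<lambda>z. fG z / fw z" and ?be = "\<lambda>z. fF z / fw z" and ?ga = "\<lambda>z. fE z / fw z"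
  have dq: "?al differentiable (at z)" "?be differentiable (at z)" "?ga differentiable (at z)"
    using w(1) by (auto intro!: differentiable_divide df)
  have comm: "dderiv e2 u1 z = dderiv e1 u2 z"
    unfolding u1_def u2_def by (rule dderiv_commute[OF open_W smooth_u z])
  let ?T = "{u1 z, u2 z}"
  let ?H = "fG z *\<^sub>R dderiv e1 u1 z - (2 * fF z) *\<^sub>R dderiv e1 u2 z + fE z *\<^sub>R dderiv e2 u2 z"
  have H: "?H \<in> span ?T"
  proof -
    let ?p = "orth_proj (orthogonal_comp ?T)"
    have lin: "linear ?p" by (rule linear_orth_proj[OF subspace_orthogonal_comp])
    have nf: "normal_fibre u z = orthogonal_comp ?T"
      using normal_fibre_span[OF diff_u[OF z]] by (simp add: u1_def u2_def)
    have "fG z *\<^sub>R ?p (dderiv e1 u1 z) - (2 * fF z) *\<^sub>R ?p (dderiv e1 u2 z) + fE z *\<^sub>R ?p (dderiv e2 u2 z) = 0"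
      using mean_0[OF z] gram[OF z]
      unfolding mean_curvature_def Let_def induced_metric_def sff_def nf u1_def[symmetric] u2_def[symmetric]
        fE_def[symmetric] fF_def[symmetric] fG_def[symmetric]
      by (auto simp: fD_def power2_eq_square)
    then have "?p ?H = 0" by (simp add: linear_add[OF lin] linear_diff[OF lin] linear_scale[OF lin])
    then show ?thesis by (simp add: orth_proj_comp_eq_0)
  qed
  have "R = (1 / fw z) *\<^sub>R ?H +
      ((dderiv e1 ?al z *\<^sub>R u1 z - dderiv e1 ?be z *\<^sub>R u2 z) + (dderiv e2 ?ga z *\<^sub>R u2 z - dderiv e2 ?be z *\<^sub>R u1 z))"
    unfolding R_def P_def [abs_def] Q_def [abs_def]
    by (simp add: dderiv_diff dderiv_scaleR differentiable_scaleR df dq comm)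
      (simp add: algebra_simps divide_inverse scaleR_2[symmetric] mult.commute)
  also have "\<dots> \<in> span ?T"
    by (intro span_add span_diff span_scale H span_base; simp)
  finally have RT: "R \<in> span ?T" .
  \<comment> \<open>Derivative of the area density, obtained from fw^2 = EG - F^2 and
    halved.\<close>
  have dw: "fw z * dderiv v fw z = (fE z * inner (u2 z) (dderiv v u2 z) + fG z * inner (u1 z) (dderiv v u1 z)
      - fF z * (inner (u1 z) (dderiv v u2 z) + inner (dderiv v u1 z) (u2 z)))" for v
  proof -
    have "dderiv v (\<lambda>z. fw z * fw z) z = dderiv v fD z"
      by (rule dderiv_cong_open[OF open_W z]) (rule fw)
    then have "2 * (fw z * dderiv v fw z) = dderiv v fD z" by (simp add: dderiv_mult df)
    also have "\<dots> = fE z * dderiv v fG z + dderiv v fE z * fG z - 2 * fF z * dderiv v fF z"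
      unfolding fD_def [abs_def] by (simp add: dderiv_diff dderiv_mult df)
    also have "\<dots> = 2 * (fE z * inner (u2 z) (dderiv v u2 z) + fG z * inner (u1 z) (dderiv v u1 z)
      - fF z * (inner (u1 z) (dderiv v u2 z) + inner (dderiv v u1 z) (u2 z)))"
      unfolding fE_def [abs_def] fF_def [abs_def] fG_def [abs_def]
      by (simp add: dderiv_inner df inner_commute algebra_simps)
    finally show ?thesis by simp
  qed
  \<comment> \<open>Differentiated duality relations of \<open>PQ_inner\<close>; they replace
    derivatives of \<open>P\<close> and \<open>Q\<close> by derivatives of \<open>u1\<close>,
    \<open>u2\<close> and \<open>fw\<close>.\<close>
  have dPQ: "inner (P z) (dderiv v u1 z) + inner (dderiv v P z) (u1 z) = dderiv v fw z"
    "inner (P z) (dderiv v u2 z) + inner (dderiv v P z) (u2 z) = 0"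
    "inner (Q z) (dderiv v u1 z) + inner (dderiv v Q z) (u1 z) = 0"
    "inner (Q z) (dderiv v u2 z) + inner (dderiv v Q z) (u2 z) = dderiv v fw z" for v
  proof -
    have "dderiv v (\<lambda>z. inner (P z) (u1 z)) z = dderiv v fw z" "dderiv v (\<lambda>z. inner (P z) (u2 z)) z = dderiv v (\<lambda>z. 0) z"
      "dderiv v (\<lambda>z. inner (Q z) (u1 z)) z = dderiv v (\<lambda>z. 0) z" "dderiv v (\<lambda>z. inner (Q z) (u2 z)) z = dderiv v fw z"
      by (rule dderiv_cong_open[OF open_W z], simp add: PQ_inner)+
    moreover have "dderiv v (\<lambda>z. 0::real) z = 0" by (rule dderiv_eq) simp
    ultimately show "inner (P z) (dderiv v u1 z) + inner (dderiv v P z) (u1 z) = dderiv v fw z"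
    "inner (P z) (dderiv v u2 z) + inner (dderiv v P z) (u2 z) = 0"
    "inner (Q z) (dderiv v u1 z) + inner (dderiv v Q z) (u1 z) = 0"
    "inner (Q z) (dderiv v u2 z) + inner (dderiv v Q z) (u2 z) = dderiv v fw z"
      by (simp_all add: dderiv_inner df)
  qed
  have wP: "fw z * inner (P z) x = fG z * inner (u1 z) x - fF z * inner (u2 z) x" for x
    using w(1) by (simp add: P_def inner_diff_left algebra_simps)
  have wQ: "fw z * inner (Q z) x = fE z * inner (u2 z) x - fF z * inner (u1 z) x" for x
    using w(1) by (simp add: Q_def inner_diff_left algebra_simps)
  have "fw z * inner R (u1 z) = fw z * dderiv e1 fw z - fw z * inner (P z) (dderiv e1 u1 z) - fw z * inner (Q z) (dderiv e2 u1 z)"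
  proof -
    have "inner R (u1 z) = dderiv e1 fw z - inner (P z) (dderiv e1 u1 z) - inner (Q z) (dderiv e2 u1 z)"
      using dPQ(1)[of e1] dPQ(3)[of e2] by (simp add: R_def inner_add_left)
    then show ?thesis by (simp only: right_diff_distrib)
  qed
  also have "\<dots> = 0" unfolding dw wP wQ comm by (simp add: inner_commute algebra_simps)
  finally have R1: "inner R (u1 z) = 0" using w(1) by simp
  have "fw z * inner R (u2 z) = fw z * dderiv e2 fw z - fw z * inner (P z) (dderiv e1 u2 z) - fw z * inner (Q z) (dderiv e2 u2 z)"
  proof -
    have "inner R (u2 z) = dderiv e2 fw z - inner (P z) (dderiv e1 u2 z) - inner (Q z) (dderiv e2 u2 z)"
      using dPQ(2)[of e1] dPQ(4)[of e2] by (simp add: R_def inner_add_left)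
    then show ?thesis by (simp only: right_diff_distrib)
  qed
  also have "\<dots> = 0" unfolding dw wP wQ comm[symmetric] by (simp add: inner_commute algebra_simps)
  finally have R2: "inner R (u2 z) = 0" using w(1) by simp
  have "R \<in> orthogonal_comp (span ?T)"
    using R1 R2 by (simp add: orthogonal_comp_span mem_orthogonal_comp inner_commute)
  then have "inner R R = 0" using RT by (simp add: mem_orthogonal_comp)
  then show ?thesis by (simp add: R_def)
qed

text \<open>A height function of a minimal surface is harmonic for the induced metric. Together with
  its conjugate, a primitive of the rotated differential, it forms coordinates whose differentials
  are orthogonal and of equal length.\<close>

lemma isothermal_coordinates:
  assumes z0: "z0 \<in> W"
  obtains U V t s where "open U" "U \<subseteq> W" "z0 \<in> U" "open V" "homeomorphism U V t s"
    "smooth_on U t" "smooth_on V s" "\<And>z. z \<in> U \<Longrightarrow> jac2 t z > 0" "\<And>y. y \<in> V \<Longrightarrow> jac2 s y > 0"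
    "isothermal V (u \<circ> s)"
proof -
  have "u1 z0 \<noteq> 0" using gram(1)[OF z0] by (auto simp: fE_def)
  then obtain e where e: "inner (u1 z0) e \<noteq> 0"
    by (metis euclidean_all_zero_iff)
  obtain r where r: "r > 0" "ball z0 r \<subseteq> W" using open_W z0 openE by blast
  have "open (ball z0 r \<inter> (\<lambda>z. inner (u1 z) e) -` (- {0}))"
    by (rule continuous_open_preimage)
      (use r in \<open>auto intro!: continuous_intros continuous_on_subset[OF smooth_on_continuous[OF smooth(1)]]\<close>)
  then obtain r' where r': "r' > 0" "ball z0 r' \<subseteq> ball z0 r \<inter> (\<lambda>z. inner (u1 z) e) -` (- {0})"
    using e r(1) by (metis Int_iff centre_in_ball vimageI openE ComplI singletonD)
  define B where "B = ball z0 r'"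
  have B: "open B" "convex B" "z0 \<in> B" "B \<subseteq> W" "\<And>z. z \<in> B \<Longrightarrow> inner (u1 z) e \<noteq> 0"
    using r r' by (auto simp: B_def)
  have BW: "z \<in> W" if "z \<in> B" for z using that B(4) by blast
  \<comment> \<open>The Hodge star of the differential of the height in direction \<open>e\<close>,
    written as a vector field; its potential \<open>hs\<close> is the conjugate function.\<close>
  define th where "th z = (- inner (Q z) e) *\<^sub>R e1 + inner (P z) e *\<^sub>R e2" for z
  have s_th: "smooth_on B th"
    unfolding th_def [abs_def]
    by (intro smooth_on_subset[OF _ B(4)] smooth_on_add smooth_on_scaleR smooth_on_const smooth_on_inner smooth_PQ open_W
        smooth_on_linear[OF open_W bounded_linear_minus[OF bounded_linear_ident]])
  have d_th: "dderiv v th z = (- inner (dderiv v Q z) e) *\<^sub>R e1 + inner (dderiv v P z) e *\<^sub>R e2" if "z \<in> B" for v z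
    unfolding th_def [abs_def]
    by (rule dderiv_eq) (intro has_derivative_add has_derivative_scaleR_left has_derivative_minus has_derivative_inner_left
        smooth_on_has_derivative[OF _ open_W BW[OF that]] smooth_PQ)
  have closed: "inner (dderiv v th z) w = inner (dderiv w th z) v" if z: "z \<in> B" for z v w
  proof -
    have "inner (dderiv e1 P z) e + inner (dderiv e2 Q z) e = 0"
      using rotated_closed[OF BW[OF z]] by (simp flip: inner_add_left)
    then have "dderiv e1 th z $ 2 = dderiv e2 th z $ 1"
      unfolding d_th[OF z] by (simp add: axis_def)
    then show ?thesis
      unfolding dderiv_coords[OF smooth_on_differentiable[OF s_th B(1) z], of v]
        dderiv_coords[OF smooth_on_differentiable[OF s_th B(1) z], of w]
      by (simp add: inner_vec_def sum_2 algebra_simps)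
  qed
  obtain hs where hs: "smooth_on B hs" "\<And>z. z \<in> B \<Longrightarrow> (hs has_derivative (\<lambda>v. inner (th z) v)) (at z)"
    using poincare_lemma[OF B(1-3) s_th closed] by blast
  define t where "t z = inner (u z) e *\<^sub>R e1 + hs z *\<^sub>R e2" for z
  have st: "smooth_on B t"
    unfolding t_def [abs_def]
    by (intro smooth_on_add smooth_on_scaleR smooth_on_const smooth_on_inner hs B(1) smooth_on_subset[OF smooth_u B(4)])
  have dt: "dderiv v t z = inner (dderiv v u z) e *\<^sub>R e1 + inner (th z) v *\<^sub>R e2" if "z \<in> B" for v z
    unfolding t_def [abs_def]
    by (rule dderiv_eq) (intro has_derivative_add has_derivative_scaleR_left has_derivative_inner_left hs(2)[OF that]
        smooth_on_has_derivative[OF smooth_u open_W BW[OF that]])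
  have dt_nth: "dderiv e1 t z $ 1 = inner (u1 z) e" "dderiv e2 t z $ 1 = inner (u2 z) e"
    "dderiv e1 t z $ 2 = - inner (Q z) e" "dderiv e2 t z $ 2 = inner (P z) e" if "z \<in> B" for z
    unfolding dt[OF that] u1_def u2_def th_def by (simp_all add: axis_def inner_vec_def sum_2)
  have J: "fw z * jac2 t z = fG z * (inner (u1 z) e)^2 - 2 * fF z * inner (u1 z) e * inner (u2 z) e + fE z * (inner (u2 z) e)^2"
    if "z \<in> B" for z
    using fw(1)[OF BW[OF that]]
    by (simp add: jac2_def dt_nth[OF that] P_def Q_def inner_diff_left power2_eq_square algebra_simps)
  have Jpos: "jac2 t z > 0" if z: "z \<in> B" for z
  proof -
    \<comment> \<open>Completing the square: fw times the Jacobian is, up to rotation, the metric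
      form evaluated at the gradient of the height, which is positive definite.\<close>
    have "fE z * (fw z * jac2 t z) = (fE z * inner (u2 z) e - fF z * inner (u1 z) e)^2 + fD z * (inner (u1 z) e)^2"
      unfolding J[OF z] by (simp add: fD_def power2_eq_square algebra_simps)
    also have "\<dots> > 0"
      using B(5)[OF z] gram(2)[OF BW[OF z]] by (intro add_nonneg_pos mult_pos_pos) auto
    finally show ?thesis using gram(1)[OF BW[OF z]] fw(1)[OF BW[OF z]] by (simp add: zero_less_mult_iff)
  qed
  have Jne: "jac2 t z \<noteq> 0" if "z \<in> B" for z using Jpos[OF that] by simp
  obtain U V s where *: "open U" "U \<subseteq> B" "z0 \<in> U" "open V" "homeomorphism U V t s"
    "smooth_on V s" "\<And>y v. y \<in> V \<Longrightarrow> dderiv v s y = cramer2 t v (s y)"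
    using smooth_local_inverse[OF B(1,3) st Jne] by blast
  have sU: "s y \<in> B" if "y \<in> V" for y using *(2,5) that unfolding homeomorphism_def by blast
  have ds_nth: "dderiv e1 s y $ 1 = inner (P (s y)) e / jac2 t (s y)" "dderiv e1 s y $ 2 = inner (Q (s y)) e / jac2 t (s y)"
    "dderiv e2 s y $ 1 = - inner (u2 (s y)) e / jac2 t (s y)" "dderiv e2 s y $ 2 = inner (u1 (s y)) e / jac2 t (s y)"
    if "y \<in> V" for y
    unfolding *(7)[OF that] cramer2_nth dt_nth[OF sU[OF that]] by (simp_all add: axis_def)
  have Js: "jac2 s y > 0" if y: "y \<in> V" for y
  proof -
    let ?J = "jac2 t (s y)"
    have "?J = inner (u1 (s y)) e * inner (P (s y)) e + inner (u2 (s y)) e * inner (Q (s y)) e"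
      unfolding jac2_def[of t] dt_nth[OF sU[OF y]] by simp
    then have "jac2 s y = ?J / (?J * ?J)"
      unfolding jac2_def[of s] ds_nth[OF y] by (simp add: add_divide_distrib mult.commute)
    then show ?thesis using Jpos[OF sU[OF y]] by simp
  qed
  have iso: "isothermal V (u \<circ> s)"
    unfolding isothermal_def
  proof (intro ballI conjI)
    fix y assume y: "y \<in> V"
    note yW = BW[OF sU[OF y]]
    have d: "dderiv v (u \<circ> s) y = dderiv v s y $ 1 *\<^sub>R u1 (s y) + dderiv v s y $ 2 *\<^sub>R u2 (s y)" for v
      using dderiv_compose[OF smooth_on_differentiable[OF *(6,4) y] diff_u[OF yW], of v]
        dderiv_coords[OF diff_u[OF yW], of "dderiv v s y"] by (simp add: o_def u1_def u2_def)
    let ?E = "fE (s y)" and ?F = "fF (s y)" and ?G = "fG (s y)" and ?w = "fw (s y)" and ?J = "jac2 t (s y)"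
    define x1 where "x1 = inner (u1 (s y)) e"
    define x2 where "x2 = inner (u2 (s y)) e"
    have m: "induced_metric (u \<circ> s) y v w = dderiv v s y $ 1 * dderiv w s y $ 1 * ?E +
       (dderiv v s y $ 1 * dderiv w s y $ 2 + dderiv v s y $ 2 * dderiv w s y $ 1) * ?F + dderiv v s y $ 2 * dderiv w s y $ 2 * ?G" for v w
      unfolding induced_metric_def d fE_def fF_def fG_def
      by (simp add: inner_add_left inner_add_right inner_commute[of "u2 _" "u1 _"] algebra_simps)
    have w: "?w > 0" "?w * ?w = ?E * ?G - ?F * ?F" using fw[OF yW] by (auto simp: fD_def)
    have PQ: "inner (P (s y)) e = (?G * x1 - ?F * x2) / ?w" "inner (Q (s y)) e = (?E * x2 - ?F * x1) / ?w"
      by (simp_all add: P_def Q_def inner_diff_left x1_def x2_def diff_divide_distrib)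
    have "((?G * x1 - ?F * x2) / ?w)^2 * ?E + 2 * ((?G * x1 - ?F * x2) / ?w) * ((?E * x2 - ?F * x1) / ?w) * ?F
        + ((?E * x2 - ?F * x1) / ?w)^2 * ?G
       = ((?G * x1 - ?F * x2)^2 * ?E + 2 * (?G * x1 - ?F * x2) * (?E * x2 - ?F * x1) * ?F
        + (?E * x2 - ?F * x1)^2 * ?G) / (?w * ?w)"
      by (simp add: power2_eq_square add_divide_distrib)
    also have "\<dots> = (x2^2 * ?E - 2 * x1 * x2 * ?F + x1^2 * ?G) * (?w * ?w) / (?w * ?w)"
      unfolding w(2) by (simp add: power2_eq_square algebra_simps)
    also have "\<dots> = x2^2 * ?E - 2 * x1 * x2 * ?F + x1^2 * ?G" using w(1) by simp
    finally have k: "((?G * x1 - ?F * x2) / ?w)^2 * ?E + 2 * ((?G * x1 - ?F * x2) / ?w) * ((?E * x2 - ?F * x1) / ?w) * ?F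
        + ((?E * x2 - ?F * x1) / ?w)^2 * ?G = x2^2 * ?E - 2 * x1 * x2 * ?F + x1^2 * ?G" .
    \<comment> \<open>These identities are proved for arbitrary reals, so that the large metric
      expressions act as atoms when they are instantiated.\<close>
    have gen1: "a / J * (a / J) * E + (a / J * (b / J) + b / J * (a / J)) * F + b / J * (b / J) * G =
        (a\<^sup>2 * E + 2 * a * b * F + b\<^sup>2 * G) / (J * J)" for a b E F G J :: real
      by (simp add: power2_eq_square add_divide_distrib ac_simps)
    have gen2: "(p / w / J) * (- y / J) * E + (p / w / J * (x / J) + q / w / J * (- y / J)) * F + q / w / J * (x / J) * G =
        (p * (- y) * E + (p * x + q * (- y)) * F + q * x * G) / (w * J * J)" for p q w x y E F G J :: real
      by (cases "w = 0 \<or> J = 0") (auto simp: field_simps)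
    have 11: "induced_metric (u \<circ> s) y e1 e1 = (((?G * x1 - ?F * x2) / ?w)^2 * ?E + 2 * ((?G * x1 - ?F * x2) / ?w) * ((?E * x2 - ?F * x1) / ?w) * ?F
        + ((?E * x2 - ?F * x1) / ?w)^2 * ?G) / (?J * ?J)"
      unfolding m ds_nth[OF y] PQ by (rule gen1)
    have 22: "induced_metric (u \<circ> s) y e2 e2 = (x2^2 * ?E - 2 * x1 * x2 * ?F + x1^2 * ?G) / (?J * ?J)"
      unfolding m ds_nth[OF y] x1_def[symmetric] x2_def[symmetric]
      using gen1[of "- x2" ?J ?E x1 ?F ?G] by (simp add: power2_eq_square mult.commute)
    show "induced_metric (u \<circ> s) y e1 e1 = induced_metric (u \<circ> s) y e2 e2"
      unfolding 11 22 k ..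
    have "induced_metric (u \<circ> s) y e1 e2 = ((?G * x1 - ?F * x2) * (- x2) * ?E + ((?G * x1 - ?F * x2) * x1 + (?E * x2 - ?F * x1) * (- x2)) * ?F
        + (?E * x2 - ?F * x1) * x1 * ?G) / (?w * ?J * ?J)"
      unfolding m ds_nth[OF y] PQ x1_def[symmetric] x2_def[symmetric] by (rule gen2)
    also have "(?G * x1 - ?F * x2) * (- x2) * ?E + ((?G * x1 - ?F * x2) * x1 + (?E * x2 - ?F * x1) * (- x2)) * ?F
        + (?E * x2 - ?F * x1) * x1 * ?G = 0"
      by (simp add: algebra_simps)
    finally show "induced_metric (u \<circ> s) y e1 e2 = 0" by (simp only: div_0)
  qed
  have "smooth_on U t" by (rule smooth_on_subset[OF st *(2)])
  moreover have "jac2 t z > 0" if "z \<in> U" for z using Jpos *(2) that by blast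
  moreover have "U \<subseteq> W" using *(2) B(4) by blast
  ultimately show ?thesis using that[OF *(1) _ *(3,4,5) _ *(6) _ Js iso] by blast
qed

end

text \<open>The complex bilinear extension of the inner product, not the Hermitian one: a vector is
  null exactly if its real and imaginary parts are orthogonal and of equal length.\<close>

definition cdot :: "complex^'n \<Rightarrow> complex^'n \<Rightarrow> complex" (infixl "\<odot>" 70) where
  "v \<odot> w = (\<Sum>i\<in>UNIV. v $ i * w $ i)"

definition ccnj :: "complex^'n \<Rightarrow> complex^'n" where "ccnj v = (\<chi> i. cnj (v $ i))"

definition cpx :: "real^2 \<Rightarrow> complex" where "cpx h = Complex (h $ 1) (h $ 2)"

text \<open>This is the real vector V + conj V; the factor 2 keeps \<open>cvec_rvec\<close> free of
  constants.\<close>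

definition rvec :: "complex^'n \<Rightarrow> real^'n" where "rvec V = (\<chi> i. 2 * Re (V $ i))"

lemma cdot_commute: "v \<odot> w = w \<odot> v"
  by (simp add: cdot_def mult.commute)

lemma cdot_linear [simp]:
  "(v + w) \<odot> x = v \<odot> x + w \<odot> x" "x \<odot> (v + w) = x \<odot> v + x \<odot> w"
  "(v - w) \<odot> x = v \<odot> x - w \<odot> x" "x \<odot> (v - w) = x \<odot> v - x \<odot> w"
  "(c *s v) \<odot> x = c * (v \<odot> x)" "x \<odot> (c *s v) = c * (x \<odot> v)"
  "(- v) \<odot> x = - (v \<odot> x)" "x \<odot> (- v) = - (x \<odot> v)" "0 \<odot> x = 0" "x \<odot> 0 = 0"
  by (simp_all add: cdot_def sum.distrib sum_subtractf sum_distrib_left sum_negf algebra_simps)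

lemma ccnj_simps [simp]:
  "ccnj (v + w) = ccnj v + ccnj w" "ccnj (v - w) = ccnj v - ccnj w" "ccnj (c *s v) = cnj c *s ccnj v"
  "ccnj (- v) = - ccnj v" "ccnj 0 = 0" "ccnj (ccnj v) = v"
  by (simp_all add: ccnj_def vec_eq_iff)

lemma cnj_cdot [simp]: "cnj (v \<odot> w) = ccnj v \<odot> ccnj w"
  by (simp add: cdot_def ccnj_def)

lemma cdot_ccnj_self: "v \<odot> ccnj v = of_real (\<Sum>i\<in>UNIV. (cmod (v $ i))\<^sup>2)"
  unfolding cdot_def ccnj_def of_real_sum of_real_power[symmetric] by (simp add: complex_norm_square del: of_real_power)

lemma cdot_ccnj_self_eq_0 [simp]: "v \<odot> ccnj v = 0 \<longleftrightarrow> v = 0"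
proof -
  have "v \<odot> ccnj v = 0 \<longleftrightarrow> (\<Sum>i\<in>UNIV. (cmod (v $ i))\<^sup>2) = 0"
    unfolding cdot_ccnj_self of_real_eq_0_iff ..
  also have "\<dots> \<longleftrightarrow> v = 0" by (simp add: sum_nonneg_eq_0_iff vec_eq_iff)
  finally show ?thesis .
qed

lemma cvec_simps: "cvec (v + w) = cvec v + cvec w" "cvec (v - w) = cvec v - cvec w"
  "cvec (r *\<^sub>R v) = of_real r *s cvec v" "cvec 0 = 0"
  by (simp_all add: cvec_def vec_eq_iff)

lemma ccnj_cvec [simp]: "ccnj (cvec v) = cvec v"
  by (simp add: cvec_def ccnj_def)

lemma cvec_eq_iff: "cvec v = cvec w \<longleftrightarrow> v = w"
  by (simp add: cvec_def vec_eq_iff)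

lemma cvec_inner: "cvec v \<odot> cvec w = of_real (inner v w)"
  by (simp add: cvec_def cdot_def inner_vec_def)

lemma cvec_rvec: "cvec (rvec V) = V + ccnj V"
  by (simp add: cvec_def rvec_def ccnj_def vec_eq_iff complex_add_cnj)

lemma rvec_add: "rvec (V + U) = rvec V + rvec U"
  and rvec_diff: "rvec (V - U) = rvec V - rvec U"
  and rvec_scaleR: "rvec (of_real r *s V) = r *\<^sub>R rvec V"
  and rvec_0: "rvec 0 = 0"
  by (simp_all add: rvec_def vec_eq_iff algebra_simps)

lemma inner_rvec: "of_real (inner (rvec V) (rvec U)) = (V + ccnj V) \<odot> (U + ccnj U)"
  by (simp flip: cvec_inner add: cvec_rvec)

definition rcpx :: "complex \<Rightarrow> real^2" where "rcpx x = vector [Re x, Im x]"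

lemma cpx_rcpx [simp]: "cpx (rcpx x) = x"
  by (simp add: cpx_def rcpx_def)

lemma cpx_simps: "cpx (v + w) = cpx v + cpx w" "cpx (r *\<^sub>R v) = of_real r * cpx v"
  "cpx (axis 1 1) = 1" "cpx (axis 2 1) = \<i>"
  by (simp_all add: cpx_def complex_eq_iff axis_def)

lemma cpx_inj: "cpx v = cpx w \<longleftrightarrow> v = w"
  by (simp add: cpx_def complex_eq_iff vec_eq_iff forall_2)

section \<open>Wirtinger derivatives\<close>

text \<open>\<open>wd F p q z\<close> says that \<open>F\<close> is differentiable at \<open>z\<close> with
  \<open>\<partial>F = p\<close> and \<open>\<partial>\<^sub>b F = q\<close>, where \<open>\<partial>\<close> and \<open>\<partial>\<^sub>b\<close> are the derivatives with respect to
  the complex coordinate and its conjugate.\<close>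

definition wd :: "(real^2 \<Rightarrow> complex) \<Rightarrow> complex \<Rightarrow> complex \<Rightarrow> real^2 \<Rightarrow> bool" where
  "wd F p q z \<longleftrightarrow> (F has_derivative (\<lambda>h. p * cpx h + q * cnj (cpx h))) (at z)"

definition vwd :: "(real^2 \<Rightarrow> complex^'n) \<Rightarrow> complex^'n \<Rightarrow> complex^'n \<Rightarrow> real^2 \<Rightarrow> bool" where
  "vwd F P Q z \<longleftrightarrow> (\<forall>i. wd (\<lambda>y. F y $ i) (P $ i) (Q $ i) z)"

lemma wd_eq: "wd F p q z \<Longrightarrow> p = p' \<Longrightarrow> q = q' \<Longrightarrow> wd F p' q' z"
  by simp

lemma vwd_eq: "vwd F p q z \<Longrightarrow> p = p' \<Longrightarrow> q = q' \<Longrightarrow> vwd F p' q' z"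
  by simp

lemma wd_const: "wd (\<lambda>y. c) 0 0 z"
  by (simp add: wd_def)

lemma wd_add: "wd F p q z \<Longrightarrow> wd G p' q' z \<Longrightarrow> wd (\<lambda>y. F y + G y) (p + p') (q + q') z"
  unfolding wd_def by (drule (1) has_derivative_add) (simp add: algebra_simps)

lemma wd_diff: "wd F p q z \<Longrightarrow> wd G p' q' z \<Longrightarrow> wd (\<lambda>y. F y - G y) (p - p') (q - q') z"
  unfolding wd_def by (drule (1) has_derivative_diff) (simp add: algebra_simps)

lemma wd_minus: "wd F p q z \<Longrightarrow> wd (\<lambda>y. - F y) (- p) (- q) z"
  using wd_diff[OF wd_const[of 0]] by fastforce

lemma wd_mult: "wd F p q z \<Longrightarrow> wd G p' q' z \<Longrightarrow> wd (\<lambda>y. F y * G y) (F z * p' + p * G z) (F z * q' + q * G z) z"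
  unfolding wd_def by (drule (1) has_derivative_mult) (simp add: algebra_simps)

lemma wd_cnj: "wd F p q z \<Longrightarrow> wd (\<lambda>y. cnj (F y)) (cnj q) (cnj p) z"
  unfolding wd_def by (drule bounded_linear.has_derivative[OF bounded_linear_cnj]) (simp add: algebra_simps)

lemma wd_inverse:
  assumes "wd F p q z" "F z \<noteq> 0"
  shows "wd (\<lambda>y. inverse (F y)) (- p / (F z)\<^sup>2) (- q / (F z)\<^sup>2) z"
proof -
  have "(inverse has_derivative (*) (- (inverse (F z) ^ Suc (Suc 0)))) (at (F z))"
    using DERIV_inverse[of "F z" UNIV] assms(2) by (simp add: has_field_derivative_def)
  from diff_chain_at[OF assms(1)[unfolded wd_def] this] show ?thesis
    unfolding wd_def o_def
    by (rule has_derivative_eq_rhs) (simp add: fun_eq_iff power2_eq_square field_simps assms(2))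
qed

lemma wd_divide:
  assumes "wd F p q z" "wd G p' q' z" "G z \<noteq> 0"
  shows "wd (\<lambda>y. F y / G y) (p / G z - F z * p' / (G z)\<^sup>2) (q / G z - F z * q' / (G z)\<^sup>2) z"
  unfolding divide_inverse[of "F _"]
  by (rule wd_eq[OF wd_mult[OF assms(1) wd_inverse[OF assms(2,3)]]]) (simp_all add: field_simps)

lemma wd_sum: "(\<And>i. i \<in> I \<Longrightarrow> wd (F i) (p i) (q i) z) \<Longrightarrow> wd (\<lambda>y. \<Sum>i\<in>I. F i y) (\<Sum>i\<in>I. p i) (\<Sum>i\<in>I. q i) z"
  by (induction I rule: infinite_finite_induct) (auto intro: wd_add wd_const)

lemma wd_cong_open:
  assumes "open S" "z \<in> S" "\<And>y. y \<in> S \<Longrightarrow> F y = G y"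
  shows "wd F p q z \<longleftrightarrow> wd G p q z"
  unfolding wd_def using has_derivative_cong_open[OF assms] by simp

lemma wd_unique:
  assumes "wd F p q z" "wd F p' q' z"
  shows "p = p'" "q = q'"
proof -
  have "(\<lambda>h. p * cpx h + q * cnj (cpx h)) = (\<lambda>h. p' * cpx h + q' * cnj (cpx h))"
    using assms has_derivative_unique unfolding wd_def by blast
  from fun_cong[OF this, of "axis 1 1"] fun_cong[OF this, of "axis 2 1"]
  have "p + q = p' + q'" "\<i> * (p - q) = \<i> * (p' - q')"
    by (simp_all add: cpx_simps algebra_simps)
  then have "p + q = p' + q'" "p - q = p' - q'" by simp_all
  then show "p = p'" "q = q'" by algebra+
qed

lemma wd_const_on:
  assumes "open S" "z \<in> S" "\<And>y. y \<in> S \<Longrightarrow> F y = c" "wd F p q z"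
  shows "p = 0" "q = 0"
proof -
  have "wd F 0 0 z"
    using wd_cong_open[of S z F "\<lambda>y. c"] wd_const assms(1-3) by blast
  from wd_unique[OF assms(4) this] show "p = 0" "q = 0" by auto
qed

lemma wd_of_differentiable:
  fixes F :: "real^2 \<Rightarrow> complex"
  assumes "F differentiable (at z)"
  shows "wd F ((dderiv (axis 1 1) F z - \<i> * dderiv (axis 2 1) F z) / 2)
     ((dderiv (axis 1 1) F z + \<i> * dderiv (axis 2 1) F z) / 2) z"
proof -
  have "dderiv h F z = (dderiv (axis 1 1) F z - \<i> * dderiv (axis 2 1) F z) / 2 * cpx h +
     (dderiv (axis 1 1) F z + \<i> * dderiv (axis 2 1) F z) / 2 * cnj (cpx h)" for h
    unfolding dderiv_coords[OF assms, of h] cpx_def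
    by (simp add: complex_eq_iff field_simps)
  then show ?thesis
    unfolding wd_def by (rule has_derivative_eq_rhs[OF has_derivative_dderiv[OF assms] ext])
qed

lemma wd_dderiv: "wd F p q z \<Longrightarrow> dderiv v F z = p * cpx v + q * cnj (cpx v)"
  unfolding wd_def by (rule dderiv_eq)

text \<open>The symmetry of second derivatives in Wirtinger form. It gives access to the conjugate
  derivative of \<open>g2\<close> through the derivative of \<open>h\<close>.\<close>

lemma wd_commute:
  assumes S: "open S" "z \<in> S" and F: "smooth_on S F"
    and PQ: "\<And>y. y \<in> S \<Longrightarrow> wd F (P y) (Q y) y" and p: "wd P p1 p2 z" and q: "wd Q q1 q2 z"
  shows "p2 = q1"
proof -
  have d: "dderiv v F y = P y * cpx v + Q y * cnj (cpx v)" if "y \<in> S" for v y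
    by (rule wd_dderiv[OF PQ[OF that]])
  have dd: "dderiv w (dderiv v F) z = (p1 * cpx w + p2 * cnj (cpx w)) * cpx v + (q1 * cpx w + q2 * cnj (cpx w)) * cnj (cpx v)" for v w
  proof -
    have "dderiv w (dderiv v F) z = dderiv w (\<lambda>y. P y * cpx v + Q y * cnj (cpx v)) z"
      by (rule dderiv_cong_open[OF S d])
    also have "\<dots> = (p1 * cpx w + p2 * cnj (cpx w)) * cpx v + (q1 * cpx w + q2 * cnj (cpx w)) * cnj (cpx v)"
      by (rule dderiv_eq) (intro has_derivative_add has_derivative_mult_left p[unfolded wd_def] q[unfolded wd_def])
    finally show ?thesis .
  qed
  have "dderiv (axis 1 1) (dderiv (axis 2 1) F) z = dderiv (axis 2 1) (dderiv (axis 1 1) F) z"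
    by (rule dderiv_commute[OF S(1) F S(2)])
  then have "2 * (p2 - q1) = 0"
    unfolding dd cpx_simps by (simp add: algebra_simps complex_eq_iff)
  then show ?thesis by simp
qed

lemma vwd_const: "vwd (\<lambda>y. c) 0 0 z"
  by (simp add: vwd_def wd_const)

lemma vwd_add: "vwd F P Q z \<Longrightarrow> vwd G P' Q' z \<Longrightarrow> vwd (\<lambda>y. F y + G y) (P + P') (Q + Q') z"
  by (simp add: vwd_def wd_add)

lemma vwd_diff: "vwd F P Q z \<Longrightarrow> vwd G P' Q' z \<Longrightarrow> vwd (\<lambda>y. F y - G y) (P - P') (Q - Q') z"
  by (simp add: vwd_def wd_diff)

lemma vwd_minus: "vwd F P Q z \<Longrightarrow> vwd (\<lambda>y. - F y) (- P) (- Q) z"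
  by (simp add: vwd_def wd_minus)

lemma vwd_scale: "wd f p q z \<Longrightarrow> vwd G P' Q' z \<Longrightarrow> vwd (\<lambda>y. f y *s G y) (f z *s P' + p *s G z) (f z *s Q' + q *s G z) z"
  unfolding vwd_def vector_smult_component vector_add_component by (intro allI wd_mult) auto

lemma vwd_ccnj: "vwd F P Q z \<Longrightarrow> vwd (\<lambda>y. ccnj (F y)) (ccnj Q) (ccnj P) z"
  unfolding vwd_def ccnj_def vec_lambda_beta by (intro allI wd_cnj) auto

lemma wd_cdot: "vwd F P Q z \<Longrightarrow> vwd G P' Q' z \<Longrightarrow> wd (\<lambda>y. F y \<odot> G y) (F z \<odot> P' + P \<odot> G z) (F z \<odot> Q' + Q \<odot> G z) z"
  unfolding cdot_def sum.distrib[symmetric] vwd_def by (intro wd_sum wd_mult) auto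

lemma vwd_cong_open:
  assumes "open S" "z \<in> S" "\<And>y. y \<in> S \<Longrightarrow> F y = G y"
  shows "vwd F p q z \<longleftrightarrow> vwd G p q z"
  unfolding vwd_def using assms by (intro all_cong1 wd_cong_open) auto

lemma vwd_unique: "vwd F P Q z \<Longrightarrow> vwd F P' Q' z \<Longrightarrow> P = P'" "vwd F P Q z \<Longrightarrow> vwd F P' Q' z \<Longrightarrow> Q = Q'"
  unfolding vwd_def vec_eq_iff using wd_unique by blast+

text \<open>Componentwise half of \<partial>u/\<partial>x - i \<partial>u/\<partial>y, that is,
  \<partial>u.\<close>

definition phi :: "(real^2 \<Rightarrow> real^'n) \<Rightarrow> real^2 \<Rightarrow> complex^'n" where
  "phi u z = (\<chi> i. Complex (dderiv (axis 1 1) u z $ i / 2) (- dderiv (axis 2 1) u z $ i / 2))"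

lemma vwd_cvec:
  assumes "u differentiable (at z)"
  shows "vwd (\<lambda>y. cvec (u y)) (phi u z) (ccnj (phi u z)) z"
  unfolding vwd_def wd_def
proof
  fix i
  have "((\<lambda>y. complex_of_real (u y $ i)) has_derivative (\<lambda>h. complex_of_real (dderiv h u z $ i))) (at z)"
    by (intro bounded_linear.has_derivative[OF bounded_linear_of_real]
        bounded_linear.has_derivative[OF bounded_linear_vec_nth] has_derivative_dderiv assms)
  moreover have "complex_of_real (dderiv h u z $ i) = phi u z $ i * cpx h + ccnj (phi u z) $ i * cnj (cpx h)" for h
    unfolding dderiv_coords[OF assms, of h]
    by (simp add: phi_def ccnj_def cpx_def complex_eq_iff field_simps)
  ultimately show "((\<lambda>y. cvec (u y) $ i) has_derivative
       (\<lambda>h. phi u z $ i * cpx h + ccnj (phi u z) $ i * cnj (cpx h))) (at z)"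
    by (simp add: cvec_def)
qed

section \<open>The first two ellipses of curvature\<close>

lemma vwd_dderiv_cvec:
  assumes "vwd (\<lambda>y. cvec (u y)) P Q z" "u differentiable (at z)"
  shows "cvec (dderiv v u z) = cpx v *s P + cnj (cpx v) *s Q"
proof -
  have "complex_of_real (dderiv v u z $ i) = P $ i * cpx v + Q $ i * cnj (cpx v)" for i
  proof -
    have 1: "((\<lambda>y. complex_of_real (u y $ i)) has_derivative (\<lambda>h. complex_of_real (dderiv h u z $ i))) (at z)"
      by (intro bounded_linear.has_derivative[OF bounded_linear_of_real]
          bounded_linear.has_derivative[OF bounded_linear_vec_nth] has_derivative_dderiv assms)
    have 2: "wd (\<lambda>y. complex_of_real (u y $ i)) (P $ i) (Q $ i) z"
      using assms(1) by (simp add: vwd_def cvec_def)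
    show ?thesis using dderiv_eq[OF 1, of v] wd_dderiv[OF 2, of v] by simp
  qed
  then show ?thesis by (simp add: cvec_def vec_eq_iff mult.commute)
qed

lemma cvec_eq_rvec: "cvec x = V + ccnj V \<longleftrightarrow> x = rvec V"
  using cvec_rvec cvec_eq_iff by metis

text \<open>Because the conjugate derivative of \<open>V\<close> vanishes, differentiating along
  \<open>v\<close> amounts to multiplying by \<open>cpx v\<close>. Iteration makes the real
  derivatives of a minimal surface complex multilinear.\<close>

lemma dderiv_rvec:
  assumes "open S" "z \<in> S" "F differentiable (at z)" "\<And>y. y \<in> S \<Longrightarrow> F y = rvec (c *s V y)" "vwd V V' 0 z"
  shows "dderiv v F z = rvec ((cpx v * c) *s V')"
proof -
  have "vwd (\<lambda>y. c *s V y + ccnj (c *s V y)) (c *s V') (ccnj (c *s V')) z"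
    by (rule vwd_eq[OF vwd_add[OF vwd_scale[OF wd_const assms(5)] vwd_ccnj[OF vwd_scale[OF wd_const assms(5)]]]]) simp_all
  then have "vwd (\<lambda>y. cvec (F y)) (c *s V') (ccnj (c *s V')) z"
    using vwd_cong_open[OF assms(1,2), of "\<lambda>y. cvec (F y)" "\<lambda>y. c *s V y + ccnj (c *s V y)"] assms(4)
    by (simp add: cvec_rvec)
  from vwd_dderiv_cvec[OF this assms(3), of v]
  have "cvec (dderiv v F z) = (cpx v * c) *s V' + ccnj ((cpx v * c) *s V')"
    by simp
  then show ?thesis by (simp add: cvec_eq_rvec del: ccnj_simps)
qed

lemma ccnj_null: "v \<odot> w = 0 \<Longrightarrow> ccnj v \<odot> ccnj w = 0"
  by (metis cnj_cdot complex_cnj_zero)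

lemma norm_rvec:
  "complex_of_real ((norm (rvec (w *s V)))\<^sup>2) = w\<^sup>2 * (V \<odot> V) + cnj (w\<^sup>2 * (V \<odot> V)) + 2 * of_real ((norm w)\<^sup>2) * (V \<odot> ccnj V)"
proof -
  have "of_real ((norm w)\<^sup>2) = w * cnj w" by (rule complex_norm_square)
  then show ?thesis
    unfolding power2_norm_eq_inner inner_rvec
    by (simp add: cdot_commute[of "ccnj V" V] power2_eq_square algebra_simps)
qed

lemma subspace_rvec: "subspace {rvec (x *s V) |x. True}"
  unfolding subspace_def
proof safe
  show "\<exists>x. 0 = rvec (x *s V) \<and> True" by (rule exI[of _ 0]) (simp add: rvec_0)
  fix c x y
  show "\<exists>z. rvec (x *s V) + rvec (y *s V) = rvec (z *s V) \<and> True"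
    by (rule exI[of _ "x + y"]) (simp add: rvec_add vector_sadd_rdistrib)
  show "\<exists>z. c *\<^sub>R rvec (x *s V) = rvec (z *s V) \<and> True"
    by (rule exI[of _ "of_real c * x"]) (simp flip: rvec_scaleR)
qed

text \<open>For null \<open>V\<close> the terms with w^2 drop out of the squared norm, leaving a
  multiple of |w|^2: circles about 0 go to circles.\<close>

lemma norm_rvec_null:
  assumes "V \<odot> V = 0"
  shows "norm (rvec (w *s V)) = norm w * sqrt (2 * Re (V \<odot> ccnj V))"
proof -
  have "complex_of_real ((norm (rvec (w *s V)))\<^sup>2) = 2 * of_real ((norm w)\<^sup>2) * (V \<odot> ccnj V)"
    unfolding norm_rvec using assms ccnj_null[OF assms] by simp
  from arg_cong[OF this, of Re] have "(norm (rvec (w *s V)))\<^sup>2 = (norm w)\<^sup>2 * (2 * Re (V \<odot> ccnj V))"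
    by (simp del: of_real_power)
  then have "sqrt ((norm (rvec (w *s V)))\<^sup>2) = sqrt ((norm w)\<^sup>2 * (2 * Re (V \<odot> ccnj V)))" by simp
  then show ?thesis by (simp add: real_sqrt_mult)
qed

lemma cdot_ccnj_pos: "V \<noteq> 0 \<Longrightarrow> Re (V \<odot> ccnj V) > 0" "Im (V \<odot> ccnj V) = 0"
proof -
  have "Re (V \<odot> ccnj V) \<ge> 0" by (simp add: cdot_ccnj_self sum_nonneg)
  moreover show i: "Im (V \<odot> ccnj V) = 0" by (simp add: cdot_ccnj_self)
  moreover assume "V \<noteq> 0"
  ultimately show "Re (V \<odot> ccnj V) > 0"
    using cdot_ccnj_self_eq_0[of V] by (metis complex_eq_iff less_eq_real_def zero_complex.sel)
qed

lemma cdot_ccnj_Re: "V \<odot> ccnj V = of_real (Re (V \<odot> ccnj V))"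
  by (simp add: complex_eq_iff cdot_ccnj_pos)

lemma dim_rvec:
  fixes V :: "complex^'n"
  assumes "V \<odot> V = 0" "V \<noteq> 0"
  shows "dim {rvec (x *s V) |x. True} = 2"
proof -
  have sp: "{rvec (x *s V) |x. True} = span {rvec V, rvec (\<i> *s V)}"
  proof
    show "{rvec (x *s V) |x. True} \<subseteq> span {rvec V, rvec (\<i> *s V)}"
    proof safe
      fix x
      have "x *s V = of_real (Re x) *s V + of_real (Im x) *s (\<i> *s V)"
        by (subst complex_eq[of x]) (simp add: vec_eq_iff algebra_simps)
      then have "rvec (x *s V) = Re x *\<^sub>R rvec V + Im x *\<^sub>R rvec (\<i> *s V)"
        by (simp only: rvec_add rvec_scaleR)
      moreover have "\<dots> \<in> span {rvec V, rvec (\<i> *s V)}"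
        by (intro span_add span_scale span_base; simp)
      ultimately show "rvec (x *s V) \<in> span {rvec V, rvec (\<i> *s V)}" by (simp only:)
    qed
    show "span {rvec V, rvec (\<i> *s V)} \<subseteq> {rvec (x *s V) |x. True}"
      by (rule span_minimal[OF _ subspace_rvec]) (auto intro: exI[of _ 1] exI[of _ \<i>])
  qed
  have "complex_of_real (inner (rvec V) (rvec (\<i> *s V))) = 0"
    unfolding inner_rvec using assms(1) ccnj_null[OF assms(1)] by (simp add: cdot_commute[of "ccnj V" V])
  then have orth: "inner (rvec V) (rvec (\<i> *s V)) = 0" by simp
  have "norm (rvec (1 *s V)) \<noteq> 0" "norm (rvec (\<i> *s V)) \<noteq> 0"
    unfolding norm_rvec_null[OF assms(1)] using cdot_ccnj_pos(1)[OF assms(2)] by simp_all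
  then have nz: "rvec V \<noteq> 0" "rvec (\<i> *s V) \<noteq> 0" by auto
  have ne: "rvec V \<noteq> rvec (\<i> *s V)" using orth nz by auto
  have "independent {rvec V, rvec (\<i> *s V)}"
    by (rule pairwise_orthogonal_independent)
      (use orth nz in \<open>auto simp: pairwise_def orthogonal_def inner_commute\<close>)
  then show ?thesis unfolding sp using ne by (simp add: dim_eq_card_independent)
qed

text \<open>In the direction from circle to null vector, the symmetry w -> -w first identifies the
  centre as \<open>c0\<close>; then the norm is constant along the curve, and three values of
  \<open>w\<close> annihilate V \<odot> V.\<close>

lemma is_circle_iff:
  fixes V :: "complex^'n"
  assumes r: "r > 0"
  shows "is_circle {c0 + rvec (w *s V) |w. norm w = r} \<longleftrightarrow> V \<odot> V = 0 \<and> V \<noteq> 0"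
proof
  assume V: "V \<odot> V = 0 \<and> V \<noteq> 0"
  let ?P = "{rvec (x *s V) |x. True}" and ?k = "sqrt (2 * Re (V \<odot> ccnj V))"
  have "Re (V \<odot> ccnj V) > 0" using cdot_ccnj_pos(1) V by blast
  then have k: "?k > 0" by simp
  have "{c0 + rvec (w *s V) |w. norm w = r} = {c0 + w |w. w \<in> ?P \<and> norm w = r * ?k}"
  proof -
    have "norm (rvec (x *s V)) = r * ?k \<longleftrightarrow> norm x = r" for x
      using norm_rvec_null[of V x] V k by simp
    then show ?thesis by fastforce
  qed
  then show "is_circle {c0 + rvec (w *s V) |w. norm w = r}"
    unfolding is_circle_def using r k dim_rvec[of V] V subspace_rvec[of V]
    by (intro exI[of _ c0] exI[of _ "r * ?k"] exI[of _ ?P] conjI mult_pos_pos) blast+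
next
  assume "is_circle {c0 + rvec (w *s V) |w. norm w = r}"
  then obtain c R P where P: "R > 0" "subspace P" "dim P = 2"
    "{c0 + rvec (w *s V) |w. norm w = r} = {c + w |w. w \<in> P \<and> norm w = R}"
    unfolding is_circle_def by blast
  have "P \<noteq> {0}" using P(3) dim_eq_0[of P] by auto
  then obtain p0 where p0: "p0 \<in> P" "p0 \<noteq> 0" using subspace_0[OF P(2)] by blast
  define p where "p = (R / norm p0) *\<^sub>R p0"
  have p: "p \<in> P" "norm p = R" using p0 P by (simp_all add: p_def subspace_scale)
  \<comment> \<open>Negating \<open>w\<close> reflects the curve at \<open>c0\<close>, so the
    reflected point again lies on the circle about \<open>c\<close>. Applied to \<open>p\<close> and
    \<open>- p\<close>, the parallelogram law forces c = c0.\<close>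
  have refl: "norm (2 *\<^sub>R (c - c0) + p) = R" if "p \<in> P" "norm p = R" for p
  proof -
    have "c + p \<in> {c0 + rvec (w *s V) |w. norm w = r}" unfolding P(4) using that by blast
    then obtain w where w: "c + p = c0 + rvec (w *s V)" "norm w = r" by blast
    have "c0 + rvec ((- w) *s V) \<in> {c + w |w. w \<in> P \<and> norm w = R}" unfolding P(4)[symmetric]
      by (rule CollectI, rule exI[of _ "- w"]) (simp add: w)
    then obtain p' where p': "c0 + rvec ((- w) *s V) = c + p'" "norm p' = R" by blast
    have "rvec ((- w) *s V) = - rvec (w *s V)"
      using rvec_scaleR[of "-1" "w *s V"] by simp
    then have "p' = - (2 *\<^sub>R (c - c0) + p)" using w(1) p'(1) by (simp add: algebra_simps scaleR_2)
    then show ?thesis using p'(2) norm_minus_cancel by metis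
  qed
  have parallelogram: "(norm (d + p))\<^sup>2 + (norm (d - p))\<^sup>2 = 2 * (norm d)\<^sup>2 + 2 * (norm p)\<^sup>2" for d p :: "real^'n"
    by (simp add: power2_norm_eq_inner inner_add_left inner_add_right inner_diff_left inner_diff_right inner_commute)
  have "norm (2 *\<^sub>R (c - c0) + p) = R" "norm (2 *\<^sub>R (c - c0) - p) = R"
    using refl[OF p] refl[of "- p"] p subspace_neg[OF P(2)] by auto
  then have "(norm (2 *\<^sub>R (c - c0) + p))\<^sup>2 + (norm (2 *\<^sub>R (c - c0) - p))\<^sup>2 = 2 * R\<^sup>2" by simp
  then have "(norm (2 *\<^sub>R (c - c0)))\<^sup>2 = 0"
    using parallelogram[of "2 *\<^sub>R (c - c0)" p] p(2) by simp
  then have c: "c = c0" by simp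
  have nR: "complex_of_real (R\<^sup>2) = w\<^sup>2 * (V \<odot> V) + cnj (w\<^sup>2 * (V \<odot> V)) + 2 * of_real (r\<^sup>2) * (V \<odot> ccnj V)"
    if "norm w = r" for w
  proof -
    have "c0 + rvec (w *s V) \<in> {c + w |w. w \<in> P \<and> norm w = R}" unfolding P(4)[symmetric] using that by blast
    then have "norm (rvec (w *s V)) = R" unfolding c by auto
    then show ?thesis using norm_rvec[of w V] that by simp
  qed
  let ?v = "V \<odot> V"
  \<comment> \<open>The square of \<open>s\<close> is i r^2. The values r and i r detect the real
    part of V \<odot> V, and \<open>s\<close> the imaginary part.\<close>
  define s where "s = of_real (r / sqrt 2) * (1 + \<i>)"
  have "norm (1 + \<i>) = sqrt 2" by (simp add: cmod_def)
  then have s: "norm s = r" using r by (simp add: s_def norm_mult norm_divide)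
  have "(complex_of_real (sqrt 2))\<^sup>2 = 2" by (simp flip: of_real_power)
  then have s2: "s\<^sup>2 = \<i> * of_real (r\<^sup>2)" by (simp add: s_def power_mult_distrib power_divide) (simp add: power2_eq_square algebra_simps)
  have 1: "of_real (r\<^sup>2) * (?v + cnj ?v) = - (of_real (r\<^sup>2) * (?v + cnj ?v))"
    using nR[of "of_real r"] nR[of "\<i> * of_real r"] r by (simp add: norm_mult power_mult_distrib algebra_simps)
  then have re: "Re ?v = 0" using r by (simp add: complex_eq_iff del: cnj_cdot)
  have 2: "of_real (r\<^sup>2) * (?v + cnj ?v) = of_real (r\<^sup>2) * (\<i> * ?v + cnj (\<i> * ?v))"
    using nR[of "of_real r"] nR[OF s] r unfolding s2 by (simp add: algebra_simps)
  then have im: "Im ?v = 0" using r re by (simp add: complex_eq_iff del: cnj_cdot)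
  have v0: "?v = 0" using re im by (simp add: complex_eq_iff)
  moreover have "V \<noteq> 0"
  proof
    assume "V = 0"
    then show False using nR[of "of_real r"] r P(1) by simp
  qed
  ultimately show "V \<odot> V = 0 \<and> V \<noteq> 0" by blast
qed

lemma cis_power_range:
  assumes "n > 0"
  shows "{(cis \<psi> * x) ^ n |\<psi>. \<psi> \<in> {0..<2*pi}} = {w. norm w = norm x ^ n}"
proof (intro equalityI subsetI)
  fix w :: complex assume "w \<in> {w. norm w = norm x ^ n}"
  then have w: "norm w = norm (x ^ n)" by (simp add: norm_power)
  show "w \<in> {(cis \<psi> * x) ^ n |\<psi>. \<psi> \<in> {0..<2*pi}}"
  proof (cases "x = 0")
    case True
    then have "w = 0" using w assms by (simp add: zero_power)
    then show ?thesis using True assms by (auto simp: zero_power intro!: exI[of _ 0])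
  next
    case False
    then have "norm (w / x ^ n) = 1" using w by (simp add: norm_divide)
    then obtain t where t: "0 \<le> t" "t < 2 * pi" "w / x ^ n = cis t"
      using complex_unimodular_polar[of "w / x ^ n"] by (auto simp: complex_eq_iff)
    have n: "real n \<ge> 1" using assms by simp
    \<comment> \<open>One n-th root in the prescribed half-open interval suffices, as the power map
      covers the circle n times.\<close>
    have "t / real n < 2 * pi"
    proof -
      have "t / real n \<le> t" using t(1) n by (simp add: divide_le_eq mult_le_cancel_left1)
      then show ?thesis using t(2) by simp
    qed
    moreover have "cis (t / real n) ^ n = cis t"
      unfolding Complex.DeMoivre using assms by simp
    then have "(cis (t / real n) * x) ^ n = w"
      using t(3) False by (simp add: power_mult_distrib field_simps)
    ultimately show ?thesis using t(1) by (auto intro!: exI[of _ "t / real n"])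
  qed
qed (auto simp: norm_power norm_mult)

locale iso_patch = minimal_patch W u for W and u :: "real^2 \<Rightarrow> real^'n" +
  assumes iso: "isothermal W u"
begin

text \<open>In isothermal coordinates the area density equals \<open>fE\<close>, so the rotated
  differential has \<open>P\<close> = \<open>u1\<close> and \<open>Q\<close> = \<open>u2\<close>,
  and its closedness is the flat Laplace equation.\<close>

lemma harmonic:
  assumes z: "z \<in> W"
  shows "dderiv e1 (dderiv e1 u) z + dderiv e2 (dderiv e2 u) z = 0"
proof -
  have m: "fF y = 0" "fG y = fE y" "fE y > 0" "fw y = fE y" if "y \<in> W" for y
  proof -
    show 1: "fF y = 0" "fG y = fE y" "fE y > 0"
      using iso that gram(1)[OF that] by (auto simp: isothermal_def fE_def fF_def fG_def u1_def u2_def induced_metric_def)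
    show "fw y = fE y" using 1 by (simp add: fw_def fD_def)
  qed
  have "dderiv e1 P z = dderiv e1 u1 z"
    by (rule dderiv_cong_open[OF open_W z]) (simp add: P_def m less_imp_neq[OF m(3), symmetric])
  moreover have "dderiv e2 Q z = dderiv e2 u2 z"
    by (rule dderiv_cong_open[OF open_W z]) (simp add: Q_def m less_imp_neq[OF m(3), symmetric])
  ultimately show ?thesis using rotated_closed[OF z] by (simp add: u1_def u2_def)
qed

end

text \<open>Harmonicity and the symmetry of second derivatives are together the Cauchy-Riemann
  equations for \<partial>v.\<close>

lemma vwd_phi:
  fixes v :: "real^2 \<Rightarrow> real^'n"
  assumes W: "open W" "z \<in> W" and v: "smooth_on W v"
    and h: "dderiv (axis 1 1) (dderiv (axis 1 1) v) z + dderiv (axis 2 1) (dderiv (axis 2 1) v) z = 0"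
  shows "vwd (phi v) (phi (dderiv (axis 1 1) v) z) 0 z"
  unfolding vwd_def wd_def
proof
  fix i
  let ?e1 = "axis 1 1 :: real^2" and ?e2 = "axis 2 1 :: real^2"
  have d: "((\<lambda>y. complex_of_real (dderiv a v y $ i)) has_derivative (\<lambda>h. complex_of_real (dderiv h (dderiv a v) z $ i))) (at z)" for a
    by (intro bounded_linear.has_derivative[OF bounded_linear_of_real]
        bounded_linear.has_derivative[OF bounded_linear_vec_nth] smooth_on_has_derivative[OF _ W] smooth_on_dderiv v)
  have "((\<lambda>y. (complex_of_real (dderiv ?e1 v y $ i) - \<i> * complex_of_real (dderiv ?e2 v y $ i)) / 2) has_derivative
     (\<lambda>h. (complex_of_real (dderiv h (dderiv ?e1 v) z $ i) - \<i> * complex_of_real (dderiv h (dderiv ?e2 v) z $ i)) / 2)) (at z)"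
    by (intro bounded_linear.has_derivative[OF bounded_linear_divide] has_derivative_diff has_derivative_mult_right d)
  moreover have "(\<lambda>y. (complex_of_real (dderiv ?e1 v y $ i) - \<i> * complex_of_real (dderiv ?e2 v y $ i)) / 2) = (\<lambda>y. phi v y $ i)"
    by (auto simp: phi_def complex_eq_iff)
  moreover have "(complex_of_real (dderiv h (dderiv ?e1 v) z $ i) - \<i> * complex_of_real (dderiv h (dderiv ?e2 v) z $ i)) / 2
      = phi (dderiv ?e1 v) z $ i * cpx h" for h
  proof -
    have "dderiv ?e2 (dderiv ?e2 v) z = - dderiv ?e1 (dderiv ?e1 v) z"
      using h by (simp add: eq_neg_iff_add_eq_0 add.commute)
    moreover have "dderiv ?e2 (dderiv ?e1 v) z = dderiv ?e1 (dderiv ?e2 v) z"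
      by (rule dderiv_commute[OF W(1) v W(2)])
    ultimately show ?thesis
      unfolding dderiv_coords[OF smooth_on_differentiable[OF smooth_on_dderiv[OF v] W], of h]
      by (simp add: phi_def cpx_def complex_eq_iff field_simps)
  qed
  ultimately show "((\<lambda>y. phi v y $ i) has_derivative
       (\<lambda>h. phi (dderiv ?e1 v) z $ i * cpx h + 0 $ i * cnj (cpx h))) (at z)" by simp
qed

context iso_patch
begin

definition "ph = phi u"
definition "ph1 = phi (dderiv e1 u)"
definition "ph2 = phi (dderiv e1 (dderiv e1 u))"

lemma harmonic1:
  assumes z: "z \<in> W"
  shows "dderiv e1 (dderiv e1 (dderiv e1 u)) z + dderiv e2 (dderiv e2 (dderiv e1 u)) z = 0"
proof -
  have sm: "smooth_on W (dderiv v (dderiv w u))" for v w by (intro smooth_on_dderiv smooth_u)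
  have "dderiv e1 (\<lambda>y. dderiv e1 (dderiv e1 u) y + dderiv e2 (dderiv e2 u) y) z = dderiv e1 (\<lambda>y. 0) z"
    by (rule dderiv_cong_open[OF open_W z]) (rule harmonic)
  moreover have "dderiv e1 (\<lambda>y. dderiv e1 (dderiv e1 u) y + dderiv e2 (dderiv e2 u) y) z
     = dderiv e1 (dderiv e1 (dderiv e1 u)) z + dderiv e1 (dderiv e2 (dderiv e2 u)) z"
    by (rule dderiv_eq) (intro has_derivative_add smooth_on_has_derivative[OF sm open_W z])
  moreover have "dderiv e1 (\<lambda>y. 0 :: real^'n) z = 0" by (rule dderiv_eq) simp
  moreover have "dderiv e1 (dderiv e2 (dderiv e2 u)) z = dderiv e2 (dderiv e1 (dderiv e2 u)) z"
    by (rule dderiv_commute[OF open_W smooth_on_dderiv[OF smooth_u] z])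
  moreover have "dderiv e2 (dderiv e1 (dderiv e2 u)) z = dderiv e2 (dderiv e2 (dderiv e1 u)) z"
    by (rule dderiv_cong_open[OF open_W z]) (rule dderiv_commute[OF open_W smooth_u])
  ultimately show ?thesis by simp
qed

lemma vwd_ph: "z \<in> W \<Longrightarrow> vwd ph (ph1 z) 0 z"
  unfolding ph_def ph1_def by (rule vwd_phi[OF open_W _ smooth_u harmonic])

lemma vwd_ph1: "z \<in> W \<Longrightarrow> vwd ph1 (ph2 z) 0 z"
  unfolding ph1_def ph2_def by (rule vwd_phi[OF open_W _ smooth_on_dderiv[OF smooth_u] harmonic1])

lemma vwd_u: "z \<in> W \<Longrightarrow> vwd (\<lambda>y. cvec (u y)) (ph z) (ccnj (ph z)) z"
  unfolding ph_def by (rule vwd_cvec[OF diff_u])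

lemma D1: "z \<in> W \<Longrightarrow> dderiv v u z = rvec (cpx v *s ph z)"
  using vwd_dderiv_cvec[OF vwd_u diff_u, of z v] by (simp flip: cvec_eq_rvec)

lemma D2: "z \<in> W \<Longrightarrow> dderiv v (dderiv w u) z = rvec ((cpx v * cpx w) *s ph1 z)"
  by (rule dderiv_rvec[OF open_W _ smooth_on_differentiable[OF smooth_on_dderiv[OF smooth_u] open_W] D1 vwd_ph])

lemma D3: "z \<in> W \<Longrightarrow> dderiv v (dderiv w (dderiv x u)) z = rvec ((cpx v * (cpx w * cpx x)) *s ph2 z)"
  by (rule dderiv_rvec[OF open_W _ smooth_on_differentiable[OF smooth_on_dderiv[OF smooth_on_dderiv[OF smooth_u]] open_W] D2 vwd_ph1])

lemma ph_null:
  assumes z: "z \<in> W"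
  shows "ph z \<odot> ph z = 0"
proof -
  let ?p = "ph z \<odot> ph z" and ?c = "ccnj (ph z) \<odot> ccnj (ph z)"
  have "inner (dderiv e1 u z) (dderiv e1 u z) = inner (dderiv e2 u z) (dderiv e2 u z)" "inner (dderiv e1 u z) (dderiv e2 u z) = 0"
    using iso z by (auto simp: isothermal_def induced_metric_def)
  then have "complex_of_real (inner (dderiv e1 u z) (dderiv e1 u z)) = complex_of_real (inner (dderiv e2 u z) (dderiv e2 u z))"
    "complex_of_real (inner (dderiv e1 u z) (dderiv e2 u z)) = 0" by simp_all
  then have "4 * (?p + ?c) = 0" "\<i> * (?p - ?c) = 0"
    unfolding D1[OF z] inner_rvec cpx_simps by (simp_all add: cdot_commute[of "ccnj (ph z)" "ph z"] algebra_simps)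
  then have "?p + ?c = 0" "?p - ?c = 0" by simp_all
  then show ?thesis by algebra
qed

text \<open>\<open>A\<close> is \<open>\<alpha>(\<partial>, \<partial>)\<close>, the part of \<open>ph1 = \<partial> ph\<close> orthogonal to \<open>ph = \<partial>u\<close>; moreover
  \<open>mu = \<partial> log lam\<close>, \<open>muz = \<partial> mu\<close> and \<open>Az = \<partial> A\<close>.\<close>

definition "lam z = ph z \<odot> ccnj (ph z)"

lemma ph_ne_0: "z \<in> W \<Longrightarrow> ph z \<noteq> 0"
  using gram(1)[of z] D1[of z e1] by (auto simp: fE_def u1_def rvec_0 cpx_simps)

lemma lam: assumes "z \<in> W" shows "lam z \<noteq> 0" "Re (lam z) > 0" "cnj (lam z) = lam z" "lam z = of_real (Re (lam z))"
  using ph_ne_0[OF assms] cdot_ccnj_pos[of "ph z"] cdot_ccnj_Re[of "ph z"]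
  by (simp_all add: lam_def cdot_commute)

lemma induced_metric_eq:
  assumes z: "z \<in> W"
  shows "induced_metric u z v w = 2 * Re (lam z) * (v $ 1 * w $ 1 + v $ 2 * w $ 2)"
proof -
  have "complex_of_real (induced_metric u z v w) = lam z * (cpx v * cnj (cpx w) + cnj (cpx v) * cpx w)"
    unfolding induced_metric_def D1[OF z] inner_rvec
    using ph_null[OF z] ccnj_null[OF ph_null[OF z]]
    by (simp add: lam_def cdot_commute[of "ccnj (ph z)" "ph z"] algebra_simps)
  from arg_cong[OF this, of Re] show ?thesis
    using lam(4)[OF z] by (simp add: cpx_def)
qed

definition "mu z = (ph1 z \<odot> ccnj (ph z)) / lam z"
definition "A z = ph1 z - mu z *s ph z"
definition "kap z = A z \<odot> ccnj (A z)"
definition "muz z = (ph2 z \<odot> ccnj (ph z)) / lam z - mu z * mu z"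
definition "Az z = ph2 z - muz z *s ph z - mu z *s ph1 z"

lemma wd_lam: "z \<in> W \<Longrightarrow> wd lam (mu z * lam z) (cnj (mu z * lam z)) z"
  unfolding lam_def[abs_def]
  by (rule wd_eq[OF wd_cdot[OF vwd_ph vwd_ccnj[OF vwd_ph]]])
    (use lam(1)[of z] in \<open>simp_all add: mu_def lam_def[symmetric] cdot_commute\<close>)

lemma A_perp:
  assumes z: "z \<in> W"
  shows "A z \<odot> ph z = 0" "A z \<odot> ccnj (ph z) = 0" "ph z \<odot> A z = 0" "ccnj (ph z) \<odot> A z = 0"
    "ccnj (A z) \<odot> ph z = 0" "ccnj (A z) \<odot> ccnj (ph z) = 0" "ph z \<odot> ccnj (A z) = 0" "ccnj (ph z) \<odot> ccnj (A z) = 0"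
    "ph1 z \<odot> ph z = 0"
proof -
  have "2 * (ph1 z \<odot> ph z) = 0"
    using wd_const_on(1)[OF open_W z ph_null wd_cdot[OF vwd_ph vwd_ph]] z by (simp add: cdot_commute)
  then show p: "ph1 z \<odot> ph z = 0" by simp
  show 1: "A z \<odot> ph z = 0" using p ph_null[OF z] by (simp add: A_def)
  show 2: "A z \<odot> ccnj (ph z) = 0"
    using lam(1)[OF z] by (simp add: A_def mu_def lam_def)
  show "ph z \<odot> A z = 0" "ccnj (ph z) \<odot> A z = 0" using 1 2 by (simp_all add: cdot_commute)
  show 3: "ccnj (A z) \<odot> ph z = 0" "ccnj (A z) \<odot> ccnj (ph z) = 0" using 1 2 by (metis ccnj_simps(6) cnj_cdot complex_cnj_zero)+
  show "ph z \<odot> ccnj (A z) = 0" "ccnj (ph z) \<odot> ccnj (A z) = 0" using 3 by (simp_all add: cdot_commute)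
qed

lemma ph1_eq: "ph1 z = A z + mu z *s ph z"
  by (simp add: A_def)

text \<open>The second entry is the mixed derivative of log \<open>lam\<close>, so this contains the
  Gauss equation of a minimal surface.\<close>

lemma wd_mu:
  assumes z: "z \<in> W"
  shows "wd mu (muz z) (kap z / lam z) z"
proof -
  note l = lam[OF z] and p = A_perp[OF z]
  have k: "kap z = ph1 z \<odot> ccnj (ph1 z) - mu z * cnj (mu z) * lam z"
    unfolding ph1_eq kap_def using p by (simp add: lam_def)
  have m: "ph1 z \<odot> ccnj (ph z) = mu z * lam z" using l by (simp add: mu_def)
  show ?thesis
    unfolding mu_def[abs_def]
    by (rule wd_eq[OF wd_divide[OF wd_cdot[OF vwd_ph1[OF z] vwd_ccnj[OF vwd_ph[OF z]]] wd_lam[OF z] l(1)]])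
     (use l in \<open>simp_all add: k muz_def m power2_eq_square field_simps\<close>)
qed

text \<open>The second entry is tangential: this is the Codazzi equation of a minimal
  surface.\<close>

lemma vwd_A:
  assumes z: "z \<in> W"
  shows "vwd A (Az z) ((- kap z / lam z) *s ph z) z"
  unfolding A_def[abs_def]
  by (rule vwd_eq[OF vwd_diff[OF vwd_ph1[OF z] vwd_scale[OF wd_mu[OF z] vwd_ph[OF z]]]])
    (simp_all add: Az_def vec_eq_iff algebra_simps)

lemma tangent_iff: "z \<in> W \<Longrightarrow> tangent_space u z = {rvec (x *s ph z) |x. True}"
proof -
  assume z: "z \<in> W"
  have "rvec (x *s ph z) \<in> range (\<lambda>v. dderiv v u z)" for x
    by (rule range_eqI[of _ _ "rcpx x"]) (simp add: D1[OF z])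
  then show ?thesis unfolding tangent_space_alt by (auto simp: D1[OF z])
qed

text \<open>Minimality makes the mixed term \<alpha>(\<partial>, conj \<partial>) vanish, so only
  the product of the two directions appears.\<close>

lemma sff_eq:
  assumes z: "z \<in> W"
  shows "sff u v w z = rvec ((cpx v * cpx w) *s A z)"
  unfolding sff_def normal_fibre_def
proof (rule orth_proj_comp_eqI)
  have "complex_of_real (inner (rvec (x *s ph z)) (rvec (y *s A z))) = 0" for x y
    unfolding inner_rvec by (simp add: A_perp[OF z])
  then show "rvec ((cpx v * cpx w) *s A z) \<in> orthogonal_comp (tangent_space u z)"
    by (auto simp: mem_orthogonal_comp tangent_iff[OF z])
  have "dderiv v (dderiv w u) z - rvec ((cpx v * cpx w) *s A z) = rvec ((cpx v * cpx w * mu z) *s ph z)"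
    unfolding D2[OF z] rvec_diff[symmetric] ph1_eq by (simp add: vec_eq_iff algebra_simps)
  then show "dderiv v (dderiv w u) z - rvec ((cpx v * cpx w) *s A z) \<in> span (tangent_space u z)"
    by (auto simp: tangent_iff[OF z] intro!: span_base)
qed

lemma cpx_structure_eq: "z \<in> W \<Longrightarrow> cpx_structure u z v = rcpx (\<i> * cpx v)"
proof -
  assume z: "z \<in> W"
  have E: "2 * Re (lam z) > 0" using lam(2)[OF z] by simp
  have "cpx_structure u z v = vector [- v $ 2, v $ 1]"
    unfolding cpx_structure_def cpx_structure_unique[OF E induced_metric_eq[OF z]] by simp
  then show ?thesis by (simp add: rcpx_def cpx_def)
qed

lemma cpx_rotate:
  "z \<in> W \<Longrightarrow> cpx (cos \<psi> *\<^sub>R X + sin \<psi> *\<^sub>R cpx_structure u z X) = cis \<psi> * cpx X"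
  by (simp add: cpx_simps cpx_structure_eq complex_eq_iff)

lemma unit_X:
  assumes z: "z \<in> W" and X: "induced_metric u z X X = 1"
  shows "norm (cpx X) > 0"
proof -
  have "X \<noteq> 0" using X by (auto simp: induced_metric_eq[OF z])
  then have "cpx X \<noteq> cpx 0" unfolding cpx_inj .
  then show ?thesis by (simp add: cpx_def flip: zero_complex.code)
qed

lemma unit_ex:
  assumes z: "z \<in> W"
  shows "\<exists>X. induced_metric u z X X = 1"
proof -
  have E: "2 * Re (lam z) > 0" using lam(2)[OF z] by simp
  define x where "x = 1 / sqrt (2 * Re (lam z))"
  have "2 * Re (lam z) * (x * x) = 1" using E by (simp add: x_def)
  then show ?thesis by (intro exI[of _ "rcpx (of_real x)"]) (simp add: induced_metric_eq[OF z] rcpx_def)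
qed

lemma curvature_ellipse_1:
  assumes z: "z \<in> W"
  shows "curvature_ellipse u 1 z X = {0 + rvec (w *s A z) |w. norm w = norm (cpx X) ^ 2}"
proof -
  have "curvature_ellipse u 1 z X = {rvec ((cis \<psi> * cpx X)^2 *s A z) |\<psi>. \<psi> \<in> {0..<2*pi}}"
    unfolding curvature_ellipse_def one_add_one numeral_2_eq_2 replicate.simps higher_sff_2 sff_eq[OF z] cpx_rotate[OF z]
    by (simp add: power2_eq_square)
  also have "\<dots> = {0 + rvec (w *s A z) |w. w \<in> {(cis \<psi> * cpx X)^2 |\<psi>. \<psi> \<in> {0..<2*pi}}}"
    by auto
  finally show ?thesis unfolding cis_power_range[OF pos2] by simp
qed

lemma kth_normal_space_1_eq:
  assumes z: "z \<in> W"
  shows "kth_normal_space u 1 z = {rvec (x *s A z) |x. True}"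
proof -
  have "{sff u X Y z |X Y. True} = {rvec (x *s A z) |x. True}"
  proof (intro equalityI subsetI)
    fix v assume "v \<in> {rvec (x *s A z) |x. True}"
    then obtain x where "v = rvec (x *s A z)" by blast
    then have "v = sff u (rcpx x) e1 z" by (simp add: sff_eq[OF z] cpx_simps)
    then show "v \<in> {sff u X Y z |X Y. True}" by blast
  qed (auto simp: sff_eq[OF z])
  then show ?thesis unfolding kth_normal_space_1 using span_eq_iff[THEN iffD2, OF subspace_rvec] by (simp only:)
qed

lemma isotropic_1_iff:
  assumes z: "z \<in> W"
  shows "(dim (kth_normal_space u 1 z) = 2 \<and>
        (\<forall>X. induced_metric u z X X = 1 \<longrightarrow> is_circle (curvature_ellipse u 1 z X)))
     \<longleftrightarrow> A z \<odot> A z = 0 \<and> A z \<noteq> 0"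
proof -
  have "is_circle (curvature_ellipse u 1 z X) \<longleftrightarrow> A z \<odot> A z = 0 \<and> A z \<noteq> 0" if "induced_metric u z X X = 1" for X
    unfolding curvature_ellipse_1[OF z] by (rule is_circle_iff) (use unit_X[OF z that] in simp)
  then show ?thesis
    using unit_ex[OF z] dim_rvec[of "A z"] kth_normal_space_1_eq[OF z] by auto
qed

end

lemma rvec_null_metric:
  fixes g :: "real^2 \<Rightarrow> real^'n"
  assumes "V \<odot> V = 0" "\<And>v. dderiv v g z = rvec (cpx v *s V)"
  shows "induced_metric g z v w = 2 * Re (V \<odot> ccnj V) * (v $ 1 * w $ 1 + v $ 2 * w $ 2)"
proof -
  have "complex_of_real (induced_metric g z v w) = (V \<odot> ccnj V) * (cpx v * cnj (cpx w) + cnj (cpx v) * cpx w)"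
    unfolding induced_metric_def assms(2) inner_rvec
    using assms(1) ccnj_null[OF assms(1)] by (simp add: cdot_commute[of "ccnj V" V] algebra_simps)
  from arg_cong[OF this, of Re] show ?thesis
    using cdot_ccnj_pos(2)[of V] by (simp add: cpx_def)
qed

section \<open>The third fundamental form of a 1-isotropic surface\<close>

locale iso1_patch = iso_patch W u for W and u :: "real^2 \<Rightarrow> real^'n" +
  assumes A_null: "z \<in> W \<Longrightarrow> A z \<odot> A z = 0" and A_ne_0: "z \<in> W \<Longrightarrow> A z \<noteq> 0"
begin

lemma kap: assumes "z \<in> W" shows "kap z \<noteq> 0" "Re (kap z) > 0" "cnj (kap z) = kap z" "kap z = of_real (Re (kap z))"
  using A_ne_0[OF assms] cdot_ccnj_pos[of "A z"] cdot_ccnj_Re[of "A z"]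
  by (simp_all add: kap_def cdot_commute)

text \<open>Each relation is the \<partial>-derivative of an orthogonality relation of
  \<open>A\<close>; the third one is where 1-isotropy enters.\<close>

lemma Az_perp:
  assumes z: "z \<in> W"
  shows "Az z \<odot> ph z = 0" "Az z \<odot> ccnj (ph z) = 0" "Az z \<odot> A z = 0"
proof -
  note p = A_perp[OF z] and n = A_null[OF z] and n' = ph_null[OF z]
  show "Az z \<odot> ph z = 0"
    using wd_const_on(1)[OF open_W z A_perp(1) wd_cdot[OF vwd_A[OF z] vwd_ph[OF z]]] p n
    by (simp add: ph1_eq)
  show "Az z \<odot> ccnj (ph z) = 0"
    using wd_const_on(1)[OF open_W z A_perp(2) wd_cdot[OF vwd_A[OF z] vwd_ccnj[OF vwd_ph[OF z]]]]
    by simp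
  show "Az z \<odot> A z = 0"
    using wd_const_on(1)[OF open_W z A_null wd_cdot[OF vwd_A[OF z] vwd_A[OF z]]]
    by (simp add: cdot_commute[of "A z" "Az z"])
qed

text \<open>Under 1-isotropy, \<open>\<partial> A\<close> has no component along \<open>ccnj A\<close>, so \<open>B\<close> is
  \<open>\<alpha>\<^sup>3(\<partial>, \<partial>, \<partial>)\<close>.\<close>

definition "cA z = (Az z \<odot> ccnj (A z)) / kap z"
definition "B z = Az z - cA z *s A z"

lemma Az_eq: "Az z = B z + cA z *s A z"
  by (simp add: B_def)

lemma B_perp:
  assumes z: "z \<in> W"
  shows "B z \<odot> ph z = 0" "B z \<odot> ccnj (ph z) = 0" "B z \<odot> A z = 0" "B z \<odot> ccnj (A z) = 0"
    "ccnj (B z) \<odot> ph z = 0" "ccnj (B z) \<odot> ccnj (ph z) = 0" "ccnj (B z) \<odot> A z = 0" "ccnj (B z) \<odot> ccnj (A z) = 0"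
    "ph z \<odot> B z = 0" "ccnj (ph z) \<odot> B z = 0" "A z \<odot> B z = 0" "ccnj (A z) \<odot> B z = 0"
    "ph z \<odot> ccnj (B z) = 0" "ccnj (ph z) \<odot> ccnj (B z) = 0" "A z \<odot> ccnj (B z) = 0" "ccnj (A z) \<odot> ccnj (B z) = 0"
proof -
  show 1: "B z \<odot> ph z = 0" "B z \<odot> ccnj (ph z) = 0" "B z \<odot> A z = 0" "B z \<odot> ccnj (A z) = 0"
    using Az_perp[OF z] A_perp[OF z] A_null[OF z] kap[OF z] by (simp_all add: B_def cA_def kap_def[symmetric])
  show 2: "ccnj (B z) \<odot> ph z = 0" "ccnj (B z) \<odot> ccnj (ph z) = 0" "ccnj (B z) \<odot> A z = 0" "ccnj (B z) \<odot> ccnj (A z) = 0"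
    using 1[THEN ccnj_null] by simp_all
  show "ph z \<odot> B z = 0" "ccnj (ph z) \<odot> B z = 0" "A z \<odot> B z = 0" "ccnj (A z) \<odot> B z = 0"
    "ph z \<odot> ccnj (B z) = 0" "ccnj (ph z) \<odot> ccnj (B z) = 0" "A z \<odot> ccnj (B z) = 0" "ccnj (A z) \<odot> ccnj (B z) = 0"
    using 1 2 by (simp_all add: cdot_commute)
qed

text \<open>Lets \<open>Az\<close>, whose continuity is direct from its formula, stand in for
  \<open>B\<close> when the open set of non-null \<open>B\<close> is formed.\<close>

lemma B_square: "z \<in> W \<Longrightarrow> B z \<odot> B z = Az z \<odot> Az z"
  unfolding Az_eq using B_perp[of z] A_null[of z] by simp

lemma higher_sff_eq:
  assumes z: "z \<in> W"
  shows "higher_sff u [x, y, w] z = rvec ((cpx x * (cpx y * cpx w)) *s B z)"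
proof -
  have t1: "rvec (c *s ph z) \<in> osculating u z" for c
    by (auto simp: osculating_def tangent_iff[OF z])
  have t2: "rvec (c *s ph1 z) \<in> osculating u z" for c
  proof -
    have "rvec (c *s ph1 z) = dderiv (rcpx c) (dderiv e1 u) z" by (simp add: D2[OF z] cpx_simps)
    then show ?thesis unfolding osculating_def by blast
  qed
  have osc: "v \<in> osculating u z \<Longrightarrow> (\<exists>c. v = rvec (c *s ph z)) \<or> (\<exists>c. v = rvec (c *s ph1 z))" for v
    by (auto simp: osculating_def tangent_iff[OF z] D2[OF z])
  have "complex_of_real (inner (rvec (c *s ph z)) (rvec (d *s B z))) = 0"
    "complex_of_real (inner (rvec (c *s ph1 z)) (rvec (d *s B z))) = 0" for c d
    unfolding inner_rvec ph1_eq by (simp_all add: B_perp[OF z])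
  then have perp: "rvec (d *s B z) \<in> orthogonal_comp (osculating u z)" for d
    unfolding mem_orthogonal_comp using osc by (auto simp del: of_real_eq_0_iff dest!: of_real_eq_0_iff[THEN iffD1] osc)
  let ?t = "cpx x * (cpx y * cpx w)"
  \<comment> \<open>The coefficients come from ph2 = B + cA A + muz ph + mu ph1 after replacing A by
    ph1 - mu ph.\<close>
  have "dderiv x (dderiv y (dderiv w u)) z - rvec (?t *s B z)
     = rvec ((?t * (muz z - cA z * mu z)) *s ph z) + rvec ((?t * (mu z + cA z)) *s ph1 z)"
    unfolding D3[OF z] rvec_add[symmetric] rvec_diff[symmetric] B_def Az_def A_def
    by (rule arg_cong[of _ _ rvec]) (simp add: vec_eq_iff algebra_simps)
  moreover have "\<dots> \<in> span (osculating u z)"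
    by (intro span_add span_base t1 t2)
  ultimately show ?thesis
    unfolding higher_sff_3[OF open_W z smooth_u inj_u, simplified]
    by (intro orth_proj_comp_eqI perp) simp
qed

lemma kth_normal_space_2_eq:
  assumes z: "z \<in> W"
  shows "kth_normal_space u 2 z = {rvec (x *s B z) |x. True}"
proof -
  have "{higher_sff u [X, Y, Z] z |X Y Z. True} = {rvec (x *s B z) |x. True}"
  proof (intro equalityI subsetI)
    fix v assume "v \<in> {rvec (x *s B z) |x. True}"
    then obtain x where "v = rvec (x *s B z)" by blast
    then have "v = higher_sff u [rcpx x, e1, e1] z" by (simp add: higher_sff_eq[OF z] cpx_simps)
    then show "v \<in> {higher_sff u [X, Y, Z] z |X Y Z. True}" by blast
  qed (auto simp: higher_sff_eq[OF z])
  then show ?thesis unfolding kth_normal_space_2 using span_eq_iff[THEN iffD2, OF subspace_rvec] by (simp only:)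
qed

lemma curvature_ellipse_2:
  assumes z: "z \<in> W"
  shows "curvature_ellipse u 2 z X = {0 + rvec (w *s B z) |w. norm w = norm (cpx X) ^ 3}"
proof -
  have r: "replicate (2 + 1) Y = [Y, Y, Y]" for Y :: "real^2" by (simp add: numeral_2_eq_2)
  have "curvature_ellipse u 2 z X = {rvec ((cis \<psi> * cpx X)^3 *s B z) |\<psi>. \<psi> \<in> {0..<2*pi}}"
    unfolding curvature_ellipse_def r higher_sff_eq[OF z] cpx_rotate[OF z]
    by (simp add: power3_eq_cube mult.assoc)
  also have "\<dots> = {0 + rvec (w *s B z) |w. w \<in> {(cis \<psi> * cpx X)^3 |\<psi>. \<psi> \<in> {0..<2*pi}}}"
    by auto
  finally show ?thesis unfolding cis_power_range[OF zero_less_numeral] by simp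
qed

lemma isotropic_2_iff:
  assumes z: "z \<in> W"
  shows "(dim (kth_normal_space u 2 z) = 2 \<and>
        (\<forall>X. induced_metric u z X X = 1 \<longrightarrow> is_circle (curvature_ellipse u 2 z X)))
     \<longleftrightarrow> B z \<odot> B z = 0 \<and> B z \<noteq> 0"
proof -
  have "is_circle (curvature_ellipse u 2 z X) \<longleftrightarrow> B z \<odot> B z = 0 \<and> B z \<noteq> 0" if "induced_metric u z X X = 1" for X
    unfolding curvature_ellipse_2[OF z] by (rule is_circle_iff) (use unit_X[OF z that] in simp)
  then show ?thesis
    using unit_ex[OF z] dim_rvec[of "B z"] kth_normal_space_2_eq[OF z] by auto
qed

text \<open>Once \<open>B\<close> is null only the dimensions 0 and 2 are possible, so constancy of
  the dimension becomes an alternative for \<open>B\<close>.\<close>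

lemma dim_kth_normal_space_2:
  assumes "z \<in> W" "B z \<odot> B z = 0"
  shows "dim (kth_normal_space u 2 z) = (if B z = 0 then 0 else 2)"
proof (cases "B z = 0")
  case True
  then have "kth_normal_space u 2 z = {0}" by (auto simp: kth_normal_space_2_eq[OF assms(1)] rvec_0)
  then show ?thesis using True by simp
next
  case False
  then show ?thesis using dim_rvec[OF assms(2)] by (simp add: kth_normal_space_2_eq[OF assms(1)])
qed

lemma vwd_A': "z \<in> W \<Longrightarrow> vwd A (B z + cA z *s A z) ((- kap z / lam z) *s ph z) z"
  using vwd_A by (simp add: Az_eq)

text \<open>Shows that \<open>cA\<close> is \<partial> log \<open>kap\<close>, as \<open>mu\<close>
  is \<partial> log \<open>lam\<close>.\<close>

lemma wd_kap:
  assumes z: "z \<in> W"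
  shows "wd kap (cA z * kap z) (cnj (cA z * kap z)) z"
  unfolding kap_def[abs_def]
  by (rule wd_eq[OF wd_cdot[OF vwd_A'[OF z] vwd_ccnj[OF vwd_A'[OF z]]]])
    (simp_all add: B_perp[OF z] A_perp[OF z] kap_def[symmetric] kap(3)[OF z])

end

section \<open>The pedal surface\<close>

lemma orth_proj_affine:
  fixes p q y :: "'a::euclidean_space"
  assumes T: "subspace T" and y: "y - p \<in> T" and perp: "\<And>t. t \<in> T \<Longrightarrow> inner (q - y) t = 0"
  shows "orth_proj ((+) p ` T) q = y"
  unfolding orth_proj_def
proof (rule the_equality)
  have mem: "x \<in> (+) p ` T \<longleftrightarrow> x - p \<in> T" for x
    by (auto simp: image_iff) (metis add.commute diff_add_cancel)
  have d: "x - x' \<in> T" if "x \<in> (+) p ` T" "x' \<in> (+) p ` T" for x x'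
    using subspace_diff[OF T, of "x - p" "x' - p"] that mem by simp
  show "y \<in> (+) p ` T \<and> (\<forall>s\<in>(+) p ` T. inner (q - y) (s - y) = 0)"
    using y mem perp d by blast
  fix x assume x: "x \<in> (+) p ` T \<and> (\<forall>s\<in>(+) p ` T. inner (q - x) (s - x) = 0)"
  have "inner (q - x) (y - x) = 0" using x y mem by blast
  moreover have "y \<in> (+) p ` T" using y mem by blast
  then have "inner (q - y) (y - x) = 0" using perp[OF d[of y x]] x by blast
  ultimately have "inner (y - x) (y - x) = 0" by (simp add: inner_diff_left)
  then show "x = y" by simp
qed

locale pedal_patch = iso1_patch W u for W and u :: "real^2 \<Rightarrow> real^'n" +
  fixes q :: "real^'n"
begin

text \<open>The tangential part of the position vector \<open>Y\<close> is \<open>rvec (a *s ph)\<close>.\<close>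

definition "Y z = cvec (u z - q)"
definition "a z = (Y z \<odot> ccnj (ph z)) / lam z"
definition "be z = Y z \<odot> A z"
text \<open>Normalised so that the conjugate of \<open>gam\<close> is the conjugate derivative of
  \<open>a\<close>, see \<open>wd_a\<close>.\<close>

definition "gam z = be z / lam z"

lemma ccnj_Y [simp]: "ccnj (Y z) = Y z"
  by (simp add: Y_def)

lemma vwd_Y: "z \<in> W \<Longrightarrow> vwd Y (ph z) (ccnj (ph z)) z"
  unfolding Y_def[abs_def] cvec_simps
  by (rule vwd_eq[OF vwd_diff[OF vwd_u vwd_const]]) simp_all

lemma Y_dot:
  assumes z: "z \<in> W"
  shows "Y z \<odot> ccnj (ph z) = a z * lam z" "Y z \<odot> ph z = cnj (a z) * lam z"
    "Y z \<odot> A z = gam z * lam z" "Y z \<odot> ccnj (A z) = cnj (gam z) * lam z"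
  using lam[OF z] by (simp_all add: a_def gam_def be_def)

lemma wd_a:
  assumes z: "z \<in> W"
  shows "wd a (1 - a z * mu z) (cnj (gam z)) z"
proof -
  note l = lam[OF z]
  have "ccnj (ph1 z) = ccnj (A z) + cnj (mu z) *s ccnj (ph z)" by (simp add: ph1_eq)
  then have "Y z \<odot> ccnj (ph1 z) = cnj (gam z) * lam z + cnj (mu z) * a z * lam z"
    by (simp add: Y_dot[OF z])
  then show ?thesis
    unfolding a_def[abs_def]
    by (intro wd_eq[OF wd_divide[OF wd_cdot[OF vwd_Y[OF z] vwd_ccnj[OF vwd_ph[OF z]]] wd_lam[OF z] l(1)]])
      (use l ccnj_null[OF ph_null[OF z]] in \<open>simp_all add: Y_dot[OF z] lam_def[symmetric] power2_eq_square field_simps\<close>)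
qed

definition "gamz z = (Y z \<odot> Az z) / lam z - gam z * mu z"
definition "gamzb z = - (kap z * cnj (a z)) / lam z - gam z * cnj (mu z)"

lemma wd_gam:
  assumes z: "z \<in> W"
  shows "wd gam (gamz z) (gamzb z) z"
proof -
  note l = lam[OF z]
  have be: "wd be (Y z \<odot> Az z) (- (kap z * cnj (a z))) z"
    unfolding be_def[abs_def]
    by (rule wd_eq[OF wd_cdot[OF vwd_Y[OF z] vwd_A[OF z]]])
      (use l in \<open>simp_all add: A_perp[OF z] Y_dot[OF z]\<close>)
  have b: "be z = gam z * lam z" using l by (simp add: gam_def)
  show ?thesis
    unfolding gam_def[abs_def]
    by (rule wd_eq[OF wd_divide[OF be wd_lam[OF z] l(1)]])
      (use l in \<open>simp_all add: b gamz_def gamzb_def power2_eq_square field_simps\<close>)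
qed

lemma pedal_point:
  assumes z: "z \<in> W"
  shows "orth_proj ((+) (u z) ` tangent_space u z) q = u z - rvec (a z *s ph z)"
proof (rule orth_proj_affine)
  show "subspace (tangent_space u z)" unfolding tangent_iff[OF z] by (rule subspace_rvec)
  have "rvec (- a z *s ph z) = - rvec (a z *s ph z)"
    using rvec_scaleR[of "-1" "a z *s ph z"] by simp
  then show "u z - rvec (a z *s ph z) - u z \<in> tangent_space u z"
    unfolding tangent_iff[OF z] by (auto intro!: exI[of _ "- a z"])
  fix t assume "t \<in> tangent_space u z"
  then obtain x where t: "t = rvec (x *s ph z)" unfolding tangent_iff[OF z] by blast
  have "cvec (q - (u z - rvec (a z *s ph z))) = - Y z + a z *s ph z + cnj (a z) *s ccnj (ph z)"
    by (simp add: cvec_simps cvec_rvec Y_def)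
  note e = this
  have "complex_of_real (inner (q - (u z - rvec (a z *s ph z))) t) = 0"
    unfolding t cvec_inner[symmetric] cvec_rvec e
    using ph_null[OF z] ccnj_null[OF ph_null[OF z]]
    by (simp add: Y_dot[OF z] cdot_commute[of "ccnj (ph z)" "ph z"] lam_def[symmetric] algebra_simps)
  then show "inner (q - (u z - rvec (a z *s ph z))) t = 0" by simp
qed

text \<open>For the pedal surface \<open>g\<close>: \<open>g1 = \<partial>g\<close>, \<open>g2 = \<partial>\<partial>g\<close>, \<open>h = \<partial>\<partial>\<^sub>b g\<close>, and below
  \<open>Gh = \<alpha>\<^sub>g(\<partial>, \<partial>)\<close>, \<open>hz = \<partial>h\<close>.\<close>

definition "g1 z = - (a z *s A z) - gam z *s ccnj (ph z)"
definition "g2 z = - ((1 - a z * mu z) *s A z) - a z *s Az z - gamz z *s ccnj (ph z)"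
definition "h z = (kap z / lam z) *s (a z *s ph z + cnj (a z) *s ccnj (ph z)) - cnj (gam z) *s A z - gam z *s ccnj (A z)"
definition "Lam z = g1 z \<odot> ccnj (g1 z)"

lemma ccnj_h [simp]: "z \<in> W \<Longrightarrow> ccnj (h z) = h z"
  using lam[of z] kap[of z] by (simp add: h_def vec_eq_iff algebra_simps)

lemma vwd_g1:
  assumes z: "z \<in> W"
  shows "vwd g1 (g2 z) (h z) z"
  unfolding g1_def[abs_def]
  by (rule vwd_eq[OF vwd_diff[OF vwd_minus[OF vwd_scale[OF wd_a[OF z] vwd_A[OF z]]]
          vwd_scale[OF wd_gam[OF z] vwd_ccnj[OF vwd_ph[OF z]]]]])
    (simp_all add: g2_def h_def gamzb_def ph1_eq vec_eq_iff ring_distribs divide_inverse)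

text \<open>\<open>g1\<close> and \<open>g2\<close> lie in the span of \<open>A\<close>,
  \<open>ccnj ph\<close> and \<open>B\<close>, where every product except that of \<open>B\<close>
  with itself vanishes. In the products with \<open>h\<close> the two remaining contributions cancel
  because of the factor \<open>kap\<close> / \<open>lam\<close>.\<close>

lemma g_dot:
  assumes z: "z \<in> W"
  shows "g1 z \<odot> g1 z = 0" "g2 z \<odot> g1 z = 0" "g2 z \<odot> g2 z = (a z)\<^sup>2 * (B z \<odot> B z)" "h z \<odot> g1 z = 0" "h z \<odot> ccnj (g1 z) = 0"
    "Lam z = a z * cnj (a z) * kap z + gam z * cnj (gam z) * lam z"
    "g2 z \<odot> ccnj (g1 z) = (1 - a z * mu z + a z * cA z) * cnj (a z) * kap z + gamz z * cnj (gam z) * lam z"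
proof -
  note s = A_perp[OF z] B_perp[OF z] ph_null[OF z] ccnj_null[OF ph_null[OF z]] A_null[OF z] ccnj_null[OF A_null[OF z]]
    cdot_commute[of "ccnj (ph z)" "ph z"] cdot_commute[of "ccnj (A z)" "A z"] lam_def[symmetric] kap_def[symmetric]
  show "g1 z \<odot> g1 z = 0" "g2 z \<odot> g1 z = 0" "g2 z \<odot> g2 z = (a z)\<^sup>2 * (B z \<odot> B z)"
    by (simp_all add: g1_def g2_def Az_eq s power2_eq_square)
  show "h z \<odot> g1 z = 0" "h z \<odot> ccnj (g1 z) = 0"
    using lam[OF z] by (simp_all add: g1_def h_def s algebra_simps)
  show "Lam z = a z * cnj (a z) * kap z + gam z * cnj (gam z) * lam z"
    by (simp add: Lam_def g1_def s)
  show "g2 z \<odot> ccnj (g1 z) = (1 - a z * mu z + a z * cA z) * cnj (a z) * kap z + gamz z * cnj (gam z) * lam z"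
    by (simp add: g1_def g2_def Az_eq s algebra_simps)
qed

lemma g2_B: "z \<in> W \<Longrightarrow> g2 z \<odot> ccnj (B z) = - a z * (B z \<odot> ccnj (B z))"
  by (simp add: g2_def Az_eq B_perp)

lemma g2_A: "z \<in> W \<Longrightarrow> g2 z \<odot> ccnj (A z) = - (1 - a z * mu z + a z * cA z) * kap z"
  by (simp add: g2_def Az_eq B_perp A_perp kap_def[symmetric] algebra_simps)

text \<open>Equals \<partial> log \<open>Lam\<close>, because \<open>h\<close> is real and
  orthogonal to \<open>g1\<close>; thus \<open>tau\<close> and \<open>Gh\<close> play for
  \<open>g\<close> the roles of \<open>mu\<close> and \<open>A\<close>.\<close>

definition "tau z = (g2 z \<odot> ccnj (g1 z)) / Lam z"
definition "Gh z = g2 z - tau z *s g1 z"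

end

locale pedal_surface_patch = pedal_patch W u q for W and u :: "real^2 \<Rightarrow> real^'n" and q +
  fixes g :: "real^2 \<Rightarrow> real^'n"
  assumes g: "z \<in> W \<Longrightarrow> g z = orth_proj ((+) (u z) ` tangent_space u z) q"
    and smooth_g: "smooth_on W g" and inj_g: "z \<in> W \<Longrightarrow> inj (frechet_derivative g (at z))"
begin

lemma diff_g: "z \<in> W \<Longrightarrow> g differentiable (at z)"
  by (rule smooth_on_differentiable[OF smooth_g open_W])

lemma vwd_g:
  assumes z: "z \<in> W"
  shows "vwd (\<lambda>y. cvec (g y)) (g1 z) (ccnj (g1 z)) z"
proof -
  have 1: "vwd (\<lambda>y. cvec (u y) - a y *s ph y - cnj (a y) *s ccnj (ph y)) (g1 z) (ccnj (g1 z)) z"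
    by (rule vwd_eq[OF vwd_diff[OF vwd_diff[OF vwd_u[OF z] vwd_scale[OF wd_a[OF z] vwd_ph[OF z]]]
         vwd_scale[OF wd_cnj[OF wd_a[OF z]] vwd_ccnj[OF vwd_ph[OF z]]]]])
      (simp_all add: g1_def ph1_eq vec_eq_iff algebra_simps)
  have 2: "cvec (g y) = cvec (u y) - a y *s ph y - cnj (a y) *s ccnj (ph y)" if "y \<in> W" for y
    unfolding g[OF that] pedal_point[OF that] by (simp add: cvec_simps cvec_rvec)
  show ?thesis by (subst vwd_cong_open[OF open_W z 2]) (assumption, rule 1)
qed

lemma Dg1: "z \<in> W \<Longrightarrow> dderiv v g z = rvec (cpx v *s g1 z)"
  using vwd_dderiv_cvec[OF vwd_g diff_g, of z v] by (simp flip: cvec_eq_rvec)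

text \<open>In contrast to \<open>D2\<close> a term with the mixed derivative \<open>h\<close>
  survives. As \<open>h\<close> is real, taking \<open>rvec\<close> of it is symmetric in the two
  directions.\<close>

lemma Dg2:
  assumes z: "z \<in> W"
  shows "dderiv v (dderiv w g) z = rvec ((cpx v * cpx w) *s g2 z + (cpx v * cnj (cpx w)) *s h z)"
proof -
  have 1: "vwd (\<lambda>y. cpx w *s g1 y + cnj (cpx w) *s ccnj (g1 y))
     (cpx w *s g2 z + cnj (cpx w) *s h z) (cpx w *s h z + cnj (cpx w) *s ccnj (g2 z)) z"
    by (rule vwd_eq[OF vwd_add[OF vwd_scale[OF wd_const vwd_g1[OF z]] vwd_scale[OF wd_const vwd_ccnj[OF vwd_g1[OF z]]]]])
      (simp_all add: z)
  have 2: "cvec (dderiv w g y) = cpx w *s g1 y + cnj (cpx w) *s ccnj (g1 y)" if "y \<in> W" for y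
    by (simp add: Dg1[OF that] cvec_rvec)
  have "vwd (\<lambda>y. cvec (dderiv w g y))
     (cpx w *s g2 z + cnj (cpx w) *s h z) (cpx w *s h z + cnj (cpx w) *s ccnj (g2 z)) z"
    by (subst vwd_cong_open[OF open_W z 2]) (assumption, rule 1)
  from vwd_dderiv_cvec[OF this smooth_on_differentiable[OF smooth_on_dderiv[OF smooth_g] open_W z], of v]
  have "cvec (dderiv v (dderiv w g) z) = ((cpx v * cpx w) *s g2 z + (cpx v * cnj (cpx w)) *s h z)
     + ccnj ((cpx v * cpx w) *s g2 z + (cpx v * cnj (cpx w)) *s h z)"
    using z by (simp add: vec_eq_iff algebra_simps)
  then show ?thesis unfolding cvec_eq_rvec .
qed

lemma g1_ne_0: "z \<in> W \<Longrightarrow> g1 z \<noteq> 0"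
  using gram_det_pos(1)[OF diff_g inj_g, of z] by (auto simp: Dg1 rvec_0)

lemma Lam: assumes "z \<in> W" shows "Lam z \<noteq> 0" "Re (Lam z) > 0" "cnj (Lam z) = Lam z" "Lam z = of_real (Re (Lam z))"
  using g1_ne_0[OF assms] cdot_ccnj_pos[of "g1 z"] cdot_ccnj_Re[of "g1 z"]
  by (simp_all add: Lam_def cdot_commute)

lemma induced_metric_g:
  "z \<in> W \<Longrightarrow> induced_metric g z v w = 2 * Re (Lam z) * (v $ 1 * w $ 1 + v $ 2 * w $ 2)"
  unfolding Lam_def by (rule rvec_null_metric) (simp_all add: g_dot Dg1)

lemma Gh_dot:
  assumes z: "z \<in> W"
  shows "Gh z \<odot> g1 z = 0" "Gh z \<odot> ccnj (g1 z) = 0" "Gh z \<odot> Gh z = (a z)\<^sup>2 * (B z \<odot> B z)"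
proof -
  note s = g_dot[OF z]
  show "Gh z \<odot> g1 z = 0" by (simp add: Gh_def s)
  show "Gh z \<odot> ccnj (g1 z) = 0" using Lam[OF z] by (simp add: Gh_def tau_def Lam_def)
  show "Gh z \<odot> Gh z = (a z)\<^sup>2 * (B z \<odot> B z)"
    by (simp add: Gh_def s(1-3) cdot_commute[of "g1 z" "g2 z"])
qed

lemma tangent_g: "z \<in> W \<Longrightarrow> tangent_space g z = {rvec (x *s g1 z) |x. True}"
proof -
  assume z: "z \<in> W"
  have "rvec (x *s g1 z) \<in> range (\<lambda>v. dderiv v g z)" for x
    by (rule range_eqI[of _ _ "rcpx x"]) (simp add: Dg1[OF z])
  then show ?thesis unfolding tangent_space_alt by (auto simp: Dg1[OF z])
qed

lemma sff_g:
  assumes z: "z \<in> W"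
  shows "sff g v w z = rvec ((cpx v * cpx w) *s Gh z + (cpx v * cnj (cpx w)) *s h z)"
  unfolding sff_def normal_fibre_def
proof (rule orth_proj_comp_eqI)
  note s = Gh_dot(1,2)[OF z] Gh_dot(1,2)[OF z, THEN ccnj_null] g_dot(4,5)[OF z]
  have "complex_of_real (inner (rvec (x *s g1 z)) (rvec (y *s Gh z + r *s h z))) = 0" for x y r
    unfolding inner_rvec cdot_commute[of "x *s g1 z + _"] using s z by simp
  then show "rvec ((cpx v * cpx w) *s Gh z + (cpx v * cnj (cpx w)) *s h z) \<in> orthogonal_comp (tangent_space g z)"
    by (auto simp: mem_orthogonal_comp tangent_g[OF z])
  have "dderiv v (dderiv w g) z - rvec ((cpx v * cpx w) *s Gh z + (cpx v * cnj (cpx w)) *s h z) = rvec ((cpx v * cpx w * tau z) *s g1 z)"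
    unfolding Dg2[OF z] rvec_diff[symmetric] Gh_def by (rule arg_cong[of _ _ rvec]) (simp add: vec_eq_iff algebra_simps)
  then show "dderiv v (dderiv w g) z - rvec ((cpx v * cpx w) *s Gh z + (cpx v * cnj (cpx w)) *s h z) \<in> span (tangent_space g z)"
    by (auto simp: tangent_g[OF z] intro!: span_base)
qed

text \<open>For unit vectors |X|^2 is a constant r. The \<open>h\<close> term is then the fixed
  centre and the square of the direction runs through the circle of radius r, so only
  \<open>Gh\<close> decides.\<close>

lemma superconformal_iff:
  assumes z: "z \<in> W"
  shows "is_circle {sff g X X z |X. induced_metric g z X X = 1} \<longleftrightarrow> Gh z \<odot> Gh z = 0 \<and> Gh z \<noteq> 0"
proof -
  define r where "r = 1 / (2 * Re (Lam z))"
  have r: "r > 0" using Lam(2)[OF z] by (simp add: r_def)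
  have n: "induced_metric g z X X = 1 \<longleftrightarrow> norm (cpx X) ^ 2 = r" for X
    unfolding induced_metric_g[OF z] cmod_power2 using Lam(2)[OF z]
    by (auto simp: cpx_def r_def power2_eq_square field_simps)
  have sX: "sff g X X z = rvec (of_real (norm (cpx X) ^ 2) *s h z) + rvec ((cpx X)^2 *s Gh z)" for X
    unfolding sff_g[OF z] complex_norm_square rvec_add[symmetric] by (simp add: power2_eq_square add.commute)
  have "{sff g X X z |X. induced_metric g z X X = 1} = {rvec (of_real r *s h z) + rvec (w *s Gh z) |w. norm w = r}"
  proof (intro equalityI subsetI)
    fix s assume "s \<in> {sff g X X z |X. induced_metric g z X X = 1}"
    then obtain X where X: "s = sff g X X z" "norm (cpx X) ^ 2 = r" unfolding n by blast
    then show "s \<in> {rvec (of_real r *s h z) + rvec (w *s Gh z) |w. norm w = r}"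
      unfolding sX by (auto simp: norm_power intro!: exI[of _ "(cpx X)^2"])
  next
    fix s assume "s \<in> {rvec (of_real r *s h z) + rvec (w *s Gh z) |w. norm w = r}"
    then obtain w where w: "s = rvec (of_real r *s h z) + rvec (w *s Gh z)" "norm w = r" by blast
    have "norm (csqrt w) ^ 2 = r" using w(2) r by (simp flip: norm_power)
    then have "s = sff g (rcpx (csqrt w)) (rcpx (csqrt w)) z" "norm (cpx (rcpx (csqrt w))) ^ 2 = r"
      using r unfolding sX w by simp_all
    then show "s \<in> {sff g X X z |X. induced_metric g z X X = 1}" unfolding n by blast
  qed
  then show ?thesis using is_circle_iff[OF r] by simp
qed

end

section \<open>Higher derivatives of the pedal surface and the S-Willmore equation\<close>

lemma bounded_linear_cscale: "bounded_linear (\<lambda>x::complex^'n. c *s x)"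
  unfolding linear_conv_bounded_linear[symmetric]
  by (rule linearI) (simp_all add: vec_eq_iff algebra_simps)

lemma bounded_linear_cvec: "bounded_linear (cvec :: real^'n \<Rightarrow> complex^'n)"
  unfolding linear_conv_bounded_linear[symmetric]
  by (rule linearI) (simp_all add: cvec_def vec_eq_iff complex_eq_iff)

text \<open>Combined with the uniqueness of Wirtinger derivatives, this transfers smoothness from a
  surface to explicitly given derivative formulas.\<close>

lemma smooth_vwd:
  fixes V :: "real^2 \<Rightarrow> complex^'n"
  assumes W: "open W" and V: "smooth_on W V"
  obtains P Q where "smooth_on W P" "smooth_on W Q" "\<And>z. z \<in> W \<Longrightarrow> vwd V (P z) (Q z) z"
proof -
  let ?d1 = "dderiv (axis 1 1) V" and ?d2 = "dderiv (axis 2 1) V"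
  define P where "P z = (1/2) *s (?d1 z - \<i> *s ?d2 z)" for z
  define Q where "Q z = (1/2) *s (?d1 z - (- \<i>) *s ?d2 z)" for z
  have "smooth_on W P" "smooth_on W Q"
    unfolding P_def[abs_def] Q_def[abs_def]
    by (intro smooth_on_linear[OF W bounded_linear_cscale] smooth_on_diff[OF W] smooth_on_dderiv V)+
  moreover have "vwd V (P z) (Q z) z" if z: "z \<in> W" for z
    unfolding vwd_def
  proof
    fix i
    have hd: "((\<lambda>y. V y $ i) has_derivative (\<lambda>v. dderiv v V z $ i)) (at z)"
      by (rule bounded_linear.has_derivative[OF bounded_linear_vec_nth smooth_on_has_derivative[OF V W z]])
    then have "(\<lambda>y. V y $ i) differentiable (at z)" by (auto simp: differentiable_def)
    from wd_of_differentiable[OF this] show "wd (\<lambda>y. V y $ i) (P z $ i) (Q z $ i) z"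
      by (rule wd_eq) (simp_all add: dderiv_eq[OF hd] P_def Q_def)
  qed
  ultimately show ?thesis using that by blast
qed

lemma has_derivative_rvec:
  fixes V :: "real^2 \<Rightarrow> complex^'n"
  assumes "vwd V P Q z"
  shows "((\<lambda>y. rvec (V y)) has_derivative (\<lambda>v. rvec (cpx v *s P + cnj (cpx v) *s Q))) (at z)"
proof -
  have r: "rvec x = (\<Sum>i\<in>UNIV. (2 * Re (x $ i)) *\<^sub>R axis i 1)" for x :: "complex^'n"
    by (simp add: rvec_def vec_eq_iff axis_def if_distrib cong: if_cong)
  have "((\<lambda>y. 2 * Re (V y $ i)) has_derivative (\<lambda>v. 2 * Re (P $ i * cpx v + Q $ i * cnj (cpx v)))) (at z)" for i
    using assms unfolding vwd_def wd_def
    by (intro has_derivative_mult_right bounded_linear.has_derivative[OF bounded_linear_Re]) blast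
  then have "((\<lambda>y. \<Sum>i\<in>UNIV. (2 * Re (V y $ i)) *\<^sub>R axis i 1) has_derivative
     (\<lambda>v. \<Sum>i\<in>UNIV. (2 * Re (P $ i * cpx v + Q $ i * cnj (cpx v))) *\<^sub>R (axis i 1 :: real^'n))) (at z)"
    by (intro has_derivative_sum has_derivative_scaleR_left)
  then show ?thesis unfolding r by (simp add: mult.commute)
qed

context pedal_surface_patch
begin

lemma smooth_g1: "smooth_on W g1"
proof -
  have "smooth_on W (\<lambda>y. cvec (g y))" by (rule smooth_on_linear[OF open_W bounded_linear_cvec smooth_g])
  then obtain P Q where P: "smooth_on W P" "\<And>z. z \<in> W \<Longrightarrow> vwd (\<lambda>y. cvec (g y)) (P z) (Q z) z"
    using smooth_vwd[OF open_W] by metis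
  have "P z = g1 z" if "z \<in> W" for z using vwd_unique(1)[OF P(2) vwd_g] that by blast
  then show ?thesis using P(1) smooth_on_cong[OF open_W] by blast
qed

lemma smooth_g2_h: "smooth_on W g2" "smooth_on W h"
proof -
  obtain P Q where P: "smooth_on W P" "smooth_on W Q" "\<And>z. z \<in> W \<Longrightarrow> vwd g1 (P z) (Q z) z"
    using smooth_vwd[OF open_W smooth_g1] by metis
  have "P z = g2 z" "Q z = h z" if "z \<in> W" for z
    using vwd_unique(1)[OF P(3) vwd_g1, of z] vwd_unique(2)[OF P(3) vwd_g1, of z] that by blast+
  then show "smooth_on W g2" "smooth_on W h" using P(1,2) smooth_on_cong[OF open_W] by blast+
qed

definition "hz z = (kap z / lam z) *s (a z *s ph1 z + (1 - a z * mu z) *s ph z + gam z *s ccnj (ph z))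
   + ((kap z / lam z) * (cA z - mu z)) *s (a z *s ph z + cnj (a z) *s ccnj (ph z))
   - cnj (gam z) *s Az z - cnj (gamzb z) *s A z - gamz z *s ccnj (A z) + (gam z * (kap z / lam z)) *s ccnj (ph z)"

lemma vwd_h:
  assumes z: "z \<in> W"
  shows "\<exists>Q. vwd h (hz z) Q z"
proof -
  have 1: "wd (\<lambda>z. kap z / lam z) ((kap z / lam z) * (cA z - mu z)) (cnj ((kap z / lam z) * (cA z - mu z))) z"
    by (rule wd_eq[OF wd_divide[OF wd_kap[OF z] wd_lam[OF z] lam(1)[OF z]]])
      (use lam[OF z] kap(3)[OF z] in \<open>simp_all add: power2_eq_square field_simps\<close>)
  show ?thesis
    unfolding h_def[abs_def]
    by (rule exI, rule vwd_eq[OF vwd_diff[OF vwd_diff[OF vwd_scale[OF 1 vwd_add[OF vwd_scale[OF wd_a[OF z] vwd_ph[OF z]]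
        vwd_scale[OF wd_cnj[OF wd_a[OF z]] vwd_ccnj[OF vwd_ph[OF z]]]]]
        vwd_scale[OF wd_cnj[OF wd_gam[OF z]] vwd_A[OF z]]] vwd_scale[OF wd_gam[OF z] vwd_ccnj[OF vwd_A[OF z]]]] _ refl])
      (use lam(3)[OF z] kap(3)[OF z] in \<open>simp add: hz_def vec_eq_iff algebra_simps\<close>)
qed

text \<open>Differentiating the formula for \<open>g2\<close> would require derivatives of
  \<open>Az\<close> and \<open>gamz\<close>. Exchanging the order of differentiation gives the
  answer as the \<partial>-derivative of \<open>h\<close>, whose ingredients have known
  derivatives.\<close>

lemma vwd_g2:
  assumes z: "z \<in> W"
  shows "\<exists>P. vwd g2 P (hz z) z"
proof -
  obtain P Q where PQ: "vwd g2 (P z) (Q z) z" using smooth_vwd[OF open_W smooth_g2_h(1)] z by metis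
  obtain R where R: "vwd h (hz z) R z" using vwd_h[OF z] by blast
  have "Q z $ i = hz z $ i" for i
  proof (rule wd_commute[OF open_W z])
    show "smooth_on W (\<lambda>y. g1 y $ i)" by (rule smooth_on_linear[OF open_W bounded_linear_vec_nth smooth_g1])
    show "wd (\<lambda>y. g1 y $ i) (g2 y $ i) (h y $ i) y" if "y \<in> W" for y
      using vwd_g1[OF that] by (simp add: vwd_def)
    show "wd (\<lambda>y. g2 y $ i) (P z $ i) (Q z $ i) z" "wd (\<lambda>y. h y $ i) (hz z $ i) (R $ i) z"
      using PQ R by (simp_all add: vwd_def)
  qed
  then have "Q z = hz z" by (simp add: vec_eq_iff)
  then show ?thesis using PQ by auto
qed

text \<open>The coefficients of \<open>B\<close>, of \<open>A\<close> and of \<open>ccnj ph\<close> on both sides already contradict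
  \<open>Lam \<noteq> 0\<close>.\<close>

lemma not_S_Willmore_algebra:
  assumes z: "z \<in> W" and B0: "B z \<noteq> 0"
    and eq: "hz z - tau z *s h z = c1 *s g1 z + c2 *s ccnj (g1 z) + c3 *s g2 z"
  shows False
proof -
  note s = A_perp[OF z] B_perp[OF z] ph_null[OF z] ccnj_null[OF ph_null[OF z]] A_null[OF z] ccnj_null[OF A_null[OF z]]
    cdot_commute[of "ccnj (ph z)" "ph z"] cdot_commute[of "ccnj (A z)" "A z"] lam_def[symmetric] kap_def[symmetric]
  note d = hz_def h_def g1_def g2_def Az_eq ph1_eq
  define k where "k = kap z / lam z"
  note l = lam(1)[OF z] and kp = kap(1)[OF z]
  have kk: "kap z = k * lam z" using l by (simp add: k_def)
  have gzb: "cnj (gamzb z) = - k * a z - cnj (gam z) * mu z"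
    using lam(3)[OF z] kap(3)[OF z] by (simp add: gamzb_def k_def)
  have "(hz z - tau z *s h z) \<odot> ccnj (B z) = (c1 *s g1 z + c2 *s ccnj (g1 z) + c3 *s g2 z) \<odot> ccnj (B z)"
    by (simp only: eq)
  then have "- cnj (gam z) * (B z \<odot> ccnj (B z)) = - (c3 * a z) * (B z \<odot> ccnj (B z))"
    by (simp add: d s)
  then have e1: "cnj (gam z) = c3 * a z" using B0 by simp
  have "(hz z - tau z *s h z) \<odot> ccnj (A z) = (c1 *s g1 z + c2 *s ccnj (g1 z) + c3 *s g2 z) \<odot> ccnj (A z)"
    by (simp only: eq)
  then have "kap z * (k * a z - cnj (gam z) * cA z - cnj (gamzb z) + tau z * cnj (gam z))
     = kap z * (- c1 * a z - c3 * (1 - a z * mu z + a z * cA z))"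
    by (simp add: d s k_def[symmetric], simp add: algebra_simps, algebra)
  then have e2: "k * a z - cnj (gam z) * cA z + k * a z + cnj (gam z) * mu z + tau z * cnj (gam z)
     = - c1 * a z - c3 * (1 - a z * mu z + a z * cA z)"
    unfolding mult_cancel_left gzb using kp by (simp add: algebra_simps)
  have "(hz z - tau z *s h z) \<odot> ph z = (c1 *s g1 z + c2 *s ccnj (g1 z) + c3 *s g2 z) \<odot> ph z"
    by (simp only: eq)
  then have "lam z * (k * gam z + k * (cA z - mu z) * cnj (a z) + gam z * k - tau z * k * cnj (a z))
     = lam z * (- c1 * gam z - c3 * gamz z)"
    by (simp add: d s k_def[symmetric], simp add: algebra_simps, algebra)
  then have e3: "k * gam z + k * (cA z - mu z) * cnj (a z) + gam z * k - tau z * k * cnj (a z) = - c1 * gam z - c3 * gamz z"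
    unfolding mult_cancel_left using l by simp
  have "tau z * Lam z = (1 - a z * mu z + a z * cA z) * cnj (a z) * kap z + gamz z * cnj (gam z) * lam z"
    using Lam(1)[OF z] g_dot(7)[OF z] by (simp add: tau_def)
  then have "lam z * (tau z * (a z * cnj (a z) * k + gam z * cnj (gam z)))
     = lam z * ((1 - a z * mu z + a z * cA z) * cnj (a z) * k + gamz z * cnj (gam z))"
    unfolding g_dot(6)[OF z] kk by (simp add: algebra_simps)
  then have e4: "tau z * (a z * cnj (a z) * k + gam z * cnj (gam z)) = (1 - a z * mu z + a z * cA z) * cnj (a z) * k + gamz z * cnj (gam z)"
    unfolding mult_cancel_left using l by simp
  \<comment> \<open>Conjugates become independent variables. Eliminating c1 between the
    \<open>A\<close> and \<open>ccnj ph\<close> relations and inserting the formula for tau leaves k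
    x' = - c3 y; multiplication by x and y' = c3 x finish the elimination.\<close>
  have key: "x * x' * k + y * y' = 0"
    if "y' = c3 * x" "k * x - y' * c + k * x + y' * m + t * y' = - c1 * x - c3 * (1 - x * m + x * c)"
      "k * y + k * (c - m) * x' + y * k - t * k * x' = - c1 * y - c3 * Q"
      "t * (x * x' * k + y * y') = (1 - x * m + x * c) * x' * k + Q * y'" for x x' y y' c m t Q k :: complex
    using that by algebra
  have "a z * cnj (a z) * k + gam z * cnj (gam z) = 0"
    by (rule key[OF e1 e2 e3 e4])
  then have "Lam z = 0" unfolding g_dot(6)[OF z] kk by algebra
  then show False using Lam(1)[OF z] by simp
qed

lemma csff_g:
  assumes z: "z \<in> W"
  shows "csff g del del z = Gh z"
  unfolding csff_def sum_2 sff_g[OF z] cvec_rvec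
  using z by (simp add: del_def cpx_simps vec_eq_iff field_simps)

text \<open>The complex linear extension of the normal projection of \<open>g\<close>. Since
  \<open>g1\<close> is null, \<open>ccnj g1\<close> is its dual partner, and the two span the
  complexified tangent plane.\<close>

definition "np z V = V - ((V \<odot> ccnj (g1 z)) / Lam z) *s g1 z - ((V \<odot> g1 z) / Lam z) *s ccnj (g1 z)"

lemma np_linear: "np z (V + U) = np z V + np z U" "np z (c *s V) = c *s np z V"
  by (simp_all add: np_def vec_eq_iff add_divide_distrib algebra_simps)

lemma cvec_normal_proj:
  assumes z: "z \<in> W"
  shows "cvec (orth_proj (normal_fibre g z) v) = np z (cvec v)"
proof -
  note L = Lam[OF z] and n = g_dot(1)[OF z] ccnj_null[OF g_dot(1)[OF z]]
  define y where "y = v - rvec (((cvec v \<odot> ccnj (g1 z)) / Lam z) *s g1 z)"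
  have cy: "cvec y = np z (cvec v)"
    using L(3) by (simp add: y_def np_def cvec_simps cvec_rvec)
  have "orth_proj (normal_fibre g z) v = y"
    unfolding normal_fibre_def
  proof (rule orth_proj_comp_eqI)
    have "complex_of_real (inner (rvec (x *s g1 z)) y) = 0" for x
      unfolding cvec_inner[symmetric] cvec_rvec cy np_def
      using n L(1) by (simp add: cdot_commute[of "ccnj (g1 z)" "cvec v"] cdot_commute[of "ccnj (g1 z)" "g1 z"]
          cdot_commute[of "g1 z" "cvec v"] Lam_def[symmetric])
    then show "y \<in> orthogonal_comp (tangent_space g z)"
      by (auto simp: mem_orthogonal_comp tangent_g[OF z])
    show "v - y \<in> span (tangent_space g z)"
      by (auto simp: y_def tangent_g[OF z] intro!: span_base)
  qed
  then show ?thesis using cy by simp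
qed

lemma not_S_Willmore_at:
  assumes z: "z \<in> W" and B0: "B z \<noteq> 0"
  shows "cnormal_connection g delbar (csff g del del) z \<noteq> c *s csff g del del z"
proof
  assume sw: "cnormal_connection g delbar (csff g del del) z = c *s csff g del del z"
  obtain g2z where g2z: "vwd g2 g2z (hz z) z" using vwd_g2[OF z] by blast
  \<comment> \<open>No formula for the derivative of \<open>tau\<close> is required: it enters only
    through a multiple of \<open>g1\<close>, which is absorbed into an unspecified
    coefficient.\<close>
  have "\<exists>t1 t2. wd tau t1 t2 z"
    unfolding tau_def[abs_def] Lam_def[abs_def]
    using wd_divide[OF wd_cdot[OF g2z vwd_ccnj[OF vwd_g1[OF z]]] wd_cdot[OF vwd_g1[OF z] vwd_ccnj[OF vwd_g1[OF z]]]]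
      Lam(1)[OF z] unfolding Lam_def by blast
  then obtain t1 t2 where t: "wd tau t1 t2 z" by blast
  obtain Gz where G: "vwd Gh Gz (hz z - (tau z *s h z + t2 *s g1 z)) z"
    using vwd_diff[OF g2z vwd_scale[OF t vwd_g1[OF z]]] unfolding Gh_def[abs_def] by blast
  define Gb where "Gb = hz z - (tau z *s h z + t2 *s g1 z)"
  let ?GR = "\<lambda>y. \<chi> i. Re (csff g del del y $ i)" and ?GI = "\<lambda>y. \<chi> i. Im (csff g del del y $ i)"
  \<comment> \<open>The factors 1/2 and -i/2 compensate for the doubling in \<open>rvec\<close> and
    select the real and the imaginary part.\<close>
  have R: "?GR y = rvec ((1/2) *s Gh y)" "?GI y = rvec ((- \<i> / 2) *s Gh y)" if "y \<in> W" for y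
    unfolding csff_g[OF that] by (simp_all add: rvec_def vec_eq_iff)
  have dG: "dderiv v (\<lambda>y. rvec (x *s Gh y)) z = rvec (x *s (cpx v *s Gz + cnj (cpx v) *s Gb))" for v x
  proof -
    have "vwd (\<lambda>y. x *s Gh y) (x *s Gz) (x *s Gb) z"
      by (rule vwd_eq[OF vwd_scale[OF wd_const G]]) (simp_all add: Gb_def)
    from dderiv_eq[OF has_derivative_rvec[OF this], of v] show ?thesis
      by (simp add: vec_eq_iff algebra_simps)
  qed
  have nc: "cvec (normal_connection g v ?GR z) + \<i> *s cvec (normal_connection g v ?GI z)
     = np z (cpx v *s Gz + cnj (cpx v) *s Gb)" for v
  proof -
    have r1: "dderiv v ?GR z = rvec ((1/2) *s (cpx v *s Gz + cnj (cpx v) *s Gb))"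
      by (subst dderiv_cong_open[OF open_W z R(1)]) (assumption, rule dG)
    have r2: "dderiv v ?GI z = rvec ((- \<i> / 2) *s (cpx v *s Gz + cnj (cpx v) *s Gb))"
      by (subst dderiv_cong_open[OF open_W z R(2)]) (assumption, rule dG)
    show ?thesis
      unfolding normal_connection_def cvec_normal_proj[OF z] r1 r2 np_linear[symmetric] cvec_rvec
      by (intro arg_cong[of _ _ "np z"]) (simp add: vec_eq_iff field_simps)
  qed
  have "cnormal_connection g delbar (csff g del del) z = np z Gb"
    unfolding cnormal_connection_def sum_2 nc np_linear[symmetric]
    by (rule arg_cong[of _ _ "np z"]) (simp add: delbar_def cpx_simps vec_eq_iff field_simps)
  then have e: "np z Gb = c *s (g2 z - tau z *s g1 z)"
    using sw csff_g[OF z] by (simp add: Gh_def)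
  \<comment> \<open>Writing out the normal projection moves its tangential corrections into the
    coefficients of \<open>g1\<close> and \<open>ccnj g1\<close>.\<close>
  have "hz z - tau z *s h z = (t2 + (Gb \<odot> ccnj (g1 z)) / Lam z - c * tau z) *s g1 z
      + ((Gb \<odot> g1 z) / Lam z) *s ccnj (g1 z) + c *s g2 z"
  proof -
    have "hz z - tau z *s h z = np z Gb + ((Gb \<odot> ccnj (g1 z)) / Lam z) *s g1 z + ((Gb \<odot> g1 z) / Lam z) *s ccnj (g1 z) + t2 *s g1 z"
      by (simp add: np_def) (simp add: Gb_def)
    then show ?thesis unfolding e by (simp add: vec_eq_iff algebra_simps)
  qed
  then show False by (rule not_S_Willmore_algebra[OF z B0])
qed

end

section \<open>Zeros of the tangential coefficient and the position vector\<close>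

lemma continuous_on_cdot:
  "continuous_on S V \<Longrightarrow> continuous_on S U \<Longrightarrow> continuous_on S (\<lambda>z. V z \<odot> U z)"
  unfolding cdot_def by (intro continuous_intros)

lemma continuous_on_ccnj: "continuous_on S V \<Longrightarrow> continuous_on S (\<lambda>z. ccnj (V z))"
  unfolding ccnj_def by (intro continuous_intros)

lemma continuous_on_cscale:
  fixes V :: "'a::topological_space \<Rightarrow> complex^'n"
  shows "continuous_on S c \<Longrightarrow> continuous_on S V \<Longrightarrow> continuous_on S (\<lambda>z. c z *s V z)"
  unfolding vector_scalar_mult_def
  by (rule continuous_on_vec_lambda) (intro continuous_on_mult continuous_on_component)

context iso_patch
begin

lemma smooth_ph: "smooth_on W ph" "smooth_on W ph1" "smooth_on W ph2"
proof -
  have step: "smooth_on W V'" if sV: "smooth_on W V" and vd: "\<And>z. z \<in> W \<Longrightarrow> vwd V (V' z) (Q z) z" for V V' Q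
  proof -
    obtain P R where P: "smooth_on W P" "\<And>z. z \<in> W \<Longrightarrow> vwd V (P z) (R z) z"
      using smooth_vwd[OF open_W sV] by metis
    have "P z = V' z" if "z \<in> W" for z by (rule vwd_unique(1)[OF P(2)[OF that] vd[OF that]])
    then show ?thesis using P(1) smooth_on_cong[OF open_W] by blast
  qed
  show 0: "smooth_on W ph"
    by (rule step[OF smooth_on_linear[OF open_W bounded_linear_cvec smooth_u] vwd_u])
  show 1: "smooth_on W ph1" by (rule step[OF 0 vwd_ph])
  show "smooth_on W ph2" by (rule step[OF 1 vwd_ph1])
qed

lemma continuous_Az: "continuous_on W Az"
proof -
  note c = smooth_ph[THEN smooth_on_continuous]
  have l: "continuous_on W lam" unfolding lam_def[abs_def] by (intro continuous_on_cdot continuous_on_ccnj c)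
  have m: "continuous_on W mu" unfolding mu_def[abs_def]
    by (intro continuous_on_divide continuous_on_cdot continuous_on_ccnj c l) (use lam(1) in blast)
  show ?thesis unfolding Az_def[abs_def] muz_def[abs_def]
    by (intro continuous_on_diff continuous_on_cscale continuous_on_mult continuous_on_divide
        continuous_on_cdot continuous_on_ccnj c l m) (use lam(1) in blast)
qed

end

context pedal_patch
begin

text \<open>The zeros of \<open>a\<close> are nowhere dense because \<open>\<partial>a = 1\<close> there.\<close>

lemma B_null_of_dense:
  assumes "\<And>z. z \<in> W \<Longrightarrow> (a z)\<^sup>2 * (B z \<odot> B z) = 0" and z: "z \<in> W"
  shows "B z \<odot> B z = 0"
proof (rule ccontr)
  assume nz: "B z \<odot> B z \<noteq> 0"
  define N where "N = W \<inter> (\<lambda>z. Az z \<odot> Az z) -` (- {0})"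
  have N: "open N" unfolding N_def
    by (rule continuous_open_preimage[OF continuous_on_cdot[OF continuous_Az continuous_Az] open_W]) auto
  have zN: "z \<in> N" using nz z by (simp add: N_def B_square)
  have "a y = 0" if "y \<in> N" for y
    using assms(1)[of y] that by (simp add: N_def B_square)
  then have "1 - a z * mu z = 0" "a z = 0" using wd_const_on(1)[OF N zN _ wd_a[OF z]] zN by auto
  then show False by simp
qed

lemma position_not_osculating:
  assumes S: "open S" "S \<subseteq> W" "S \<noteq> {}" and B0: "\<And>z. z \<in> S \<Longrightarrow> B z \<noteq> 0"
    and sp: "\<And>z. z \<in> S \<Longrightarrow> \<exists>x x' y y'. Y z = x *s A z + x' *s ccnj (A z) + y *s ph z + y' *s ccnj (ph z)"
  shows False
proof -
  define p where "p z = cnj (gam z) * lam z / kap z" for z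
  define p' where "p' z = gam z * lam z / kap z" for z
  \<comment> \<open>Products with the conjugate frame vectors determine the coefficients, so they
    are differentiable functions and the relation itself can be differentiated.\<close>
  have Yeq: "Y z = p z *s A z + p' z *s ccnj (A z) + a z *s ph z + cnj (a z) *s ccnj (ph z)" if z: "z \<in> S" for z
  proof -
    have zW: "z \<in> W" using z S by blast
    note s = A_perp[OF zW] ph_null[OF zW] ccnj_null[OF ph_null[OF zW]] A_null[OF zW] ccnj_null[OF A_null[OF zW]]
      cdot_commute[of "ccnj (ph z)" "ph z"] cdot_commute[of "ccnj (A z)" "A z"] lam_def[symmetric] kap_def[symmetric]
    obtain x x' y y' where e: "Y z = x *s A z + x' *s ccnj (A z) + y *s ph z + y' *s ccnj (ph z)" using sp[OF z] by blast
    have "x * kap z = cnj (gam z) * lam z" "x' * kap z = gam z * lam z" "y * lam z = a z * lam z" "y' * lam z = cnj (a z) * lam z"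
      unfolding Y_dot[OF zW, symmetric] e by (simp_all add: s)
    then have "x = p z" "x' = p' z" "y = a z" "y' = cnj (a z)"
      using kap(1)[OF zW] lam(1)[OF zW] by (simp_all add: p_def p'_def field_simps)
    then show ?thesis using e by simp
  qed
  \<comment> \<open>Among the derivatives on the right, only that of \<open>A\<close> has a
    component along \<open>B\<close>, namely \<open>p z\<close>; on the left the derivative is
    \<open>ph\<close>, which has none.\<close>
  have gam0: "gam z = 0" if z: "z \<in> S" for z
  proof -
    have zW: "z \<in> W" using z S by blast
    have "\<exists>p1 p2. wd p p1 p2 z" "\<exists>p1 p2. wd p' p1 p2 z"
      unfolding p_def[abs_def] p'_def[abs_def]
      using wd_divide[OF wd_mult[OF wd_cnj[OF wd_gam[OF zW]] wd_lam[OF zW]] wd_kap[OF zW] kap(1)[OF zW]]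
        wd_divide[OF wd_mult[OF wd_gam[OF zW] wd_lam[OF zW]] wd_kap[OF zW] kap(1)[OF zW]] by blast+
    then obtain p1 p2 p3 p4 where pd: "wd p p1 p2 z" "wd p' p3 p4 z" by blast
    have "vwd Y (p z *s Az z + p1 *s A z + (p' z *s ccnj ((- kap z / lam z) *s ph z) + p3 *s ccnj (A z))
        + (a z *s ph1 z + (1 - a z * mu z) *s ph z) + (cnj (a z) *s ccnj 0 + cnj (cnj (gam z)) *s ccnj (ph z)))
       (p z *s ((- kap z / lam z) *s ph z) + p2 *s A z + (p' z *s ccnj (Az z) + p4 *s ccnj (A z))
        + (a z *s 0 + cnj (gam z) *s ph z) + (cnj (a z) *s ccnj (ph1 z) + cnj (1 - a z * mu z) *s ccnj (ph z))) z"
      by (subst vwd_cong_open[OF S(1) z Yeq], assumption)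
        (intro vwd_add vwd_scale vwd_ccnj pd vwd_A[OF zW] wd_a[OF zW] vwd_ph[OF zW] wd_cnj)
    from vwd_unique(1)[OF vwd_Y[OF zW] this]
    have "ph z \<odot> ccnj (B z) = (p z *s Az z + p1 *s A z + (p' z *s ccnj ((- kap z / lam z) *s ph z) + p3 *s ccnj (A z))
        + (a z *s ph1 z + (1 - a z * mu z) *s ph z) + (cnj (a z) *s ccnj 0 + cnj (cnj (gam z)) *s ccnj (ph z))) \<odot> ccnj (B z)"
      by (rule arg_cong)
    then have "p z * (B z \<odot> ccnj (B z)) = 0"
      by (simp add: Az_eq ph1_eq B_perp[OF zW])
    then have "p z = 0" using B0[OF z] by simp
    then show ?thesis using lam(1)[OF zW] kap(1)[OF zW] by (simp add: p_def)
  qed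
  \<comment> \<open>With \<open>gam\<close> = 0 the position vector is tangential, and the
    \<open>A\<close> component of its derivative is \<open>a\<close>, while \<open>ph\<close> has no
    such component.\<close>
  have a0: "a z = 0" if z: "z \<in> S" for z
  proof -
    have zW: "z \<in> W" using z S by blast
    have Yeq': "Y z = a z *s ph z + cnj (a z) *s ccnj (ph z)" if "z \<in> S" for z
      using Yeq[OF that] gam0[OF that] by (simp add: p_def p'_def)
    have "vwd Y ((a z *s ph1 z + (1 - a z * mu z) *s ph z) + (cnj (a z) *s ccnj 0 + cnj (cnj (gam z)) *s ccnj (ph z)))
       ((a z *s 0 + cnj (gam z) *s ph z) + (cnj (a z) *s ccnj (ph1 z) + cnj (1 - a z * mu z) *s ccnj (ph z))) z"
      by (subst vwd_cong_open[OF S(1) z Yeq'], assumption)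
        (intro vwd_add vwd_scale vwd_ccnj wd_a[OF zW] vwd_ph[OF zW] wd_cnj)
    from vwd_unique(1)[OF vwd_Y[OF zW] this]
    have "ph z \<odot> ccnj (A z) = ((a z *s ph1 z + (1 - a z * mu z) *s ph z) + (cnj (a z) *s ccnj 0 + cnj (cnj (gam z)) *s ccnj (ph z))) \<odot> ccnj (A z)"
      by (rule arg_cong)
    then have "a z * kap z = 0" by (simp add: ph1_eq A_perp[OF zW] kap_def)
    then show ?thesis using kap(1)[OF zW] by simp
  qed
  obtain z where z: "z \<in> S" using S by blast
  have zW: "z \<in> W" using z S by blast
  have "1 - a z * mu z = 0" using wd_const_on(1)[OF S(1) z a0 wd_a[OF zW]] by simp
  then show False using a0[OF z] by simp
qed

end

context pedal_surface_patch
begin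

text \<open>A zero of \<open>h\<close> forces gam = 0 and a = 0 through its \<open>A\<close> and
  \<open>ph\<close> components; then \<open>Lam\<close> vanishes, contradicting that
  \<open>g\<close> is an immersion.\<close>

lemma h_ne_0: "z \<in> W \<Longrightarrow> h z \<noteq> 0"
proof
  assume z: "z \<in> W" and h0: "h z = 0"
  note s = A_perp[OF z] ph_null[OF z] ccnj_null[OF ph_null[OF z]] A_null[OF z] ccnj_null[OF A_null[OF z]]
      cdot_commute[of "ccnj (ph z)" "ph z"] cdot_commute[of "ccnj (A z)" "A z"] lam_def[symmetric] kap_def[symmetric]
  have "h z \<odot> ccnj (A z) = 0" "h z \<odot> ccnj (ph z) = 0" using h0 by simp_all
  then have "cnj (gam z) * kap z = 0" "kap z * a z = 0"
    using lam(1)[OF z] by (simp_all add: h_def s)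
  then have "gam z = 0" "a z = 0" using kap(1)[OF z] by simp_all
  then show False using Lam(1)[OF z] g_dot(6)[OF z] by simp
qed

text \<open>If \<open>Gh\<close> vanished, \<open>g2\<close> would be a multiple of
  \<open>g1\<close>. The \<open>B\<close> component then gives a = 0, and at a zero of
  \<open>a\<close> the \<open>A\<close> component of \<open>g2\<close> is -1 while that of
  \<open>g1\<close> is 0.\<close>

lemma superconformal_of_isotropic:
  assumes z: "z \<in> W" and B: "B z \<odot> B z = 0" "B z \<noteq> 0"
  shows "Gh z \<odot> Gh z = 0 \<and> Gh z \<noteq> 0"
proof
  show "Gh z \<odot> Gh z = 0" by (simp add: Gh_dot[OF z] B)
  show "Gh z \<noteq> 0"
  proof
    assume "Gh z = 0"
    then have e: "g2 z = tau z *s g1 z" by (simp add: Gh_def)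
    have "g2 z \<odot> ccnj (B z) = (tau z *s g1 z) \<odot> ccnj (B z)" by (simp only: e)
    then have "a z * (B z \<odot> ccnj (B z)) = 0" unfolding g2_B[OF z] by (simp add: g1_def B_perp[OF z])
    then have a0: "a z = 0" using B(2) by simp
    have "g2 z \<odot> ccnj (A z) = (tau z *s g1 z) \<odot> ccnj (A z)" by (simp only: e)
    then have "kap z = 0" unfolding g2_A[OF z] by (simp add: g1_def A_perp[OF z] a0)
    then show False using kap(1)[OF z] by simp
  qed
qed

lemma g_not_harmonic:
  assumes z: "z \<in> W"
  shows "dderiv e1 (dderiv e1 g) z + dderiv e2 (dderiv e2 g) z \<noteq> 0"
proof
  assume 0: "dderiv e1 (dderiv e1 g) z + dderiv e2 (dderiv e2 g) z = 0"
  have "cvec (dderiv e1 (dderiv e1 g) z + dderiv e2 (dderiv e2 g) z) = 4 *s h z"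
    unfolding cvec_simps Dg2[OF z] cvec_rvec using z by (simp add: cpx_simps vec_eq_iff)
  then have "h z = 0" unfolding 0 cvec_simps by (simp add: vec_eq_iff)
  then show False using h_ne_0[OF z] by simp
qed

definition "inv_V d z = cvec (g z - d)"
definition "inv_r d z = inv_V d z \<odot> inv_V d z"
text \<open>The quotient rule value of \<partial> for the surface (g - d) / |g - d|^2.\<close>

definition "inv_g1 d z = (1 / inv_r d z) *s g1 z - (2 * (inv_V d z \<odot> g1 z) / (inv_r d z * inv_r d z)) *s inv_V d z"

lemma ccnj_inv_V [simp]: "ccnj (inv_V d z) = inv_V d z"
  by (simp add: inv_V_def)

lemma inv_r_ne_0: "g z \<noteq> d \<Longrightarrow> inv_r d z \<noteq> 0"
  unfolding inv_r_def inv_V_def cvec_inner by simp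

lemma vwd_inv_V: "z \<in> W \<Longrightarrow> vwd (inv_V d) (g1 z) (ccnj (g1 z)) z"
  unfolding inv_V_def[abs_def] cvec_simps
  by (rule vwd_eq[OF vwd_diff[OF vwd_g vwd_const]]) simp_all

lemma wd_inv_r: "z \<in> W \<Longrightarrow> wd (inv_r d) (2 * (inv_V d z \<odot> g1 z)) (2 * (inv_V d z \<odot> ccnj (g1 z))) z"
  unfolding inv_r_def[abs_def]
  by (rule wd_eq[OF wd_cdot[OF vwd_inv_V vwd_inv_V]]) (simp_all add: cdot_commute[of _ "inv_V d z"])

lemma vwd_inverted:
  assumes z: "z \<in> W" and d: "g z \<noteq> d"
  shows "vwd (\<lambda>y. cvec ((1 / (norm (g y - d))\<^sup>2) *\<^sub>R (g y - d))) (inv_g1 d z) (ccnj (inv_g1 d z)) z"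
proof -
  have c: "cnj (inv_r d z) = inv_r d z" by (simp add: inv_r_def)
  have cs: "cvec ((1 / (norm (g y - d))\<^sup>2) *\<^sub>R (g y - d)) = (1 / inv_r d y) *s inv_V d y" for y
    unfolding cvec_simps(3) by (simp add: inv_r_def inv_V_def cvec_inner power2_norm_eq_inner)
  show ?thesis
    unfolding cs
    by (rule vwd_eq[OF vwd_scale[OF wd_divide[OF wd_const wd_inv_r[OF z] inv_r_ne_0[OF d]] vwd_inv_V[OF z]]])
     (simp_all add: inv_g1_def vec_eq_iff power2_eq_square c)
qed

lemma inv_g1_null:
  assumes z: "z \<in> W" and d: "g z \<noteq> d"
  shows "inv_g1 d z \<odot> inv_g1 d z = 0"
  using g_dot(1)[OF z] inv_r_ne_0[OF d]
  by (simp add: inv_g1_def cdot_commute[of "g1 z" "inv_V d z"] inv_r_def[symmetric] field_simps)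

text \<open>Harmonicity makes the conjugate derivative of \<open>inv_g1\<close> vanish, a linear
  relation between \<open>h\<close>, \<open>g1\<close>, \<open>ccnj g1\<close> and g - d. Solving it
  for g - d and adding the tangential part puts u - d into the osculating space.\<close>

lemma inverted_not_harmonic:
  assumes S: "open S" "S \<subseteq> W" "S \<noteq> {}" and B0: "\<And>z. z \<in> S \<Longrightarrow> B z \<noteq> 0"
    and d: "\<And>z. z \<in> S \<Longrightarrow> g z \<noteq> d"
    and sm: "smooth_on S (\<lambda>y. (1 / (norm (g y - d))\<^sup>2) *\<^sub>R (g y - d))"
    and harm: "\<And>z. z \<in> S \<Longrightarrow> dderiv e1 (dderiv e1 (\<lambda>y. (1 / (norm (g y - d))\<^sup>2) *\<^sub>R (g y - d))) z +
        dderiv e2 (dderiv e2 (\<lambda>y. (1 / (norm (g y - d))\<^sup>2) *\<^sub>R (g y - d))) z = 0"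
  shows False
proof -
  \<comment> \<open>The result on position vectors is reused with \<open>d\<close> in place of
    \<open>q\<close>; the frame depends on \<open>u\<close> only and stays the same.\<close>
  interpret d: pedal_patch W u d by unfold_locales
  let ?s = "\<lambda>y. (1 / (norm (g y - d))\<^sup>2) *\<^sub>R (g y - d)"
  define V where "V = inv_V d"
  define r where "r = inv_r d"
  define s1 where "s1 = inv_g1 d"
  have SW: "z \<in> W" if "z \<in> S" for z using that S by blast
  have r0: "r z \<noteq> 0" if "z \<in> S" for z
    using d[OF that] unfolding r_def by (rule inv_r_ne_0)
  have vV: "vwd V (g1 z) (ccnj (g1 z)) z" if "z \<in> S" for z
    unfolding V_def by (rule vwd_inv_V[OF SW[OF that]])
  have wr: "wd r (2 * (V z \<odot> g1 z)) (2 * (V z \<odot> ccnj (g1 z))) z" if "z \<in> S" for z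
    unfolding r_def V_def by (rule wd_inv_r[OF SW[OF that]])
  have s1_eq: "s1 = (\<lambda>z. (1 / r z) *s g1 z - (2 * (V z \<odot> g1 z) / (r z * r z)) *s V z)"
    by (simp add: s1_def inv_g1_def[abs_def] V_def r_def)
  have vs: "vwd (\<lambda>y. cvec (?s y)) (s1 z) (ccnj (s1 z)) z" if z: "z \<in> S" for z
    unfolding s1_def by (rule vwd_inverted[OF SW[OF z] d[OF z]])
  have s1_phi: "s1 z = phi ?s z" if "z \<in> S" for z
    using vwd_unique(1)[OF vs[OF that] vwd_cvec[OF smooth_on_differentiable[OF sm S(1) that]]] .
  have vs1: "vwd s1 (phi (dderiv e1 ?s) z) 0 z" if "z \<in> S" for z
    by (subst vwd_cong_open[OF S(1) that s1_phi]) (assumption, rule vwd_phi[OF S(1) that sm harm[OF that]])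
  have sp: "\<exists>x x' y y'. d.Y z = x *s A z + x' *s ccnj (A z) + y *s ph z + y' *s ccnj (ph z)" if z: "z \<in> S" for z
  proof -
    note zW = SW[OF z] and r0 = r0[OF z]
    let ?p = "V z \<odot> g1 z" and ?p' = "V z \<odot> ccnj (g1 z)" and ?r = "r z"
    have wp: "wd (\<lambda>z. V z \<odot> g1 z) (V z \<odot> g2 z + g1 z \<odot> g1 z) (V z \<odot> h z + ccnj (g1 z) \<odot> g1 z) z"
      by (rule wd_cdot[OF vV[OF z] vwd_g1[OF zW]])
    define m where "m = (2 * (V z \<odot> h z + Lam z)) / (?r * ?r) - 8 * ?p * ?p' / (?r * ?r * ?r)"
    have "\<exists>P. vwd s1 P ((1 / ?r) *s h z - (2 * ?p' / (?r * ?r)) *s g1 z - (2 * ?p / (?r * ?r)) *s ccnj (g1 z) - m *s V z) z"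
      unfolding s1_eq
      by (rule exI, rule vwd_eq[OF vwd_diff[OF vwd_scale[OF wd_divide[OF wd_const wr[OF z] r0] vwd_g1[OF zW]]
         vwd_scale[OF wd_divide[OF wd_mult[OF wd_const wp] wd_mult[OF wr[OF z] wr[OF z]]] vV[OF z]]] refl])
        (use r0 in \<open>simp_all add: m_def vec_eq_iff Lam_def cdot_commute[of "ccnj (g1 z)"] power2_eq_square field_simps\<close>)
    then obtain P where "vwd s1 P ((1 / ?r) *s h z - (2 * ?p' / (?r * ?r)) *s g1 z - (2 * ?p / (?r * ?r)) *s ccnj (g1 z) - m *s V z) z" by blast
    from vwd_unique(2)[OF this vs1[OF z]]
    have e: "(1 / ?r) *s h z - (2 * ?p' / (?r * ?r)) *s g1 z - (2 * ?p / (?r * ?r)) *s ccnj (g1 z) - m *s V z = 0" .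
    then have "((1 / ?r) *s h z - (2 * ?p' / (?r * ?r)) *s g1 z - (2 * ?p / (?r * ?r)) *s ccnj (g1 z) - m *s V z) \<odot> V z = 0"
      by simp
    then have "(V z \<odot> h z) / ?r - 4 * ?p * ?p' / (?r * ?r) - m * ?r = 0"
      by (simp add: cdot_commute[of "h z" "inv_V d z"] cdot_commute[of "g1 z" "inv_V d z"]
          cdot_commute[of "ccnj (g1 z)" "inv_V d z"] r_def inv_r_def[symmetric] V_def algebra_simps)
    \<comment> \<open>Both this equation, obtained by multiplying with V, and the definition of
      \<open>m\<close> contain V \<odot> h and the product of p and p'. Eliminating these gives m in
      terms of \<open>Lam\<close>, so m is nonzero and the relation can be solved for V.\<close>
    then have "m * (?r * ?r) = - 2 * Lam z"
      using r0 unfolding m_def by (simp add: field_simps) algebra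
    then have m0: "m \<noteq> 0" using Lam(1)[OF zW] by auto
    have Ve: "V z = (1 / (?r * m)) *s h z - (2 * ?p' / (?r * ?r * m)) *s g1 z - (2 * ?p / (?r * ?r * m)) *s ccnj (g1 z)"
    proof -
      have "m *s V z = (1 / ?r) *s h z - (2 * ?p' / (?r * ?r)) *s g1 z - (2 * ?p / (?r * ?r)) *s ccnj (g1 z)"
        using e by simp
      then have "(1 / m) *s (m *s V z) = (1 / m) *s ((1 / ?r) *s h z - (2 * ?p' / (?r * ?r)) *s g1 z - (2 * ?p / (?r * ?r)) *s ccnj (g1 z))"
        by simp
      then show ?thesis using m0 by (simp add: vec_eq_iff algebra_simps)
    qed
    have "d.Y z = V z + a z *s ph z + cnj (a z) *s ccnj (ph z)"
      unfolding d.Y_def V_def inv_V_def g[OF zW] pedal_point[OF zW] by (simp add: cvec_simps cvec_rvec)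
    moreover obtain x1 x2 x3 where "V z = x1 *s h z + x2 *s g1 z + x3 *s ccnj (g1 z)"
      using that[of "1 / (?r * m)" "- (2 * ?p' / (?r * ?r * m))" "- (2 * ?p / (?r * ?r * m))"] Ve
      by (simp add: vec_eq_iff)
    moreover define k where "k = kap z / lam z"
    moreover have "x1 *s (k *s (a z *s ph z + cnj (a z) *s ccnj (ph z)) - cnj (gam z) *s A z - gam z *s ccnj (A z))
        + x2 *s (- (a z *s A z) - gam z *s ccnj (ph z)) + x3 *s (- (cnj (a z) *s ccnj (A z)) - cnj (gam z) *s ph z)
        + a z *s ph z + cnj (a z) *s ccnj (ph z)
      = (- x1 * cnj (gam z) - x2 * a z) *s A z + (- x1 * gam z - x3 * cnj (a z)) *s ccnj (A z)
        + (x1 * k * a z - x3 * cnj (gam z) + a z) *s ph z + (x1 * k * cnj (a z) - x2 * gam z + cnj (a z)) *s ccnj (ph z)" for x1 x2 x3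
      by (simp add: vec_eq_iff algebra_simps)
    ultimately have "d.Y z = (- x1 * cnj (gam z) - x2 * a z) *s A z + (- x1 * gam z - x3 * cnj (a z)) *s ccnj (A z)
        + (x1 * k * a z - x3 * cnj (gam z) + a z) *s ph z + (x1 * k * cnj (a z) - x2 * gam z + cnj (a z)) *s ccnj (ph z)"
      by (simp add: h_def g1_def)
    then show ?thesis by blast
  qed
  show False by (rule d.position_not_osculating[OF S B0 sp])
qed

end

section \<open>Moebius transformations\<close>

text \<open>Inversion in the unit sphere with the default value 0 at 0, which makes it an involution
  on the whole space.\<close>

definition inv0 :: "'a::euclidean_space \<Rightarrow> 'a" where
  "inv0 w = (1 / (norm w)\<^sup>2) *\<^sub>R w"

definition reflect0 :: "'a::euclidean_space \<Rightarrow> 'a \<Rightarrow> 'a" where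
  "reflect0 a v = v - (2 * inner a v / inner a a) *\<^sub>R a"

lemma linear_reflect0: "linear (reflect0 a)"
  by (rule linearI) (simp_all add: reflect0_def inner_add_right algebra_simps add_divide_distrib)

lemma norm_reflect0: "a \<noteq> 0 \<Longrightarrow> norm (reflect0 a v) = norm v"
proof -
  assume a: "a \<noteq> 0"
  define c where "c = inner a v / inner a a"
  have c: "c * inner a a = inner a v" using a by (simp add: c_def)
  have r: "reflect0 a v = v - (2 * c) *\<^sub>R a" by (simp add: reflect0_def c_def)
  have "inner (reflect0 a v) (reflect0 a v) = inner v v - 4 * c * inner a v + 4 * c * (c * inner a a)"
    unfolding r by (simp add: inner_diff_left inner_diff_right inner_commute[of v a] algebra_simps)
  then have "inner (reflect0 a v) (reflect0 a v) = inner v v" unfolding c by simp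
  then show ?thesis by (simp add: norm_eq_sqrt_inner)
qed

text \<open>Two inversions separated by a translation compose to an inversion with the new centre
  \<open>w0\<close>, followed by a similarity. This is the step that keeps the normal form of
  Moebius maps closed.\<close>

lemma inv0_diff:
  assumes "w \<noteq> 0" "w0 \<noteq> 0" "w \<noteq> w0"
  shows "inv0 (inv0 w - inv0 w0) = - w0 + (norm w0)\<^sup>2 *\<^sub>R reflect0 w0 (inv0 (w - w0))"
proof -
  define P where "P = inner w w"
  define P0 where "P0 = inner w0 w0"
  define v where "v = w - w0"
  define V where "V = inner v v"
  have nz: "P \<noteq> 0" "P0 \<noteq> 0" "V \<noteq> 0" using assms by (auto simp: P_def P0_def V_def v_def)
  have w: "w = v + w0" by (simp add: v_def)
  have PV: "P = V + 2 * inner w0 v + P0"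
    by (simp add: P_def V_def P0_def w inner_add_left inner_add_right inner_commute)
  define y where "y = P0 *\<^sub>R w - P *\<^sub>R w0"
  have d: "inv0 w - inv0 w0 = (1 / (P * P0)) *\<^sub>R y"
    using nz by (simp add: inv0_def power2_norm_eq_inner P_def[symmetric] P0_def[symmetric] y_def scaleR_diff_right)
  have "inner y y = P0 * P0 * P - 2 * P * P0 * inner w w0 + P * P * P0"
    by (simp add: y_def inner_diff_left inner_diff_right inner_commute[of w0 w] P_def[symmetric] P0_def[symmetric] algebra_simps)
  also have "\<dots> = P * P0 * V"
    unfolding V_def v_def by (simp add: inner_diff_left inner_diff_right inner_commute[of w0 w] P_def[symmetric] P0_def[symmetric] algebra_simps)
  \<comment> \<open>Equivalent to the distance formula |inv0 w - inv0 w0| = |w - w0| / (|w|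
    |w0|).\<close>
  finally have yy: "inner y y = P * P0 * V" .
  have "inv0 ((1 / (P * P0)) *\<^sub>R y) = (1 / V) *\<^sub>R y"
    unfolding inv0_def power2_norm_eq_inner using nz by (simp add: yy)
  then have "inv0 (inv0 w - inv0 w0) = (1 / V) *\<^sub>R y" by (simp only: d)
  moreover have "- w0 + (norm w0)\<^sup>2 *\<^sub>R reflect0 w0 (inv0 (w - w0)) = (1 / V) *\<^sub>R y"
  proof -
    have "V *\<^sub>R (- w0 + P0 *\<^sub>R reflect0 w0 (inv0 v)) = - (V *\<^sub>R w0) + P0 *\<^sub>R v - (2 * inner w0 v) *\<^sub>R w0"
      using nz by (simp add: reflect0_def inv0_def power2_norm_eq_inner P0_def[symmetric] V_def[symmetric] algebra_simps)
    also have "\<dots> = y" unfolding y_def PV by (simp add: w algebra_simps)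
    finally have "(1 / V) *\<^sub>R (V *\<^sub>R (- w0 + P0 *\<^sub>R reflect0 w0 (inv0 v))) = (1 / V) *\<^sub>R y" by simp
    then show ?thesis using nz by (simp add: power2_norm_eq_inner P0_def[symmetric] v_def[symmetric])
  qed
  ultimately show ?thesis by simp
qed

definition similarity0 :: "('a::euclidean_space \<Rightarrow> 'a) \<Rightarrow> real \<Rightarrow> bool" where
  "similarity0 L k \<longleftrightarrow> linear L \<and> k > 0 \<and> (\<forall>v. norm (L v) = k * norm v)"

lemma similarity0_surj: "similarity0 L k \<Longrightarrow> \<exists>x. L x = y"
proof -
  assume L: "similarity0 L k"
  then have lin: "linear L" and k: "k > 0" and n: "\<And>v. norm (L v) = k * norm v"
    by (auto simp: similarity0_def)
  have "inj L"
    unfolding linear_injective_0[OF lin]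
  proof (intro allI impI)
    fix x assume "L x = 0"
    then show "x = 0" using n[of x] k by simp
  qed
  then have "surj L" by (rule linear_inj_imp_surj[OF lin])
  then show ?thesis by (metis surjD)
qed

lemma similarity0_scale: "similarity0 L k \<Longrightarrow> r > 0 \<Longrightarrow> similarity0 (\<lambda>x. r *\<^sub>R L x) (r * k)"
  by (auto simp: similarity0_def linear_compose_scale_right)

lemma similarity0_reflect: "similarity0 L k \<Longrightarrow> a \<noteq> 0 \<Longrightarrow> similarity0 (\<lambda>x. reflect0 a (L x)) k"
  "similarity0 L k \<Longrightarrow> a \<noteq> 0 \<Longrightarrow> similarity0 (\<lambda>x. L (reflect0 a x)) k"
  using linear_compose[of L "reflect0 a"] linear_compose[of "reflect0 a" L]
  by (auto simp: similarity0_def norm_reflect0 linear_reflect0 o_def)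

definition moebius_affine :: "('a::euclidean_space option \<Rightarrow> 'a option) \<Rightarrow> bool" where
  "moebius_affine T \<longleftrightarrow> (\<exists>c L k. similarity0 L k \<and> T None = None \<and> (\<forall>y. T (Some y) = Some (c + L y)))"

definition moebius_inverted :: "('a::euclidean_space option \<Rightarrow> 'a option) \<Rightarrow> bool" where
  "moebius_inverted T \<longleftrightarrow> (\<exists>c L k d. similarity0 L k \<and> T None = Some c \<and> T (Some d) = None \<and>
     (\<forall>y. y \<noteq> d \<longrightarrow> T (Some y) = Some (c + L (inv0 (y - d)))))"

lemma plane_reflection_affine:
  assumes "similarity0 L k" "a \<noteq> 0"
  shows "plane_reflection a b (Some (c + L y)) = Some ((c - (2 * (inner a c - b) / inner a a) *\<^sub>R a) + reflect0 a (L y))"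
  by (simp add: plane_reflection_def reflect0_def inner_add_right algebra_simps add_divide_distrib diff_divide_distrib)

lemma sphere_inversion_eq:
  "y \<noteq> c0 \<Longrightarrow> sphere_inversion c0 r (Some y) = Some (c0 + r\<^sup>2 *\<^sub>R inv0 (y - c0))"
  by (simp add: sphere_inversion_def inv0_def)

lemma inv0_similarity: "similarity0 L k \<Longrightarrow> inv0 (L v) = (1 / k\<^sup>2) *\<^sub>R L (inv0 v)"
  by (auto simp: similarity0_def inv0_def linear_scale power_mult_distrib)

lemma inv0_inv0: "inv0 (inv0 w) = w"
  by (cases "w = 0") (simp_all add: inv0_def power_divide field_simps power2_eq_square)

lemma inv0_eq_0: "inv0 w = 0 \<longleftrightarrow> w = 0"
  by (simp add: inv0_def)

lemma inv0_minus: "inv0 (- w) = - inv0 w"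
  by (simp add: inv0_def)

text \<open>The two normal forms distinguish whether infinity is fixed or some finite point is sent
  there. Reflections preserve the form; an inversion preserves or exchanges it, depending on the
  image of infinity.\<close>

lemma moebius_group_cases: "T \<in> moebius_group \<Longrightarrow> moebius_affine T \<or> moebius_inverted T"
proof (induction rule: moebius_group.induct)
  case ident
  have "similarity0 (\<lambda>x::'a. x) 1" by (simp add: similarity0_def linear_iff)
  then have "moebius_affine (id :: 'a option \<Rightarrow> 'a option)"
    unfolding moebius_affine_def by (intro exI[of _ 0] exI[of _ "\<lambda>x. x"] exI[of _ 1]) simp
  then show ?case ..
next
  case (reflection T a b)
  let ?c = "\<lambda>c. c - (2 * (inner a c - b) / inner a a) *\<^sub>R a"
  have pc: "plane_reflection a b (Some c) = Some (?c c)" for c by (simp add: plane_reflection_def)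
  from reflection.IH show ?case
  proof
    assume "moebius_affine T"
    then obtain c L k where *: "similarity0 L k" "T None = None" "\<And>y. T (Some y) = Some (c + L y)"
      unfolding moebius_affine_def by blast
    have "moebius_affine (plane_reflection a b \<circ> T)"
      unfolding moebius_affine_def
      by (intro exI[of _ "?c c"] exI[of _ "\<lambda>x. reflect0 a (L x)"] exI[of _ k] conjI allI similarity0_reflect * reflection.hyps)
        (simp_all add: * plane_reflection_affine[OF *(1) \<open>a \<noteq> 0\<close>], simp add: plane_reflection_def)
    then show ?thesis ..
  next
    assume "moebius_inverted T"
    then obtain c L k d where *: "similarity0 L k" "T None = Some c" "T (Some d) = None"
        "\<And>y. y \<noteq> d \<Longrightarrow> T (Some y) = Some (c + L (inv0 (y - d)))"
      unfolding moebius_inverted_def by blast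
    have "moebius_inverted (plane_reflection a b \<circ> T)"
      unfolding moebius_inverted_def
      by (intro exI[of _ "?c c"] exI[of _ "\<lambda>x. reflect0 a (L x)"] exI[of _ k] exI[of _ d] conjI allI impI similarity0_reflect * reflection.hyps)
        (simp_all add: * pc plane_reflection_affine[OF *(1) \<open>a \<noteq> 0\<close>], simp add: plane_reflection_def)
    then show ?thesis ..
  qed
next
  case (inversion T r c0)
  have r2: "r\<^sup>2 > 0" using inversion.hyps by simp
  have sN: "sphere_inversion c0 r None = Some c0" "sphere_inversion c0 r (Some c0) = None"
    by (simp_all add: sphere_inversion_def)
  from inversion.IH show ?case
  proof
    assume "moebius_affine T"
    then obtain c L k where *: "similarity0 L k" "T None = None" "\<And>y. T (Some y) = Some (c + L y)"
      unfolding moebius_affine_def by blast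
    have lin: "linear L" and k: "k > 0" using *(1) by (auto simp: similarity0_def)
    \<comment> \<open>This is the point that \<open>T\<close> sends to the centre \<open>c0\<close>,
      hence the composition to infinity.\<close>
    obtain d where d: "L d = c0 - c" using similarity0_surj[OF *(1)] by blast
    have inj: "L x = L y \<longleftrightarrow> x = y" for x y
    proof -
      have "norm (L (x - y)) = k * norm (x - y)" using *(1) by (simp add: similarity0_def)
      then show ?thesis using k by (auto simp: linear_diff[OF lin])
    qed
    have sim: "similarity0 (\<lambda>x. (r\<^sup>2 / k\<^sup>2) *\<^sub>R L x) (r\<^sup>2 / k\<^sup>2 * k)"
      by (rule similarity0_scale[OF *(1)]) (use r2 k in simp)
    have val: "(sphere_inversion c0 r \<circ> T) (Some y) = Some (c0 + (r\<^sup>2 / k\<^sup>2) *\<^sub>R L (inv0 (y - d)))" if "y \<noteq> d" for y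
    proof -
      have "c + L y - c0 = L (y - d)" by (simp add: linear_diff[OF lin] d)
      moreover have "c + L y \<noteq> c0" using inj[of y d] that d by (auto simp: algebra_simps)
      ultimately show ?thesis
        by (simp add: *(3) sphere_inversion_eq inv0_similarity[OF *(1)])
    qed
    have "moebius_inverted (sphere_inversion c0 r \<circ> T)"
      unfolding moebius_inverted_def
      by (intro exI[of _ c0] exI[of _ "\<lambda>x. (r\<^sup>2 / k\<^sup>2) *\<^sub>R L x"] exI[of _ "r\<^sup>2 / k\<^sup>2 * k"] exI[of _ d] conjI allI impI sim val)
        (simp_all add: * d sN)
    then show ?thesis ..
  next
    assume "moebius_inverted T"
    then obtain c L k d where *: "similarity0 L k" "T None = Some c" "T (Some d) = None"
        "\<And>y. y \<noteq> d \<Longrightarrow> T (Some y) = Some (c + L (inv0 (y - d)))"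
      unfolding moebius_inverted_def by blast
    have lin: "linear L" and k: "k > 0" using *(1) by (auto simp: similarity0_def)
    have inj: "L x = L y \<longleftrightarrow> x = y" for x y
    proof -
      have "norm (L (x - y)) = k * norm (x - y)" using *(1) by (simp add: similarity0_def)
      then show ?thesis using k by (auto simp: linear_diff[OF lin])
    qed
    let ?f = "r\<^sup>2 / k\<^sup>2"
    have f: "?f > 0" using r2 k by simp
    show ?thesis
    proof (cases "c = c0")
      case True
      \<comment> \<open>Here \<open>T\<close> sends infinity to the centre of inversion, so infinity
        becomes a fixed point and the two inversions cancel up to a similarity.\<close>
      have val: "(sphere_inversion c0 r \<circ> T) (Some y) = Some ((c0 - ?f *\<^sub>R L d) + ?f *\<^sub>R L y)" for y
      proof (cases "y = d")
        case True
        then show ?thesis by (simp add: *(3) sN)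
      next
        case False
        have "L (inv0 (y - d)) \<noteq> 0" using inj[of "inv0 (y - d)" 0] False by (simp add: linear_0[OF lin] inv0_eq_0)
        then show ?thesis
          using False \<open>c = c0\<close>
          by (simp add: *(4) sphere_inversion_eq inv0_similarity[OF *(1)] inv0_inv0 linear_diff[OF lin] algebra_simps)
      qed
      have "moebius_affine (sphere_inversion c0 r \<circ> T)"
        unfolding moebius_affine_def
        by (intro exI[of _ "c0 - ?f *\<^sub>R L d"] exI[of _ "\<lambda>x. ?f *\<^sub>R L x"] exI[of _ "?f * k"] conjI allI val similarity0_scale[OF *(1) f])
          (simp add: * True sN)
      then show ?thesis ..
    next
      case False
      \<comment> \<open>With \<open>w0\<close> the inverse point of \<open>m\<close>, the map
        \<open>T\<close> sends d + w0 to the centre \<open>c0\<close>; this is the new point going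
        to infinity.\<close>
      obtain m where m: "L m = c0 - c" using similarity0_surj[OF *(1)] by blast
      have m0: "m \<noteq> 0" using m False by (auto simp: linear_0[OF lin])
      define w0 where "w0 = inv0 m"
      have w0: "w0 \<noteq> 0" "inv0 w0 = m" using m0 by (simp_all add: w0_def inv0_eq_0 inv0_inv0)
      define c1 where "c1 = c0 - ?f *\<^sub>R L w0"
      define L1 where "L1 x = (?f * (norm w0)\<^sup>2) *\<^sub>R L (reflect0 w0 x)" for x
      have L1: "similarity0 L1 (?f * (norm w0)\<^sup>2 * k)"
        unfolding L1_def[abs_def] by (rule similarity0_scale[OF similarity0_reflect(2)[OF *(1) w0(1)]], rule mult_pos_pos[OF f]) (use w0 in simp)
      have vN: "(sphere_inversion c0 r \<circ> T) None = Some c1"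
      proof -
        have "c - c0 = L (- m)" using m by (simp add: linear_neg[OF lin])
        then have "inv0 (c - c0) = (1 / k\<^sup>2) *\<^sub>R L (- w0)" by (simp add: inv0_similarity[OF *(1)] inv0_minus w0_def)
        then show ?thesis using False by (simp add: *(2) sphere_inversion_eq c1_def linear_neg[OF lin])
      qed
      have val: "(sphere_inversion c0 r \<circ> T) (Some y) = Some (c1 + L1 (inv0 (y - (d + w0))))" if y: "y \<noteq> d + w0" for y
      proof (cases "y = d")
        \<comment> \<open>The old pole \<open>d\<close> goes to infinity under \<open>T\<close> and
          then to \<open>c0\<close>; the common formula has to cover it as well.\<close>
        case True
        have "reflect0 w0 (inv0 (- w0)) = (1 / (norm w0)\<^sup>2) *\<^sub>R w0"
          using w0(1) by (simp add: reflect0_def inv0_def power2_norm_eq_inner flip: scaleR_left_diff_distrib diff_divide_distrib)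
        then have "L1 (inv0 (- w0)) = ?f *\<^sub>R L w0" using w0 by (simp add: L1_def linear_scale[OF lin])
        then show ?thesis using True by (simp add: *(3) sN c1_def)
      next
        case False
        define w where "w = y - d"
        have w: "w \<noteq> 0" "w \<noteq> w0" using False y by (auto simp: w_def)
        have e: "c + L (inv0 w) - c0 = L (inv0 w - inv0 w0)" by (simp add: linear_diff[OF lin] w0 m)
        have "inv0 w \<noteq> inv0 w0" using inv0_inv0[of w] inv0_inv0[of w0] w by metis
        then have ne: "c + L (inv0 w) \<noteq> c0" using inj[of "inv0 w" "inv0 w0"] w0 m by (auto simp: algebra_simps)
        have "(sphere_inversion c0 r \<circ> T) (Some y) = Some (c0 + r\<^sup>2 *\<^sub>R inv0 (L (inv0 w - inv0 w0)))"
          using False ne by (simp add: *(4) sphere_inversion_eq e w_def[symmetric])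
        also have "c0 + r\<^sup>2 *\<^sub>R inv0 (L (inv0 w - inv0 w0)) = c1 + L1 (inv0 (w - w0))"
          unfolding inv0_similarity[OF *(1)] inv0_diff[OF w(1) w0(1) w(2)]
          by (simp add: linear_add[OF lin] linear_neg[OF lin] linear_diff[OF lin] linear_scale[OF lin] c1_def L1_def algebra_simps)
        finally show ?thesis by (simp add: w_def algebra_simps)
      qed
      have vd: "(sphere_inversion c0 r \<circ> T) (Some (d + w0)) = None"
        using w0 m by (simp add: *(4) sN)
      have "moebius_inverted (sphere_inversion c0 r \<circ> T)"
        unfolding moebius_inverted_def
        by (intro exI[of _ c1] exI[of _ L1] exI[of _ "?f * (norm w0)\<^sup>2 * k"] exI[of _ "d + w0"] conjI allI impI L1 vN vd val)
      then show ?thesis ..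
    qed
  qed
qed

section \<open>The atlas\<close>

lemma jac2_compose:
  assumes "s differentiable (at z)" "t differentiable (at (s z))"
  shows "jac2 (\<lambda>z. t (s z)) z = jac2 t (s z) * jac2 s z"
  unfolding jac2_def dderiv_compose[OF assms]
    dderiv_coords[OF assms(2), of "dderiv (axis 1 1) s z"] dderiv_coords[OF assms(2), of "dderiv (axis 2 1) s z"]
  by (simp add: algebra_simps)

lemma jac2_cong_open:
  assumes "open S" "z \<in> S" "\<And>y. y \<in> S \<Longrightarrow> s y = t y"
  shows "jac2 s z = jac2 t z"
  unfolding jac2_def using dderiv_cong_open[OF assms] by simp

lemma oriented_transition_iff:
  "oriented_transition (W, x) (V, y) \<longleftrightarrow>
     smooth_on {z \<in> W. x z \<in> y ` V} (\<lambda>z. inv_into V y (x z)) \<and>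
     (\<forall>z\<in>{z \<in> W. x z \<in> y ` V}. jac2 (\<lambda>z. inv_into V y (x z)) z > 0)"
  unfolding oriented_transition_def Let_def jac2_det by (simp add: o_def)

lemma local_paramD:
  assumes "local_param (W, x)"
  shows "open W" "open (x ` W)" "continuous_on W x" "inj_on x W"
    "\<And>U. open U \<Longrightarrow> U \<subseteq> W \<Longrightarrow> open (x ` U)" "\<exists>y. homeomorphism W (x ` W) x y"
proof -
  obtain y where y: "homeomorphism W (x ` W) x y" and o: "open W" "open (x ` W)"
    using assms by (auto simp: local_param_def)
  show "open W" "open (x ` W)" by (rule o)+
  show "continuous_on W x" using y by (simp add: homeomorphism_def)
  show "inj_on x W" by (rule inj_on_inverseI) (rule homeomorphism_apply1[OF y])
  show "open (x ` U)" if "open U" "U \<subseteq> W" for U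
    using homeomorphism_imp_open_map[OF y, of U] o that
    by (metis openin_open_eq openin_subset_trans open_openin openin_open_trans open_subset)
  show "\<exists>y. homeomorphism W (x ` W) x y" using y by blast
qed

lemma open_overlap:
  assumes "local_param (W, x)" "open (y ` V)"
  shows "open {z \<in> W. x z \<in> y ` V}"
proof -
  have "{z \<in> W. x z \<in> y ` V} = W \<inter> x -` (y ` V)" by auto
  then show ?thesis
    using continuous_open_preimage[OF local_paramD(3,1)[OF assms(1)] assms(2)] by simp
qed

text \<open>Maximality of the atlas reduces membership to compatibility with each of its charts. The
  transitions of the new chart are the old ones composed with \<open>s\<close> or with
  \<open>t\<close>.\<close>

lemma reparametrized_in_atlas:
  fixes x :: "real^2 \<Rightarrow> 'm::topological_space"
  assumes A: "oriented_surface A" and Wx: "(W, x) \<in> A"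
    and U: "open U" "U \<subseteq> W" and V: "open V" and hom: "homeomorphism U V t s"
    and t: "smooth_on U t" and s: "smooth_on V s"
    and Jt: "\<And>z. z \<in> U \<Longrightarrow> jac2 t z > 0" and Js: "\<And>z. z \<in> V \<Longrightarrow> jac2 s z > 0"
  shows "(V, x \<circ> s) \<in> A"
proof -
  have lp: "local_param P" if "P \<in> A" for P using A that by (auto simp: oriented_surface_def)
  have tr: "oriented_transition P Q" if "P \<in> A" "Q \<in> A" for P Q using A that by (auto simp: oriented_surface_def)
  have mx: "P \<in> A" if "local_param P" "\<And>Q. Q \<in> A \<Longrightarrow> oriented_transition P Q \<and> oriented_transition Q P" for P
    using A that unfolding oriented_surface_def by blast
  note lx = local_paramD[OF lp[OF Wx]]
  have sV: "s ` V = U" and tU: "t ` U = V" and st: "\<And>z. z \<in> U \<Longrightarrow> s (t z) = z" and ts: "\<And>z. z \<in> V \<Longrightarrow> t (s z) = z"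
    using hom by (auto simp: homeomorphism_def)
  have im: "(x \<circ> s) ` V = x ` U" unfolding image_comp[symmetric] sV ..
  have oU: "open (x ` U)" by (rule lx(5)[OF U])
  have injU: "inj_on (x \<circ> s) V"
    using lx(4) U(2) sV ts by (intro inj_onI) (metis comp_apply image_eqI inj_onD subsetD)
  show ?thesis
  proof (rule mx)
    obtain y where y: "homeomorphism W (x ` W) x y" using lx(6) by blast
    have "homeomorphism U (x ` U) x y"
      by (rule homeomorphism_of_subsets[OF y U(2)]) (use U(2) in auto)
    from homeomorphism_compose[OF homeomorphism_symD[OF hom] this]
    show "local_param (V, x \<circ> s)"
      unfolding local_param_def using V oU im by auto
    fix Q assume Q: "Q \<in> A"
    obtain V' y' where Qe: "Q = (V', y')" by (cases Q)
    have oy: "open (y' ` V')" using local_paramD(2) lp[OF Q] unfolding Qe by blast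
    let ?S1 = "{z \<in> W. x z \<in> y' ` V'}" and ?S2 = "{z \<in> V. (x \<circ> s) z \<in> y' ` V'}"
    have S1: "open ?S1" by (rule open_overlap[OF lp[OF Wx] oy])
    have S2: "open ?S2"
    proof -
      have "?S2 = V \<inter> s -` ?S1" using sV U(2) by auto
      then show ?thesis using continuous_open_preimage[OF smooth_on_continuous[OF s] V S1] by simp
    qed
    have sS: "s ` ?S2 \<subseteq> ?S1" using sV U(2) by auto
    have T1: "smooth_on ?S1 (\<lambda>z. inv_into V' y' (x z))" "\<And>z. z \<in> ?S1 \<Longrightarrow> jac2 (\<lambda>z. inv_into V' y' (x z)) z > 0"
      using tr[OF Wx Q] unfolding Qe oriented_transition_iff by auto
    have s2: "smooth_on ?S2 s" by (rule smooth_on_subset[OF s]) auto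
    have a: "smooth_on ?S2 (\<lambda>z. inv_into V' y' (x (s z)))"
      by (rule smooth_on_compose[OF S2 S1 sS s2 T1(1)])
    have b: "jac2 (\<lambda>z. inv_into V' y' (x (s z))) z > 0" if z: "z \<in> ?S2" for z
    proof -
      have sz: "s z \<in> ?S1" using sS z by blast
      show ?thesis
        using jac2_compose[OF smooth_on_differentiable[OF s2 S2 z] smooth_on_differentiable[OF T1(1) S1 sz]]
          T1(2)[OF sz] Js[of z] z by simp
    qed
    have "oriented_transition (V, x \<circ> s) Q"
      unfolding Qe oriented_transition_iff using a b by (auto simp: o_def)
    moreover have "oriented_transition Q (V, x \<circ> s)"
    proof -
      \<comment> \<open>The new chart covers only part of the image of the old one; smoothness is
        known on the larger overlap \<open>?TW\<close> and restricted to \<open>?T\<close>.\<close>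
      let ?T = "{z \<in> V'. y' z \<in> x ` U}" and ?TW = "{z \<in> V'. y' z \<in> x ` W}"
      have T: "open ?T" "open ?TW"
        using open_overlap[of V' y' x U] open_overlap[of V' y' x W] lp[OF Q] oU lx(2) unfolding Qe by blast+
      have sub: "?T \<subseteq> ?TW" using U(2) by auto
      have T2: "smooth_on ?TW (\<lambda>z. inv_into W x (y' z))" "\<And>z. z \<in> ?TW \<Longrightarrow> jac2 (\<lambda>z. inv_into W x (y' z)) z > 0"
        using tr[OF Q Wx] unfolding Qe oriented_transition_iff by auto
      have inU: "inv_into W x (y' z) \<in> U" if z: "z \<in> ?T" for z
      proof -
        obtain v where v: "v \<in> U" "y' z = x v" using z by blast
        have "inv_into W x (x v) = v" by (rule inv_into_f_f[OF lx(4)]) (use v(1) U(2) in blast)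
        then show ?thesis using v by simp
      qed
      have sm: "smooth_on ?T (\<lambda>z. t (inv_into W x (y' z)))"
        by (rule smooth_on_compose[OF T(1) U(1) _ smooth_on_subset[OF T2(1) sub] t]) (use inU in blast)
      have eq: "t (inv_into W x (y' z)) = inv_into V (x \<circ> s) (y' z)" if z: "z \<in> ?T" for z
      proof -
        obtain v where v: "v \<in> U" "y' z = x v" using z by blast
        have "inv_into W x (x v) = v" by (rule inv_into_f_f[OF lx(4)]) (use v(1) U(2) in blast)
        then have "inv_into W x (y' z) = v" using v by simp
        moreover have "inv_into V (x \<circ> s) (y' z) = t v"
        proof (rule inv_into_f_eq[OF injU])
          show "t v \<in> V" using v tU by auto
          show "(x \<circ> s) (t v) = y' z" using v st by simp
        qed
        ultimately show ?thesis by simp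
      qed
      have j: "jac2 (\<lambda>z. inv_into V (x \<circ> s) (y' z)) z > 0" if z: "z \<in> ?T" for z
      proof -
        have zW: "z \<in> ?TW" using z sub by blast
        have "jac2 (\<lambda>z. t (inv_into W x (y' z))) z > 0"
          using jac2_compose[OF smooth_on_differentiable[OF T2(1) T(2) zW] smooth_on_differentiable[OF t U(1) inU[OF z]]]
            T2(2)[OF zW] Jt[OF inU[OF z]] by simp
        then show ?thesis using jac2_cong_open[OF T(1) z eq] by simp
      qed
      have "smooth_on ?T (\<lambda>z. inv_into V (x \<circ> s) (y' z))"
        by (rule iffD1[OF smooth_on_cong[OF T(1) eq] sm])
      then show ?thesis unfolding Qe oriented_transition_iff im by (intro conjI ballI j)
    qed
    ultimately show "oriented_transition (V, x \<circ> s) Q \<and> oriented_transition Q (V, x \<circ> s)" ..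
  qed
qed

locale surface =
  fixes A :: "'m::topological_space param set"
  assumes A: "oriented_surface A"
begin

lemma local_param: "P \<in> A \<Longrightarrow> local_param P"
  using A by (auto simp: oriented_surface_def)

lemmas chart = local_param[THEN local_paramD(1)] local_param[THEN local_paramD(2)] local_param[THEN local_paramD(3)]
  local_param[THEN local_paramD(4)] local_param[THEN local_paramD(5)]

lemma chart_ex: "\<exists>W x z. (W, x) \<in> A \<and> z \<in> W \<and> x z = p"
proof -
  have "p \<in> (\<Union>(W, x)\<in>A. x ` W)" using A by (simp add: oriented_surface_def)
  then show ?thesis by auto
qed

lemma transition_map:
  assumes "(W, x) \<in> A" "(V, y) \<in> A"
  defines "S \<equiv> {z \<in> V. y z \<in> x ` W}" and "t \<equiv> \<lambda>z. inv_into W x (y z)"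
  shows "open S" "smooth_on S t" "\<And>z. z \<in> S \<Longrightarrow> t z \<in> W" "\<And>z. z \<in> S \<Longrightarrow> x (t z) = y z" "\<And>z. z \<in> S \<Longrightarrow> jac2 t z > 0"
proof -
  show "open S" unfolding S_def by (rule open_overlap[OF local_param[OF assms(2)] chart(2)[OF assms(1)]])
  have "oriented_transition (V, y) (W, x)" using A assms(1,2) unfolding oriented_surface_def by blast
  then show "smooth_on S t" "\<And>z. z \<in> S \<Longrightarrow> jac2 t z > 0"
    unfolding oriented_transition_iff S_def t_def by blast+
  show "t z \<in> W" "x (t z) = y z" if "z \<in> S" for z
    using that unfolding S_def t_def by (auto intro: inv_into_into f_inv_into_f)
qed

lemma immersion_onD:
  assumes "immersion_on A UNIV f" "(W, x) \<in> A"
  shows "smooth_on W (f \<circ> x)" "\<And>z. z \<in> W \<Longrightarrow> inj (frechet_derivative (f \<circ> x) (at z))"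
  using assms by (auto simp: immersion_on_def)

lemma reparametrizationI:
  assumes f: "immersion_on A UNIV f" and W: "(W, x) \<in> A" and V: "(V, y) \<in> A"
  shows "reparametrization W {z \<in> V. y z \<in> x ` W} (f \<circ> x) (\<lambda>z. inv_into W x (y z)) (f \<circ> y)"
proof
  note tm = transition_map[OF W V]
  show "open W" by (rule chart(1)[OF W])
  show "inj (frechet_derivative (f \<circ> x) (at z))" if "z \<in> W" for z
    by (rule immersion_onD(2)[OF f W that])
  show "smooth_on W (f \<circ> x)" using immersion_onD[OF f W] by blast
  show "open {z \<in> V. y z \<in> x ` W}" "smooth_on {z \<in> V. y z \<in> x ` W} (\<lambda>z. inv_into W x (y z))" by (rule tm)+
  fix z assume z: "z \<in> {z \<in> V. y z \<in> x ` W}"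
  show "inv_into W x (y z) \<in> W" "jac2 (\<lambda>z. inv_into W x (y z)) z > 0" using tm z by blast+
  show "(f \<circ> y) z = (f \<circ> x) (inv_into W x (y z))" using tm(4)[OF z] by simp
qed

lemma isothermal_chart_ex:
  fixes f :: "'m \<Rightarrow> 'a::euclidean_space"
  assumes f: "minimal_on A UNIV f"
  shows "\<exists>V y z. (V, y) \<in> A \<and> isothermal V (f \<circ> y) \<and> z \<in> V \<and> y z = p"
proof -
  obtain W x z0 where W: "(W, x) \<in> A" "z0 \<in> W" "x z0 = p" using chart_ex by blast
  have im: "immersion_on A UNIV f" using f by (simp add: minimal_on_def)
  interpret minimal_patch W "f \<circ> x"
    using chart(1)[OF W(1)] immersion_onD[OF im W(1)] f W(1) by unfold_locales (auto simp: minimal_on_def)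
  obtain U V t s where *: "open U" "U \<subseteq> W" "z0 \<in> U" "open V" "homeomorphism U V t s"
    "smooth_on U t" "smooth_on V s" "\<And>z. z \<in> U \<Longrightarrow> jac2 t z > 0" "\<And>y. y \<in> V \<Longrightarrow> jac2 s y > 0"
    "isothermal V (f \<circ> x \<circ> s)"
    using isothermal_coordinates[OF W(2)] by blast
  have "(V, x \<circ> s) \<in> A" by (rule reparametrized_in_atlas[OF A W(1) *(1,2,4,5,6,7,8,9)])
  moreover have "t z0 \<in> V" "s (t z0) = z0" using *(3,5) by (auto simp: homeomorphism_def)
  ultimately show ?thesis using *(10) W(3)
    by (intro exI[of _ V] exI[of _ "x \<circ> s"] exI[of _ "t z0"]) (auto simp: comp_assoc)
qed

end

section \<open>Surfaces with vanishing third fundamental form\<close>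

lemma inner_rvec_cvec: "inner (rvec V) w = 2 * Re (V \<odot> cvec w)"
proof -
  have "complex_of_real (inner (rvec V) w) = (V \<odot> cvec w) + cnj (V \<odot> cvec w)"
    unfolding cvec_inner[symmetric] cvec_rvec by simp
  from arg_cong[OF this, of Re] show ?thesis by (simp del: cnj_cdot)
qed

context iso1_patch
begin

lemma A_continuous: "continuous_on W A" "continuous_on W mu" "continuous_on W cA" "continuous_on W (\<lambda>z. kap z / lam z)"
proof -
  note c = smooth_ph[THEN smooth_on_continuous]
  have l: "continuous_on W lam" unfolding lam_def[abs_def] by (intro continuous_on_cdot continuous_on_ccnj c)
  show m: "continuous_on W mu" unfolding mu_def[abs_def]
    by (intro continuous_on_divide continuous_on_cdot continuous_on_ccnj c l) (use lam(1) in blast)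
  show a: "continuous_on W A" unfolding A_def[abs_def] by (intro continuous_on_diff continuous_on_cscale c m)
  have k: "continuous_on W kap" unfolding kap_def[abs_def] by (intro continuous_on_cdot continuous_on_ccnj a)
  show "continuous_on W cA" unfolding cA_def[abs_def]
    by (intro continuous_on_divide continuous_on_cdot continuous_on_ccnj continuous_Az a k) (use kap(1) in blast)
  show "continuous_on W (\<lambda>z. kap z / lam z)"
    by (intro continuous_on_divide k l) (use lam(1) in blast)
qed

text \<open>If \<open>B\<close> vanishes, \<open>ph\<close> and \<open>A\<close> satisfy a linear total differential equation, to which
  Gronwall's argument applies on segments.\<close>

lemma osculating_constant:
  assumes B0: "\<And>z. z \<in> W \<Longrightarrow> B z = 0" and C: "convex C" "C \<subseteq> W" and z0: "z0 \<in> C"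
    and init: "ph z0 \<odot> cvec w = 0" "A z0 \<odot> cvec w = 0" and z1: "z1 \<in> C"
  shows "ph z1 \<odot> cvec w = 0 \<and> A z1 \<odot> cvec w = 0"
proof -
  define F where "F z = ph z \<odot> cvec w" for z
  define G where "G z = A z \<odot> cvec w" for z
  \<comment> \<open>Squared length of the pair of coefficients \<open>F\<close>, \<open>G\<close>;
    this is the quantity for the Gronwall estimate.\<close>
  define N where "N z = F z * cnj (F z) + G z * cnj (G z)" for z
  define dl where "dl = cpx (z1 - z0)"
  define c where "c r = z0 + r *\<^sub>R (z1 - z0)" for r :: real
  have cC: "c r \<in> C" if "0 \<le> r" "r \<le> 1" for r
    using convexD_alt[OF C(1) z0 z1, of r] that by (simp add: c_def algebra_simps)
  have cW: "c r \<in> W" if "0 \<le> r" "r \<le> 1" for r using cC[OF that] C(2) by blast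
  have wF: "wd F (G z + mu z * F z) 0 z" if "z \<in> W" for z
    unfolding F_def[abs_def] G_def
    by (rule wd_eq[OF wd_cdot[OF vwd_ph[OF that] vwd_const]]) (simp_all add: ph1_eq)
  have wG: "wd G (cA z * G z) (- (kap z / lam z) * F z) z" if "z \<in> W" for z
    unfolding G_def[abs_def] F_def
    by (rule wd_eq[OF wd_cdot[OF vwd_A'[OF that] vwd_const]]) (simp_all add: B0[OF that])
  define Nz where "Nz z = (G z + mu z * F z) * cnj (F z) + (cA z * (G z * cnj (G z)) - G z * (kap z / lam z) * cnj (F z))" for z
  have wN: "wd N (Nz z) (cnj (Nz z)) z" if "z \<in> W" for z
    unfolding N_def[abs_def]
    by (rule wd_eq[OF wd_add[OF wd_mult[OF wF[OF that] wd_cnj[OF wF[OF that]]] wd_mult[OF wG[OF that] wd_cnj[OF wG[OF that]]]]])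
      (use lam(3)[OF that] kap(3)[OF that] in \<open>simp_all add: Nz_def algebra_simps\<close>)
  have bound: "\<exists>M\<ge>0. \<forall>r\<in>{0..1}. norm (H (c r)) \<le> M" if "continuous_on W H" for H :: "real^2 \<Rightarrow> complex"
  proof -
    have "continuous_on {0..1} (\<lambda>r. H (c r))"
      by (rule continuous_on_compose2[OF that]) (use cW in \<open>auto simp: c_def intro!: continuous_intros\<close>)
    then have "bounded ((\<lambda>r. H (c r)) ` {0..1})"
      by (intro compact_imp_bounded compact_continuous_image) auto
    then show ?thesis unfolding bounded_pos by (auto intro: less_imp_le)
  qed
  obtain M1 where M1: "M1 \<ge> 0" "\<And>r. r \<in> {0..1} \<Longrightarrow> norm (mu (c r)) \<le> M1" using bound[OF A_continuous(2)] by blast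
  obtain M2 where M2: "M2 \<ge> 0" "\<And>r. r \<in> {0..1} \<Longrightarrow> norm (cA (c r)) \<le> M2" using bound[OF A_continuous(3)] by blast
  obtain M3 where M3: "M3 \<ge> 0" "\<And>r. r \<in> {0..1} \<Longrightarrow> norm (kap (c r) / lam (c r)) \<le> M3" using bound[OF A_continuous(4)] by blast
  \<comment> \<open>The 1 is the coefficient of \<open>G\<close> in the derivative of
    \<open>F\<close>; the other summands bound the remaining coefficients of the system along the
    segment.\<close>
  define M where "M = 1 + M1 + M2 + M3"
  define n where "n r = Re (N (c r))" for r
  have n_eq: "n r = (norm (F (c r)))\<^sup>2 + (norm (G (c r)))\<^sup>2" for r
    by (simp add: n_def N_def complex_norm_square[symmetric])
  have Nz_bound: "norm (Nz (c r)) \<le> M * n r" if r: "r \<in> {0..1}" for r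
  proof -
    let ?f = "norm (F (c r))" and ?g = "norm (G (c r))"
    have "2 * (?g * ?f) \<le> ?g\<^sup>2 + ?f\<^sup>2" using sum_squares_bound[of ?g ?f] by (simp only: mult.assoc)
    moreover have "?g * ?f \<ge> 0" by simp
    ultimately have fg: "?g * ?f \<le> n r" unfolding n_eq by linarith
    have ff: "?f * ?f \<le> n r" "?g * ?g \<le> n r" unfolding n_eq by (simp_all add: power2_eq_square)
    have n0: "n r \<ge> 0" unfolding n_eq by simp
    have "norm (Nz (c r)) \<le> norm ((G (c r) + mu (c r) * F (c r)) * cnj (F (c r)))
        + (norm (cA (c r) * (G (c r) * cnj (G (c r)))) + norm (G (c r) * (kap (c r) / lam (c r)) * cnj (F (c r))))"
      unfolding Nz_def by (meson add_left_mono norm_triangle_ineq norm_triangle_ineq4 order_trans)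
    also have "\<dots> \<le> (?g * ?f + norm (mu (c r)) * (?f * ?f)) + (norm (cA (c r)) * (?g * ?g) + norm (kap (c r) / lam (c r)) * (?g * ?f))"
    proof -
      have "norm ((G (c r) + mu (c r) * F (c r)) * cnj (F (c r))) \<le> (?g + norm (mu (c r)) * ?f) * ?f"
        unfolding norm_mult[of _ "cnj _"] by (intro mult_mono) (auto simp: norm_mult[symmetric] norm_triangle_ineq)
      then show ?thesis by (simp add: norm_mult norm_divide algebra_simps)
    qed
    also have "\<dots> \<le> (n r + M1 * n r) + (M2 * n r + M3 * n r)"
      by (intro add_mono mult_mono fg ff M1 M2 M3 r n0) auto
    finally show ?thesis by (simp add: M_def algebra_simps)
  qed
  define K where "K = 2 * norm dl * M"
  have dn: "(n has_real_derivative 2 * Re (Nz (c r) * dl)) (at r)" if "0 \<le> r" "r \<le> 1" for r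
  proof -
    have dc: "(c has_derivative (\<lambda>x. x *\<^sub>R (z1 - z0))) (at r)"
      unfolding c_def[abs_def] by (auto intro!: derivative_eq_intros)
    have "((\<lambda>r. Re (N (c r))) has_derivative (\<lambda>x. Re (Nz (c r) * cpx (x *\<^sub>R (z1 - z0)) + cnj (Nz (c r)) * cnj (cpx (x *\<^sub>R (z1 - z0)))))) (at r)"
      using diff_chain_at[OF dc wN[OF cW[OF that], unfolded wd_def]]
      by (intro bounded_linear.has_derivative[OF bounded_linear_Re]) (simp add: o_def)
    moreover have "Re (Nz (c r) * cpx (x *\<^sub>R (z1 - z0)) + cnj (Nz (c r)) * cnj (cpx (x *\<^sub>R (z1 - z0)))) = 2 * Re (Nz (c r) * dl) * x" for x
      unfolding cpx_simps dl_def[symmetric] by (simp add: algebra_simps)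
    ultimately show ?thesis unfolding n_def[abs_def] has_field_derivative_def by simp
  qed
  have dn_le: "2 * Re (Nz (c r) * dl) \<le> K * n r" if "0 \<le> r" "r \<le> 1" for r
  proof -
    have "Re (Nz (c r) * dl) \<le> norm (Nz (c r)) * norm dl" by (metis complex_Re_le_cmod norm_mult)
    also have "\<dots> \<le> M * n r * norm dl" using Nz_bound[of r] that by (intro mult_right_mono) auto
    finally show ?thesis by (simp add: K_def algebra_simps)
  qed
  \<comment> \<open>Gronwall: the derivative of \<open>n\<close> is at most K n, so n times exp(-K
    r) does not increase. It starts at 0 and \<open>n\<close> is nonnegative.\<close>
  have "exp (- K * 1) * n 1 \<le> exp (- K * 0) * n 0"
  proof (rule DERIV_nonpos_imp_nonincreasing[of 0 1 "\<lambda>r. exp (- K * r) * n r"])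
    fix r :: real assume r: "0 \<le> r" "r \<le> 1"
    have "((\<lambda>r. exp (- K * r) * n r) has_real_derivative (exp (- K * r) * (- K) * n r + 2 * Re (Nz (c r) * dl) * exp (- K * r))) (at r)"
      by (intro DERIV_mult dn[OF r]) (auto intro!: derivative_eq_intros)
    moreover have "exp (- K * r) * (- K) * n r + 2 * Re (Nz (c r) * dl) * exp (- K * r) = exp (- K * r) * (2 * Re (Nz (c r) * dl) - K * n r)"
      by (simp add: algebra_simps)
    moreover have "\<dots> \<le> 0" using dn_le[OF r] by (simp add: mult_le_0_iff)
    ultimately show "\<exists>y. ((\<lambda>r. exp (- K * r) * n r) has_real_derivative y) (at r) \<and> y \<le> 0" by metis
  qed simp
  moreover have "n 0 = 0" using init by (simp add: n_eq c_def F_def G_def)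
  ultimately have "n 1 \<le> 0" by (simp add: mult_le_0_iff)
  then have "F z1 = 0" "G z1 = 0" unfolding n_eq c_def
    by (simp_all add: add_nonneg_eq_0_iff flip: less_eq_real_def) (smt (verit) norm_eq_zero power2_eq_iff_nonneg zero_le_power2 zero_eq_power2)+
  then show ?thesis by (simp add: F_def G_def)
qed

text \<open>Two complex equations amount to four real ones, given by the real and imaginary parts of
  \<open>ph\<close> and \<open>A\<close>, which leaves a direction in dimension at least
  five.\<close>

lemma normal_vector_ex:
  assumes "CARD('n) \<ge> 5"
  shows "\<exists>w::real^'n. w \<noteq> 0 \<and> ph z \<odot> cvec w = 0 \<and> A z \<odot> cvec w = 0"
proof -
  let ?X = "{rvec (ph z), rvec (\<i> *s ph z), rvec (A z), rvec (\<i> *s A z)}"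
  have "dim ?X \<le> card ?X" by (rule dim_le_card') simp
  also have "card ?X \<le> 4" by (simp add: card_insert_if)
  finally have "dim ?X < DIM(real^'n)" using assms by simp
  then obtain w where w: "w \<noteq> 0" "\<And>y. y \<in> span ?X \<Longrightarrow> orthogonal w y"
    using orthogonal_to_subspace_exists by blast
  have perp: "inner y w = 0" if "y \<in> ?X" for y
    using w(2)[OF span_base[OF that]] by (simp add: orthogonal_def inner_commute)
  have "Re (ph z \<odot> cvec w) = 0" "Re ((\<i> *s ph z) \<odot> cvec w) = 0" "Re (A z \<odot> cvec w) = 0" "Re ((\<i> *s A z) \<odot> cvec w) = 0"
    using perp[of "rvec (ph z)"] perp[of "rvec (\<i> *s ph z)"] perp[of "rvec (A z)"] perp[of "rvec (\<i> *s A z)"]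
    by (simp_all add: inner_rvec_cvec del: cdot_linear)
  then have "ph z \<odot> cvec w = 0 \<and> A z \<odot> cvec w = 0" by (simp add: complex_eq_iff)
  then show ?thesis using w(1) by blast
qed

lemma height_constant:
  assumes B0: "\<And>z. z \<in> W \<Longrightarrow> B z = 0" and C: "convex C" "C \<subseteq> W" and z0: "z0 \<in> C"
    and init: "ph z0 \<odot> cvec w = 0" "A z0 \<odot> cvec w = 0" and z1: "z1 \<in> C"
  shows "inner (u z1) w = inner (u z0) w"
proof -
  have "((\<lambda>z. inner (u z) w) has_derivative (\<lambda>h. 0)) (at z within C)" if z: "z \<in> C" for z
  proof -
    have zW: "z \<in> W" using z C by blast
    have "inner (dderiv v u z) w = 0" for v
      unfolding D1[OF zW] inner_rvec_cvec using osculating_constant[OF B0 C z0 init z] by simp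
    then have "((\<lambda>z. inner (u z) w) has_derivative (\<lambda>h. 0)) (at z)"
      using has_derivative_inner_left[OF has_derivative_dderiv[OF diff_u[OF zW]], of w] by simp
    then show ?thesis by (rule has_derivative_at_withinI)
  qed
  from has_derivative_zero_constant[OF C(1) this] obtain k where "\<And>z. z \<in> C \<Longrightarrow> inner (u z) w = k" by blast
  then show ?thesis using z0 z1 by simp
qed

text \<open>Differentiating a constant height twice recovers the initial data of
  \<open>osculating_constant\<close>, so the constancy can be continued into the next chart.\<close>

lemma height_zero_open:
  assumes N: "open N" "N \<subseteq> W" "z0 \<in> N" "\<And>z. z \<in> N \<Longrightarrow> inner (u z) w = k"
  shows "ph z0 \<odot> cvec w = 0 \<and> A z0 \<odot> cvec w = 0"
proof -
  have ph0: "ph z \<odot> cvec w = 0" if z: "z \<in> N" for z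
  proof (rule wd_const_on(1)[OF N(1) z])
    show "cvec (u y) \<odot> cvec w = of_real k" if "y \<in> N" for y
      using N(4)[OF that] by (simp add: cvec_inner)
    have "z \<in> W" using z N by blast
    then show "wd (\<lambda>y. cvec (u y) \<odot> cvec w) (ph z \<odot> cvec w) (ccnj (ph z) \<odot> cvec w) z"
      by (intro wd_eq[OF wd_cdot[OF vwd_u vwd_const]]) simp_all
  qed
  have z0W: "z0 \<in> W" using N by blast
  have "ph1 z0 \<odot> cvec w = 0"
    by (rule wd_const_on(1)[OF N(1,3) ph0 wd_eq[OF wd_cdot[OF vwd_ph[OF z0W] vwd_const]]]) simp_all
  then show ?thesis using ph0[OF N(3)] by (simp add: A_def)
qed

end

section \<open>The main theorem\<close>

lemma similarity0_inner:
  assumes "similarity0 L k"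
  shows "inner (L a) (L b) = k\<^sup>2 * inner a b"
proof -
  have lin: "linear L" and n: "norm (L v) = k * norm v" for v using assms by (auto simp: similarity0_def)
  have sq: "inner (L v) (L v) = k\<^sup>2 * inner v v" for v
    using n[of v] by (simp add: power2_norm_eq_inner[symmetric] power_mult_distrib)
  have "inner (L (a + b)) (L (a + b)) = k\<^sup>2 * inner (a + b) (a + b)" by (rule sq)
  then have "2 * inner (L a) (L b) = 2 * (k\<^sup>2 * inner a b)"
    using sq[of a] sq[of b]
    by (simp add: linear_add[OF lin] inner_add_left inner_add_right inner_commute[of "L b" "L a"] inner_commute[of b a] algebra_simps)
  then show ?thesis by simp
qed

text \<open>Minimality means harmonicity in isothermal coordinates only. A similarity keeps
  coordinates isothermal, so the image is harmonic, and injectivity of \<open>L\<close> transfers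
  this to \<open>s\<close>.\<close>

lemma harmonic_of_similar:
  fixes s F :: "real^2 \<Rightarrow> real^'n"
  assumes S: "open S" and s: "smooth_on S s" and L: "similarity0 L k"
    and F: "\<And>z. z \<in> S \<Longrightarrow> F z = c + L (s z)" and iso: "isothermal S s" and min: "minimal_patch S F" and z: "z \<in> S"
  shows "dderiv (axis 1 1) (dderiv (axis 1 1) s) z + dderiv (axis 2 1) (dderiv (axis 2 1) s) z = 0"
proof -
  have lin: "linear L" using L by (simp add: similarity0_def)
  then have bl: "bounded_linear L" by (simp add: linear_conv_bounded_linear)
  have d1: "dderiv v F z = L (dderiv v s z)" if z: "z \<in> S" for v z
  proof -
    have "dderiv v F z = dderiv v (\<lambda>z. c + L (s z)) z" by (rule dderiv_cong_open[OF S z F])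
    also have "\<dots> = L (dderiv v s z)"
      by (rule dderiv_eq) (auto intro!: derivative_eq_intros bounded_linear.has_derivative[OF bl smooth_on_has_derivative[OF s S z]])
    finally show ?thesis .
  qed
  have d2: "dderiv w (dderiv v F) z = L (dderiv w (dderiv v s) z)" for v w
  proof -
    have "dderiv w (dderiv v F) z = dderiv w (\<lambda>z. L (dderiv v s z)) z" by (rule dderiv_cong_open[OF S z d1])
    also have "\<dots> = L (dderiv w (dderiv v s) z)"
      by (rule dderiv_eq) (rule bounded_linear.has_derivative[OF bl smooth_on_has_derivative[OF smooth_on_dderiv[OF s] S z]])
    finally show ?thesis .
  qed
  interpret F: minimal_patch S F by (rule min)
  have "isothermal S F"
    using iso unfolding isothermal_def induced_metric_def by (simp add: d1 similarity0_inner[OF L])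
  then interpret F: iso_patch S F by unfold_locales
  have "L (dderiv (axis 1 1) (dderiv (axis 1 1) s) z + dderiv (axis 2 1) (dderiv (axis 2 1) s) z) = 0"
    using F.harmonic[OF z] unfolding d2 by (simp add: linear_add[OF lin])
  then have "k * norm (dderiv (axis 1 1) (dderiv (axis 1 1) s) z + dderiv (axis 2 1) (dderiv (axis 2 1) s) z) = 0"
    using L unfolding similarity0_def by (metis norm_zero)
  then show ?thesis using L by (simp add: similarity0_def)
qed

context pedal_surface_patch
begin

lemma isothermal_g: "isothermal W g"
  unfolding isothermal_def by (simp add: induced_metric_g axis_def)

lemma not_conformally_minimal:
  assumes S: "open S" "S \<subseteq> W" "S \<noteq> {}" and B0: "\<And>z. z \<in> S \<Longrightarrow> B z \<noteq> 0"
    and T: "T \<in> moebius_group" "\<And>z. z \<in> S \<Longrightarrow> T (Some (g z)) \<noteq> None"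
  shows "\<not> minimal_patch S (\<lambda>z. the (T (Some (g z))))"
proof
  let ?F = "\<lambda>z. the (T (Some (g z)))"
  assume min: "minimal_patch S ?F"
  have SW: "z \<in> W" if "z \<in> S" for z using that S by blast
  have sg: "smooth_on S g" by (rule smooth_on_subset[OF smooth_g S(2)])
  obtain z0 where z0: "z0 \<in> S" using S by blast
  from moebius_group_cases[OF T(1)] show False
  proof
    assume "moebius_affine T"
    then obtain c L k where L: "similarity0 L k" "\<And>y. T (Some y) = Some (c + L y)"
      unfolding moebius_affine_def by blast
    have iso: "isothermal S g" using isothermal_g S(2) by (auto simp: isothermal_def)
    have "dderiv e1 (dderiv e1 g) z0 + dderiv e2 (dderiv e2 g) z0 = 0"
      by (rule harmonic_of_similar[OF S(1) sg L(1) _ iso min z0]) (simp add: L(2))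
    then show False using g_not_harmonic[OF SW[OF z0]] by blast
  next
    assume "moebius_inverted T"
    then obtain c L k d where L: "similarity0 L k" "T (Some d) = None"
        "\<And>y. y \<noteq> d \<Longrightarrow> T (Some y) = Some (c + L (inv0 (y - d)))"
      unfolding moebius_inverted_def by blast
    have d: "g z \<noteq> d" if "z \<in> S" for z using T(2)[OF that] L(2) by auto
    define s where "s y = (1 / (norm (g y - d))\<^sup>2) *\<^sub>R (g y - d)" for y
    have ss: "smooth_on S s"
      unfolding s_def[abs_def] power2_norm_eq_inner using d
      by (intro smooth_on_scaleR[OF S(1)] smooth_on_divide[OF S(1)] smooth_on_const smooth_on_inner[OF S(1)]
          smooth_on_diff[OF S(1)] sg) auto
    have ds: "dderiv v s z = rvec (cpx v *s inv_g1 d z)" if z: "z \<in> S" for v z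
    proof -
      have "vwd (\<lambda>y. cvec (s y)) (inv_g1 d z) (ccnj (inv_g1 d z)) z"
        unfolding s_def by (rule vwd_inverted[OF SW[OF z] d[OF z]])
      from vwd_dderiv_cvec[OF this smooth_on_differentiable[OF ss S(1) z], of v]
      show ?thesis by (simp flip: cvec_eq_rvec)
    qed
    have iso: "isothermal S s"
      unfolding isothermal_def
      using rvec_null_metric[OF inv_g1_null[OF SW d] ds] by (auto simp: axis_def)
    have h: "dderiv e1 (dderiv e1 s) z + dderiv e2 (dderiv e2 s) z = 0" if z: "z \<in> S" for z
      by (rule harmonic_of_similar[OF S(1) ss L(1) _ iso min z]) (simp add: L(3) d s_def inv0_def)
    show False
      by (rule inverted_not_harmonic[OF S B0 d ss[unfolded s_def[abs_def]] h[unfolded s_def[abs_def]]])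
  qed
qed

end

section \<open>From isothermal charts to the whole surface\<close>

locale pedal_setting = surface A for A :: "'m::topological_space param set" +
  fixes f g :: "'m \<Rightarrow> real^'n" and q :: "real^'n"
  assumes imm_f: "immersion_on A UNIV f" and isotropic_f: "isotropic A 1 f"
    and pedal: "pedal_surface A f q g" and imm_g: "immersion_on A UNIV g"
begin

definition iso_chart :: "(real^2) set \<Rightarrow> (real^2 \<Rightarrow> 'm) \<Rightarrow> bool" where
  "iso_chart W x \<longleftrightarrow> (W, x) \<in> A \<and> isothermal W (f \<circ> x)"

lemma minimal_f: "minimal_on A UNIV f"
  using isotropic_f by (simp add: isotropic_def)

lemma iso_chart_ex: "\<exists>W x z. iso_chart W x \<and> z \<in> W \<and> x z = p"
  unfolding iso_chart_def using isothermal_chart_ex[OF minimal_f, of p] by blast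

lemma patch:
  assumes "iso_chart W x"
  shows "pedal_surface_patch W (f \<circ> x) q (g \<circ> x)"
proof -
  have W: "(W, x) \<in> A" and iso: "isothermal W (f \<circ> x)" using assms by (auto simp: iso_chart_def)
  interpret p: iso_patch W "f \<circ> x"
    using chart(1)[OF W] immersion_onD[OF imm_f W] minimal_f W iso by unfold_locales (auto simp: minimal_on_def)
  have "dim (kth_normal_space (f \<circ> x) 1 z) = 2 \<and>
        (\<forall>X. induced_metric (f \<circ> x) z X X = 1 \<longrightarrow> is_circle (curvature_ellipse (f \<circ> x) 1 z X))" if "z \<in> W" for z
    using isotropic_f W that unfolding isotropic_def by fastforce
  then have A1: "p.A z \<odot> p.A z = 0 \<and> p.A z \<noteq> 0" if "z \<in> W" for z
    using p.isotropic_1_iff[OF that] that by blast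
  have ped: "(g \<circ> x) z = orth_proj ((+) ((f \<circ> x) z) ` tangent_space (f \<circ> x) z) q" if "z \<in> W" for z
    using pedal W that unfolding pedal_surface_def by auto
  show ?thesis
    by unfold_locales (use A1 ped immersion_onD[OF imm_g W] in blast)+
qed

text \<open>\<open>B\<close> has this meaning in isothermal charts alone. For an arbitrary chart,
  dimension and ellipse are compared with those at the same point in an isothermal chart.\<close>

lemma B_iff_isotropic_2:
  "isotropic A 2 f \<longleftrightarrow> (\<forall>W x z. iso_chart W x \<and> z \<in> W \<longrightarrow>
     iso1_patch.B (f \<circ> x) z \<odot> iso1_patch.B (f \<circ> x) z = 0 \<and> iso1_patch.B (f \<circ> x) z \<noteq> 0)"
proof
  assume i2: "isotropic A 2 f"
  show "\<forall>W x z. iso_chart W x \<and> z \<in> W \<longrightarrow>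
     iso1_patch.B (f \<circ> x) z \<odot> iso1_patch.B (f \<circ> x) z = 0 \<and> iso1_patch.B (f \<circ> x) z \<noteq> 0"
  proof (intro allI impI, elim conjE)
    fix W x z assume ic: "iso_chart W x" and z: "z \<in> W"
    interpret p: pedal_surface_patch W "f \<circ> x" q "g \<circ> x" by (rule patch[OF ic])
    have "dim (kth_normal_space (f \<circ> x) 2 z) = 2 \<and>
        (\<forall>X. induced_metric (f \<circ> x) z X X = 1 \<longrightarrow> is_circle (curvature_ellipse (f \<circ> x) 2 z X))"
      using i2 ic z unfolding isotropic_def iso_chart_def by fastforce
    then show "p.B z \<odot> p.B z = 0 \<and> p.B z \<noteq> 0" using p.isotropic_2_iff[OF z] by blast
  qed
next
  assume B: "\<forall>W x z. iso_chart W x \<and> z \<in> W \<longrightarrow>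
     iso1_patch.B (f \<circ> x) z \<odot> iso1_patch.B (f \<circ> x) z = 0 \<and> iso1_patch.B (f \<circ> x) z \<noteq> 0"
  have two: "dim (kth_normal_space (f \<circ> y) 2 z) = 2 \<and>
        (\<forall>X. induced_metric (f \<circ> y) z X X = 1 \<longrightarrow> is_circle (curvature_ellipse (f \<circ> y) 2 z X))"
    if V: "(V, y) \<in> A" "z \<in> V" for V y z
  proof -
    obtain W x z0 where ic: "iso_chart W x" "z0 \<in> W" "x z0 = y z" using iso_chart_ex by blast
    interpret p: pedal_surface_patch W "f \<circ> x" q "g \<circ> x" by (rule patch[OF ic(1)])
    have W: "(W, x) \<in> A" using ic by (simp add: iso_chart_def)
    interpret r: reparametrization W "{z \<in> V. y z \<in> x ` W}" "f \<circ> x" "\<lambda>z. inv_into W x (y z)" "f \<circ> y"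
      by (rule reparametrizationI[OF imm_f W V(1)])
    let ?t = "\<lambda>z. inv_into W x (y z)"
    have z: "z \<in> {z \<in> V. y z \<in> x ` W}" using V(2) ic by (metis (mono_tags, lifting) imageI mem_Collect_eq)
    have tz: "?t z \<in> W" by (rule r.t_mem[OF z])
    have E: "2 * Re (p.lam (?t z)) > 0" using p.lam(2)[OF tz] by simp
    have i2: "dim (kth_normal_space (f \<circ> x) 2 (?t z)) = 2"
        "\<And>X. induced_metric (f \<circ> x) (?t z) X X = 1 \<Longrightarrow> is_circle (curvature_ellipse (f \<circ> x) 2 (?t z) X)"
      using p.isotropic_2_iff[OF tz] B ic(1) tz by blast+
    show ?thesis
      using i2 r.kth_normal_space_2_u'[OF z] r.induced_metric_u'[OF z]
        r.curvature_ellipse_u'[OF z E p.induced_metric_eq[OF tz], of 2] by simp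
  qed
  have "\<forall>z\<in>V. dim (kth_normal_space (f \<circ> y) r z) = 2 \<and>
        (\<forall>X. induced_metric (f \<circ> y) z X X = 1 \<longrightarrow> is_circle (curvature_ellipse (f \<circ> y) r z X))"
    if r: "r \<in> {1..2}" and V: "(V, y) \<in> A" for r V y
  proof -
    have "r = 1 \<or> r = 2" using r by auto
    then show ?thesis
    proof
      assume "r = 1"
      then show ?thesis using isotropic_f V unfolding isotropic_def by fastforce
    next
      assume "r = 2"
      then show ?thesis using two[OF V] by blast
    qed
  qed
  then show "isotropic A 2 f"
    unfolding isotropic_def using minimal_f by fast
qed

lemma superconformal_iff_charts:
  "superconformal A g \<longleftrightarrow> (\<forall>W x z. iso_chart W x \<and> z \<in> W \<longrightarrow>
     is_circle {sff (g \<circ> x) X X z |X. induced_metric (g \<circ> x) z X X = 1})"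
proof
  assume "superconformal A g"
  then show "\<forall>W x z. iso_chart W x \<and> z \<in> W \<longrightarrow>
     is_circle {sff (g \<circ> x) X X z |X. induced_metric (g \<circ> x) z X X = 1}"
    unfolding superconformal_def iso_chart_def by fast
next
  assume sc: "\<forall>W x z. iso_chart W x \<and> z \<in> W \<longrightarrow>
     is_circle {sff (g \<circ> x) X X z |X. induced_metric (g \<circ> x) z X X = 1}"
  show "superconformal A g"
    unfolding superconformal_def
  proof clarify
    fix V y z assume V: "(V, y) \<in> A" "z \<in> V"
    obtain W x z0 where ic: "iso_chart W x" "z0 \<in> W" "x z0 = y z" using iso_chart_ex by blast
    have W: "(W, x) \<in> A" using ic by (simp add: iso_chart_def)
    interpret r: reparametrization W "{z \<in> V. y z \<in> x ` W}" "g \<circ> x" "\<lambda>z. inv_into W x (y z)" "g \<circ> y"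
      by (rule reparametrizationI[OF imm_g W V(1)])
    have z: "z \<in> {z \<in> V. y z \<in> x ` W}" using V(2) ic by (metis (mono_tags, lifting) imageI mem_Collect_eq)
    show "is_circle {sff (g \<circ> y) X X z |X. induced_metric (g \<circ> y) z X X = 1}"
      unfolding r.unit_sff_u'[OF z] using sc ic(1) r.t_mem[OF z] by blast
  qed
qed

text \<open>Otherwise a vector normal to the osculating space at one point has constant height
  locally, and connectedness spreads this, placing all of \<open>f\<close> in a hyperplane.\<close>

lemma B_nonzero_somewhere:
  assumes conn: "connected (UNIV :: 'm set)" and sub: "substantial f" and n: "CARD('n) \<ge> 5"
  shows "\<exists>W x z. iso_chart W x \<and> z \<in> W \<and> iso1_patch.B (f \<circ> x) z \<noteq> 0"
proof (rule ccontr)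
  assume "\<not> ?thesis"
  then have B0: "iso1_patch.B (f \<circ> x) z = 0" if "iso_chart W x" "z \<in> W" for W x z using that by blast
  obtain W0 x0 z0 where ic0: "iso_chart W0 x0" "z0 \<in> W0" using iso_chart_ex by blast
  interpret p0: pedal_surface_patch W0 "f \<circ> x0" q "g \<circ> x0" by (rule patch[OF ic0(1)])
  obtain w where w: "w \<noteq> 0" "p0.ph z0 \<odot> cvec w = 0" "p0.A z0 \<odot> cvec w = 0"
    using p0.normal_vector_ex[OF n] by blast
  define k where "k = inner (f (x0 z0)) w"
  \<comment> \<open>The interior of the level set of the height; it is open by construction, and
    closedness remains to be shown.\<close>
  define S where "S = \<Union>{N. open N \<and> (\<forall>p\<in>N. inner (f p) w = k)}"
  have oS: "open S" unfolding S_def by (intro open_Union) auto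
  have Sk: "inner (f p) w = k" if "p \<in> S" for p using that unfolding S_def by blast
  have ball: "\<exists>r>0. ball z r \<subseteq> W \<and> open (x ` ball z r)" if ic: "iso_chart W x" and z: "z \<in> W" for W x z
  proof -
    have W: "(W, x) \<in> A" using ic by (simp add: iso_chart_def)
    obtain r where "r > 0" "ball z r \<subseteq> W" using chart(1)[OF W] z openE by blast
    then show ?thesis using chart(5)[OF W, of "ball z r"] by auto
  qed
  have "x0 z0 \<in> S"
  proof -
    obtain r where r: "r > 0" "ball z0 r \<subseteq> W0" "open (x0 ` ball z0 r)" using ball[OF ic0] by blast
    have "inner (f p) w = k" if p: "p \<in> x0 ` ball z0 r" for p
    proof -
      obtain z1 where z1: "z1 \<in> ball z0 r" "p = x0 z1" using p by blast
      have "inner ((f \<circ> x0) z1) w = inner ((f \<circ> x0) z0) w"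
        by (rule p0.height_constant[OF B0[OF ic0(1)] convex_ball r(2) _ w(2,3) z1(1)]) (use r(1) in simp_all)
      then show ?thesis by (simp add: k_def z1(2))
    qed
    then show ?thesis unfolding S_def using r by (intro UnionI[of "x0 ` ball z0 r"]) auto
  qed
  moreover have "open (- S)"
  proof (subst open_subopen, intro ballI)
    fix p assume p: "p \<in> - S"
    obtain W x z where ic: "iso_chart W x" "z \<in> W" "x z = p" using iso_chart_ex by blast
    interpret c: pedal_surface_patch W "f \<circ> x" q "g \<circ> x" by (rule patch[OF ic(1)])
    have W: "(W, x) \<in> A" using ic by (simp add: iso_chart_def)
    obtain r where r: "r > 0" "ball z r \<subseteq> W" "open (x ` ball z r)" using ball[OF ic(1,2)] by blast
    \<comment> \<open>If the coordinate ball met \<open>S\<close>, the data at a common point would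
      propagate over the whole ball, including \<open>p\<close>.\<close>
    have "x ` ball z r \<inter> S = {}"
    proof (rule ccontr)
      assume "x ` ball z r \<inter> S \<noteq> {}"
      then obtain z' where z': "z' \<in> ball z r" "x z' \<in> S" by blast
      let ?N = "ball z r \<inter> (W \<inter> x -` S)"
      have N: "open ?N" "?N \<subseteq> W" "z' \<in> ?N"
        using continuous_open_preimage[OF chart(3)[OF W] chart(1)[OF W] oS] z' r(2) by (auto intro: open_Int)
      have init: "c.ph z' \<odot> cvec w = 0" "c.A z' \<odot> cvec w = 0"
        using c.height_zero_open[OF N, of w k] Sk by auto
      have "inner (f p') w = k" if p': "p' \<in> x ` ball z r" for p'
      proof -
        obtain z1 where z1: "z1 \<in> ball z r" "p' = x z1" using p' by blast
        have "inner ((f \<circ> x) z1) w = inner ((f \<circ> x) z') w"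
          by (rule c.height_constant[OF B0[OF ic(1)] convex_ball r(2) z'(1) init z1(1)])
        then show ?thesis using Sk[OF z'(2)] z1(2) by simp
      qed
      then have "x ` ball z r \<subseteq> S" unfolding S_def using r(3) by blast
      moreover have "p \<in> x ` ball z r" by (rule image_eqI[of _ _ z]) (use ic(3) r(1) in auto)
      ultimately show False using p by blast
    qed
    then show "\<exists>T. open T \<and> p \<in> T \<and> T \<subseteq> - S"
      using r ic(3) by (intro exI[of _ "x ` ball z r"]) auto
  qed
  ultimately have "S = UNIV"
    using connectedD[OF conn oS, of "- S"] by auto
  then have "range f \<subseteq> {y. inner w y = k}" using Sk by (auto simp: inner_commute)
  moreover have "{y. inner w y = k} \<noteq> UNIV"
  proof
    assume "{y. inner w y = k} = UNIV"
    then have "inner w 0 = k" "inner w w = k" by blast+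
    then show False using w(1) by simp
  qed
  ultimately show False using sub affine_hyperplane[of w k] unfolding substantial_def by blast
qed

lemma superconformal_iff_isotropic_2:
  assumes conn: "connected (UNIV :: 'm set)" and sub: "substantial f" and n: "CARD('n) \<ge> 5"
    and reg: "regular_surface A f"
  shows "superconformal A g \<longleftrightarrow> isotropic A 2 f"
proof
  assume "isotropic A 2 f"
  then have B: "iso1_patch.B (f \<circ> x) z \<odot> iso1_patch.B (f \<circ> x) z = 0 \<and> iso1_patch.B (f \<circ> x) z \<noteq> 0"
    if "iso_chart W x" "z \<in> W" for W x z
    using that unfolding B_iff_isotropic_2 by blast
  show "superconformal A g"
    unfolding superconformal_iff_charts
  proof (intro allI impI, elim conjE)
    fix W x z assume ic: "iso_chart W x" and z: "z \<in> W"
    interpret p: pedal_surface_patch W "f \<circ> x" q "g \<circ> x" by (rule patch[OF ic])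
    show "is_circle {sff (g \<circ> x) X X z |X. induced_metric (g \<circ> x) z X X = 1}"
      unfolding p.superconformal_iff[OF z] using p.superconformal_of_isotropic[OF z] B[OF ic z] by blast
  qed
next
  assume sc: "superconformal A g"
  have Bn: "iso1_patch.B (f \<circ> x) z \<odot> iso1_patch.B (f \<circ> x) z = 0" if ic: "iso_chart W x" and z: "z \<in> W" for W x z
  proof -
    interpret p: pedal_surface_patch W "f \<circ> x" q "g \<circ> x" by (rule patch[OF ic])
    have "(p.a z)\<^sup>2 * (p.B z \<odot> p.B z) = 0" if "z \<in> W" for z
      using sc ic that p.superconformal_iff[OF that] p.Gh_dot(3)[OF that] unfolding superconformal_iff_charts by auto
    then show ?thesis by (rule p.B_null_of_dense[OF _ z])
  qed
  obtain d where d: "\<And>W x z. (W, x) \<in> A \<Longrightarrow> z \<in> W \<Longrightarrow> dim (kth_normal_space (f \<circ> x) 2 z) = d"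
  proof -
    have "\<exists>d. \<forall>(W, x)\<in>A. \<forall>z\<in>W. dim (kth_normal_space (f \<circ> x) 2 z) = d"
      using reg[unfolded regular_surface_def, THEN spec[of _ 2], THEN mp] by simp
    then show ?thesis using that by blast
  qed
  \<comment> \<open>The constant dimension is 0 at zeros of \<open>B\<close> and 2 elsewhere, so
    \<open>B\<close> vanishes everywhere or nowhere.\<close>
  have dB: "d = (if iso1_patch.B (f \<circ> x) z = 0 then 0 else 2)" if ic: "iso_chart W x" and z: "z \<in> W" for W x z
  proof -
    interpret p: pedal_surface_patch W "f \<circ> x" q "g \<circ> x" by (rule patch[OF ic])
    show ?thesis using p.dim_kth_normal_space_2[OF z Bn[OF ic z]] d[of W x z] ic z by (simp add: iso_chart_def)
  qed
  obtain W x z where "iso_chart W x" "z \<in> W" "iso1_patch.B (f \<circ> x) z \<noteq> 0"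
    using B_nonzero_somewhere[OF conn sub n] by blast
  then have "d = 2" using dB by simp
  then show "isotropic A 2 f"
    unfolding B_iff_isotropic_2 using Bn dB by fastforce
qed

definition metric_ratio :: "(real^2 \<Rightarrow> 'm) \<Rightarrow> real^2 \<Rightarrow> real \<Rightarrow> bool" where
  "metric_ratio x z r \<longleftrightarrow> r > 0 \<and> (\<forall>v w. induced_metric (g \<circ> x) z v w = r * induced_metric (f \<circ> x) z v w)"

lemma metric_ratio_transfer:
  assumes W: "(W, x) \<in> A" "z \<in> W" and V: "(V, y) \<in> A" "z' \<in> V" and eq: "x z = y z'" and r: "metric_ratio x z r"
  shows "metric_ratio y z' r"
proof -
  interpret rf: reparametrization W "{z \<in> V. y z \<in> x ` W}" "f \<circ> x" "\<lambda>z. inv_into W x (y z)" "f \<circ> y"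
    by (rule reparametrizationI[OF imm_f W(1) V(1)])
  interpret rg: reparametrization W "{z \<in> V. y z \<in> x ` W}" "g \<circ> x" "\<lambda>z. inv_into W x (y z)" "g \<circ> y"
    by (rule reparametrizationI[OF imm_g W(1) V(1)])
  have z': "z' \<in> {z \<in> V. y z \<in> x ` W}" using V W eq by (metis (mono_tags, lifting) imageI mem_Collect_eq)
  have "inv_into W x (y z') = z" using eq W(2) chart(4)[OF W(1)] by (metis inv_into_f_f)
  then show ?thesis
    using r rf.induced_metric_u'[OF z'] rg.induced_metric_u'[OF z'] by (simp add: metric_ratio_def)
qed

lemma conformal: "conformal_metrics A f g"
proof -
  \<comment> \<open>The factor must be the same in all charts around the point before it can be
    chosen as a function on the surface.\<close>
  have ex: "\<exists>r. \<forall>V y z. (V, y) \<in> A \<and> z \<in> V \<and> y z = p \<longrightarrow> metric_ratio y z r" for p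
  proof -
    obtain W x z0 where ic: "iso_chart W x" "z0 \<in> W" "x z0 = p" using iso_chart_ex by blast
    interpret p: pedal_surface_patch W "f \<circ> x" q "g \<circ> x" by (rule patch[OF ic(1)])
    have W: "(W, x) \<in> A" using ic(1) by (simp add: iso_chart_def)
    have mr: "metric_ratio x z0 (Re (p.Lam z0) / Re (p.lam z0))"
      using p.lam(2)[OF ic(2)] p.Lam(2)[OF ic(2)]
      by (simp add: metric_ratio_def p.induced_metric_g[OF ic(2)] p.induced_metric_eq[OF ic(2)])
    show ?thesis
    proof (intro exI allI impI)
      fix V y z assume a: "(V, y) \<in> A \<and> z \<in> V \<and> y z = p"
      show "metric_ratio y z (Re (p.Lam z0) / Re (p.lam z0))"
        by (rule metric_ratio_transfer[OF W ic(2) _ _ _ mr]) (use a ic(3) in auto)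
    qed
  qed
  then obtain \<rho> where \<rho>: "\<And>p V y z. (V, y) \<in> A \<Longrightarrow> z \<in> V \<Longrightarrow> y z = p \<Longrightarrow> metric_ratio y z (\<rho> p)"
    by metis
  have "\<rho> p > 0" for p using chart_ex[of p] \<rho> unfolding metric_ratio_def by blast
  then show ?thesis
    unfolding conformal_metrics_def using \<rho> unfolding metric_ratio_def by (intro exI[of _ \<rho>]) fast
qed

lemma not_locally_conformally_minimal:
  assumes B0: "\<And>W x z. iso_chart W x \<Longrightarrow> z \<in> W \<Longrightarrow> iso1_patch.B (f \<circ> x) z \<noteq> 0"
  shows "\<not> locally_conformally_minimal A g"
proof
  assume "locally_conformally_minimal A g"
  then obtain U T where U: "open U" "U \<noteq> {}" "T \<in> moebius_group" "\<And>p. p \<in> U \<Longrightarrow> T (Some (g p)) \<noteq> None"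
      "minimal_on A U (\<lambda>p. the (T (Some (g p))))"
    unfolding locally_conformally_minimal_def by blast
  obtain p where p: "p \<in> U" using U by blast
  obtain W x z0 where ic: "iso_chart W x" "z0 \<in> W" "x z0 = p" using iso_chart_ex by blast
  have W: "(W, x) \<in> A" using ic by (simp add: iso_chart_def)
  interpret p: pedal_surface_patch W "f \<circ> x" q "g \<circ> x" by (rule patch[OF ic(1)])
  let ?S = "W \<inter> x -` U"
  have S: "open ?S" "?S \<subseteq> W" "?S \<noteq> {}"
    using continuous_open_preimage[OF chart(3)[OF W] chart(1)[OF W] U(1)] ic p by auto
  have "minimal_patch ?S ((\<lambda>p. the (T (Some (g p)))) \<circ> x)"
    using U(5) W S(1) unfolding minimal_on_def immersion_on_def by unfold_locales fast+
  moreover have "\<not> minimal_patch ?S (\<lambda>z. the (T (Some ((g \<circ> x) z))))"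
    by (rule p.not_conformally_minimal[OF S _ U(3)]) (use B0[OF ic(1)] U(4) in auto)
  ultimately show False by (simp add: o_def)
qed

lemma not_S_Willmore:
  assumes B0: "\<And>W x z. iso_chart W x \<Longrightarrow> z \<in> W \<Longrightarrow> iso1_patch.B (f \<circ> x) z \<noteq> 0"
  shows "\<not> S_Willmore A g"
proof
  assume sw: "S_Willmore A g"
  obtain W x z where ic: "iso_chart W x" "z \<in> W" using iso_chart_ex by blast
  have W: "(W, x) \<in> A" using ic by (simp add: iso_chart_def)
  interpret p: pedal_surface_patch W "f \<circ> x" q "g \<circ> x" by (rule patch[OF ic(1)])
  have "\<exists>c. cnormal_connection (g \<circ> x) delbar (csff (g \<circ> x) del del) z = c *s csff (g \<circ> x) del del z"
    using sw W ic(2) p.isothermal_g unfolding S_Willmore_def by fast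
  then show False using p.not_S_Willmore_at[OF ic(2) B0[OF ic]] by blast
qed

end

theorem theorem1:
  fixes A :: "'m::{t2_space, second_countable_topology} param set"
    and f g :: "'m \<Rightarrow> real^'n"
    and q :: "real^'n"
  assumes "CARD('n) \<ge> 6"
    and "oriented_surface A" and "connected (UNIV :: 'm set)"
    and "immersion_on A UNIV f" and "regular_surface A f" and "substantial f" and "isotropic A 1 f"
    and "pedal_surface A f q g" and "immersion_on A UNIV g"
  shows "(superconformal A g \<longleftrightarrow> isotropic A 2 f) \<and>
    (superconformal A g \<longrightarrow>
       conformal_metrics A f g \<and>
       \<not> locally_conformally_minimal A g \<and>
       \<not> S_Willmore A g)"
proof -
  interpret pedal_setting A f g q
    using assms by unfold_locales
  have iff: "superconformal A g \<longleftrightarrow> isotropic A 2 f"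
    by (rule superconformal_iff_isotropic_2[OF assms(3,6) _ assms(5)]) (use assms(1) in simp)
  have "iso1_patch.B (f \<circ> x) z \<noteq> 0" if "superconformal A g" "iso_chart W x" "z \<in> W" for W x z
    using that iff B_iff_isotropic_2 by blast
  then show ?thesis
    using iff conformal not_locally_conformally_minimal not_S_Willmore by blast
qed

end
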